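(* Let $\varphi:\mathcal{L}_0\to\mathbb{C}$ be a linear map, with Verma module $\bar V(\varphi)$ and irreducible highest weight module $V(\varphi)$ over the loop-Virasoro algebra $\mathcal{L}=\mathrm{Vir}\otimes\mathbb{C}[t^{\pm1}]$. (a) The weight module $V(\varphi)$ is a Harish-Chandra module if and only if there are exp-polynomial functions $f(k),g(k)$ such that $\varphi(d_0\otimes t^k)=f(k)$ and $\varphi(c\otimes t^k)=g(k)$ for all $k\in\mathbb{Z}$. (b) The Verma module $\bar V(\varphi)$ is reducible if and only if there is an exp-polynomial function $f(k)$ such that $\varphi(d_0\otimes t^k)=f(k)$ for all $k\in\mathbb{Z}$.
   Context: The Virasoro algebra $\mathrm{Vir}$ is the complex Lie algebra with basis $\{c,d_i : i\in\mathbb{Z}\}$ and brackets $[d_m,d_n]=(n-m)d_{m+n}+\delta_{m,-n}\frac{m^3-m}{12}c$, $[d_m,c]=0$. The loop-Virasoro algebra is $\mathcal{L}=\mathrm{Vir}\otimes\mathbb{C}[t^{\pm1}]$ with brackets $[d_i\otimes t^j,d_k\otimes t^l]=(k-i)\,d_{i+k}\otimes t^{j+l}+\delta_{i+k,0}\frac{i^3-i}{12}\,c\otimes t^{j+l}$, and with $c\otimes t^l$ central. Let $\mathcal{L}_i=(\mathbb{C}d_i\oplus\delta_{i,0}\mathbb{C}c)\otimes\mathbb{C}[t^{\pm1}]$ and $\mathcal{L}_+=\bigoplus_{i>0}\mathcal{L}_i$. For a linear map $\varphi:\mathcal{L}_0\to\mathbb{C}$, let $\mathbb{C}v_0$ be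 the one-dimensional $(\mathcal{L}_0+\mathcal{L}_+)$-module with $\mathcal{L}_+v_0=0$ and $xv_0=\varphi(x)v_0$ for $x\in\mathcal{L}_0$. The Verma module is $\bar V(\varphi)=U(\mathcal{L})\otimes_{U(\mathcal{L}_0+\mathcal{L}_+)}\mathbb{C}v_0$, and $V(\varphi)$ is its quotient by its unique maximal proper submodule. A Harish-Chandra module is a module which is the sum of its weight spaces (eigenspaces of $d_0=d_0\otimes 1$), all of which are finite-dimensional. The algebra of exp-polynomial functions in the integer variable $k$ is the $\mathbb{C}$-algebra of functions $\mathbb{Z}\to\mathbb{C}$ generated by the function $k\mapsto k$ and the functions $k\mapsto a^k$ for $a\in\mathbb{C}\setminus\{0\}$. *)

theory Defs
  imports Complex_Main "HOL-Library.Poly_Mapping" "HOL-Algebra.QuotRing" "HOL-Algebra.Module"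
begin

definition complex_field :: "complex ring" where
  "complex_field = \<lparr>carrier = UNIV, mult = (*), one = 1, zero = 0, add = (+)\<rparr>"

definition scal :: "complex \<Rightarrow> ('a \<Rightarrow>\<^sub>0 complex) \<Rightarrow> ('a \<Rightarrow>\<^sub>0 complex)" where
  "scal c = Poly_Mapping.map ((*) c)"

text \<open>The linear extension of a map that is given on the basis.\<close>

definition lin_ext :: "('a \<Rightarrow> ('b \<Rightarrow>\<^sub>0 complex)) \<Rightarrow> ('a \<Rightarrow>\<^sub>0 complex) \<Rightarrow> ('b \<Rightarrow>\<^sub>0 complex)" where
  "lin_ext h p = (\<Sum>a\<in>Poly_Mapping.keys p. scal (Poly_Mapping.lookup p a) (h a))"

text \<open>The record type of modules in HOL-Algebra extends the one of rings.  The multiplicative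
  fields play no role in a module and are left undefined.\<close>

definition free_space :: "'a set \<Rightarrow> (complex, 'a \<Rightarrow>\<^sub>0 complex) module" where
  "free_space S = \<lparr>carrier = {p. Poly_Mapping.keys p \<subseteq> S}, mult = undefined, one = undefined,
     zero = 0, add = (+), smult = scal\<rparr>"

text \<open>Quotient of a vector space by a subspace, or of an algebra by an ideal; as in
  \<^const>\<open>rcoset_mult\<close>, an operation on cosets is the union of the cosets of its values
  on representatives (which all coincide when the operation is well defined).\<close>

definition quot_module :: "(complex, 'v, 'z) module_scheme \<Rightarrow> 'v set \<Rightarrow> (complex, 'v set) module" where
  "quot_module V N = ring.extend (V Quot N)
     (module.fields (\<lambda>c X. \<Union>x\<in>X. N +>\<^bsub>V\<^esub> (c \<odot>\<^bsub>V\<^esub> x)))"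

definition subspace_generated :: "(complex, 'v, 'z) module_scheme \<Rightarrow> 'v set \<Rightarrow> 'v set" where
  "subspace_generated V S = \<Inter>{N. submodule N complex_field V \<and> S \<subseteq> N}"

definition finite_dimensional :: "(complex, 'v, 'z) module_scheme \<Rightarrow> 'v set \<Rightarrow> bool" where
  "finite_dimensional V W \<longleftrightarrow>
     (\<exists>B. finite B \<and> B \<subseteq> W \<and> (\<forall>w\<in>W. \<exists>c. w = (\<Oplus>\<^bsub>V\<^esub>b\<in>B. c b \<odot>\<^bsub>V\<^esub> b)))"

text \<open>\<open>M \<otimes>\<^sub>A N\<close> for a right \<open>A\<close>-module \<open>M\<close> (action \<open>r\<close>) and a left \<open>A\<close>-module \<open>N\<close>
  (action \<open>l\<close>), as the quotient of the vector space with basis \<open>M \<times> N\<close> by the bilinearity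
  relations and the relations \<open>m a \<otimes> n = m \<otimes> a n\<close>.\<close>

abbreviation pure :: "'m \<Rightarrow> 'n \<Rightarrow> ('m \<times> 'n \<Rightarrow>\<^sub>0 complex)" where
  "pure m n \<equiv> Poly_Mapping.single (m, n) 1"

definition tensor_relations ::
  "('a, 'y) ring_scheme \<Rightarrow> (complex, 'm, 'z) module_scheme \<Rightarrow> ('m \<Rightarrow> 'a \<Rightarrow> 'm)
    \<Rightarrow> (complex, 'n, 'w) module_scheme \<Rightarrow> ('a \<Rightarrow> 'n \<Rightarrow> 'n) \<Rightarrow> ('m \<times> 'n \<Rightarrow>\<^sub>0 complex) set" where
  "tensor_relations A M r N l =
     {pure (m \<oplus>\<^bsub>M\<^esub> m') n - pure m n - pure m' n | m m' n.
        m \<in> carrier M \<and> m' \<in> carrier M \<and> n \<in> carrier N}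
   \<union> {pure m (n \<oplus>\<^bsub>N\<^esub> n') - pure m n - pure m n' | m n n'.
        m \<in> carrier M \<and> n \<in> carrier N \<and> n' \<in> carrier N}
   \<union> {pure (c \<odot>\<^bsub>M\<^esub> m) n - scal c (pure m n) | c m n. m \<in> carrier M \<and> n \<in> carrier N}
   \<union> {pure m (c \<odot>\<^bsub>N\<^esub> n) - scal c (pure m n) | c m n. m \<in> carrier M \<and> n \<in> carrier N}
   \<union> {pure (r m a) n - pure m (l a n) | m a n.
        m \<in> carrier M \<and> a \<in> carrier A \<and> n \<in> carrier N}"

definition tensor_null ::
  "('a, 'y) ring_scheme \<Rightarrow> (complex, 'm, 'z) module_scheme \<Rightarrow> ('m \<Rightarrow> 'a \<Rightarrow> 'm)
    \<Rightarrow> (complex, 'n, 'w) module_scheme \<Rightarrow> ('a \<Rightarrow> 'n \<Rightarrow> 'n) \<Rightarrow> ('m \<times> 'n \<Rightarrow>\<^sub>0 complex) set" where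
  "tensor_null A M r N l =
     subspace_generated (free_space (carrier M \<times> carrier N)) (tensor_relations A M r N l)"

definition tensor_product ::
  "('a, 'y) ring_scheme \<Rightarrow> (complex, 'm, 'z) module_scheme \<Rightarrow> ('m \<Rightarrow> 'a \<Rightarrow> 'm)
    \<Rightarrow> (complex, 'n, 'w) module_scheme \<Rightarrow> ('a \<Rightarrow> 'n \<Rightarrow> 'n)
    \<Rightarrow> (complex, ('m \<times> 'n \<Rightarrow>\<^sub>0 complex) set) module" where
  "tensor_product A M r N l =
     quot_module (free_space (carrier M \<times> carrier N)) (tensor_null A M r N l)"

text \<open>\<open>Dt i j\<close> stands for $d_i \otimes t^j$ and \<open>Ct j\<close> for $c \otimes t^j$; these elements
  form a basis of $\mathrm{Vir} \otimes \mathbb{C}[t^{\pm 1}]$.\<close>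

datatype lvb = Dt int int | Ct int

type_synonym lvir = "lvb \<Rightarrow>\<^sub>0 complex"

abbreviation d_t :: "int \<Rightarrow> int \<Rightarrow> lvir" where "d_t i j \<equiv> Poly_Mapping.single (Dt i j) 1"
abbreviation c_t :: "int \<Rightarrow> lvir" where "c_t j \<equiv> Poly_Mapping.single (Ct j) 1"

fun lvb_bracket :: "lvb \<Rightarrow> lvb \<Rightarrow> lvir" where
  "lvb_bracket (Dt i j) (Dt k l) =
     scal (of_int (k - i)) (d_t (i + k) (j + l))
     + (if i + k = 0 then scal (of_int (i ^ 3 - i) / 12) (c_t (j + l)) else 0)"
| "lvb_bracket (Ct _) _ = 0"
| "lvb_bracket _ (Ct _) = 0"

definition lv_bracket :: "lvir \<Rightarrow> lvir \<Rightarrow> lvir" where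
  "lv_bracket x y = lin_ext (\<lambda>a. lin_ext (lvb_bracket a) y) x"

fun lvb_degree :: "lvb \<Rightarrow> int" where
  "lvb_degree (Dt i j) = i"
| "lvb_degree (Ct j) = 0"

text \<open>The subspaces $\mathcal{L}_0$ and $\mathcal{L}_0 + \mathcal{L}_+$ are spanned by basis
  elements of degree 0 and of nonnegative degree, respectively.\<close>

definition lv_zero_part :: "lvir set" where
  "lv_zero_part = {x. Poly_Mapping.keys x \<subseteq> {b. lvb_degree b = 0}}"

definition lvb_nonneg :: "lvb set" where
  "lvb_nonneg = {b. 0 \<le> lvb_degree b}"

text \<open>The tensor algebra of a vector space with basis \<open>'b\<close> is the monoid algebra of the
  free monoid on \<open>'b\<close>.  The multiplication of \<^typ>\<open>'k \<Rightarrow>\<^sub>0 complex\<close> uses an additively written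
  monoid of keys; hence concatenation is written \<open>+\<close> here.\<close>

datatype 'b free_mon = Mon (letters: "'b list")

instantiation free_mon :: (type) monoid_add
begin

definition zero_free_mon :: "'b free_mon" where
  "zero_free_mon = Mon []"

definition plus_free_mon :: "'b free_mon \<Rightarrow> 'b free_mon \<Rightarrow> 'b free_mon" where
  "plus_free_mon v w = Mon (letters v @ letters w)"

instance
  by standard (simp_all add: zero_free_mon_def plus_free_mon_def)

end

type_synonym lv_tensor = "lvb free_mon \<Rightarrow>\<^sub>0 complex"

definition tensor_algebra :: "'b set \<Rightarrow> (complex, 'b free_mon \<Rightarrow>\<^sub>0 complex) module" where
  "tensor_algebra S =
     (free_space {w. set (letters w) \<subseteq> S}) \<lparr>mult := (*), one := 1\<rparr>"

definition deg1 :: "('b \<Rightarrow>\<^sub>0 complex) \<Rightarrow> ('b free_mon \<Rightarrow>\<^sub>0 complex)" where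
  "deg1 = lin_ext (\<lambda>b. Poly_Mapping.single (Mon [b]) 1)"

text \<open>\<open>lv_env S\<close> is the universal enveloping algebra of the Lie subalgebra spanned by
  a set \<open>S\<close> of basis elements; the span is assumed to be closed under the bracket.\<close>

definition lv_env_ideal :: "lvb set \<Rightarrow> lv_tensor set" where
  "lv_env_ideal S = Idl\<^bsub>tensor_algebra S\<^esub>
     {deg1 x * deg1 y - deg1 y * deg1 x - deg1 (lv_bracket x y) | x y.
        Poly_Mapping.keys x \<subseteq> S \<and> Poly_Mapping.keys y \<subseteq> S}"

definition lv_env :: "lvb set \<Rightarrow> (complex, lv_tensor set) module" where
  "lv_env S = quot_module (tensor_algebra S) (lv_env_ideal S)"

abbreviation U_lv :: "(complex, lv_tensor set) module" where
  "U_lv \<equiv> lv_env UNIV"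

definition lv_incl :: "lvir \<Rightarrow> lv_tensor set" where
  "lv_incl x = lv_env_ideal UNIV +>\<^bsub>tensor_algebra UNIV\<^esub> deg1 x"

text \<open>The homomorphism from \<open>lv_env S\<close> to \<open>U_lv\<close> that is induced by the inclusion.\<close>

definition lv_env_incl :: "lv_tensor set \<Rightarrow> lv_tensor set" where
  "lv_env_incl X = (\<Union>p\<in>X. lv_env_ideal UNIV +>\<^bsub>tensor_algebra UNIV\<^esub> p)"

record 'v lv_module = "(complex, 'v) module" +
  act :: "lvir \<Rightarrow> 'v \<Rightarrow> 'v"

definition lv_submodule :: "'v set \<Rightarrow> 'v lv_module \<Rightarrow> bool" where
  "lv_submodule N V \<longleftrightarrow>
     submodule N complex_field V \<and> (\<forall>x. \<forall>v\<in>N. act V x v \<in> N)"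

definition lv_quotient :: "'v lv_module \<Rightarrow> 'v set \<Rightarrow> 'v set lv_module" where
  "lv_quotient V N = module.extend (quot_module V N)
     (lv_module.fields (\<lambda>x X. \<Union>v\<in>X. N +>\<^bsub>V\<^esub> act V x v))"

definition lv_reducible :: "'v lv_module \<Rightarrow> bool" where
  "lv_reducible V \<longleftrightarrow> (\<exists>N. lv_submodule N V \<and> N \<noteq> {\<zero>\<^bsub>V\<^esub>} \<and> N \<noteq> carrier V)"

definition maximal_proper_submodule :: "'v set \<Rightarrow> 'v lv_module \<Rightarrow> bool" where
  "maximal_proper_submodule N V \<longleftrightarrow>
     lv_submodule N V \<and> N \<noteq> carrier V \<and>
     (\<forall>N'. lv_submodule N' V \<and> N' \<noteq> carrier V \<and> N \<subseteq> N' \<longrightarrow> N' = N)"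

definition weight_space :: "'v lv_module \<Rightarrow> complex \<Rightarrow> 'v set" where
  "weight_space V \<mu> = {v \<in> carrier V. act V (d_t 0 0) v = \<mu> \<odot>\<^bsub>V\<^esub> v}"

definition harish_chandra :: "'v lv_module \<Rightarrow> bool" where
  "harish_chandra V \<longleftrightarrow>
     (\<forall>v\<in>carrier V. \<exists>F w. finite F \<and> (\<forall>\<mu>\<in>F. w \<mu> \<in> weight_space V \<mu>)
        \<and> v = (\<Oplus>\<^bsub>V\<^esub>\<mu>\<in>F. w \<mu>))
     \<and> (\<forall>\<mu>. finite_dimensional V (weight_space V \<mu>))"

definition lv_zero_form :: "(lvir \<Rightarrow> complex) \<Rightarrow> bool" where
  "lv_zero_form \<phi> \<longleftrightarrow>
     (\<forall>x\<in>lv_zero_part. \<forall>y\<in>lv_zero_part. \<phi> (x + y) = \<phi> x + \<phi> y)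
     \<and> (\<forall>c. \<forall>x\<in>lv_zero_part. \<phi> (scal c x) = c * \<phi> x)"

text \<open>The one-dimensional $(\mathcal{L}_0 + \mathcal{L}_+)$-module $\mathbb{C} v_0$ is realised
  on \<^typ>\<open>complex\<close> with \<open>v\<^sub>0 = 1\<close>.  A basis element \<open>b\<close> acts on it as the
  scalar \<open>hw_scalar \<phi> b\<close>, and a word in basis elements as the product of the scalars of its letters.\<close>

definition hw_space :: "(complex, complex) module" where
  "hw_space = ring.extend complex_field (module.fields (*))"

definition hw_scalar :: "(lvir \<Rightarrow> complex) \<Rightarrow> lvb \<Rightarrow> complex" where
  "hw_scalar \<phi> b = (if lvb_degree b = 0 then \<phi> (Poly_Mapping.single b 1) else 0)"

definition hw_eval :: "(lvir \<Rightarrow> complex) \<Rightarrow> lv_tensor \<Rightarrow> complex" where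
  "hw_eval \<phi> p = (\<Sum>w\<in>Poly_Mapping.keys p. Poly_Mapping.lookup p w * prod_list (map (hw_scalar \<phi>) (letters w)))"

text \<open>The action of a coset is read off from any of its representatives.\<close>

definition hw_act :: "(lvir \<Rightarrow> complex) \<Rightarrow> lv_tensor set \<Rightarrow> complex \<Rightarrow> complex" where
  "hw_act \<phi> X z = the_elem (hw_eval \<phi> ` X) * z"

type_synonym verma_vec = "(lv_tensor set \<times> complex \<Rightarrow>\<^sub>0 complex) set"

text \<open>$\mathcal{L}$ acts on the tensor product by left multiplication on the factor
  $U(\mathcal{L})$.\<close>

definition lv_verma :: "(lvir \<Rightarrow> complex) \<Rightarrow> verma_vec lv_module" where
  "lv_verma \<phi> =
     (let B = lv_env lvb_nonneg;
          r = (\<lambda>u X. u \<otimes>\<^bsub>U_lv\<^esub> lv_env_incl X);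
          K = tensor_null B U_lv r hw_space (hw_act \<phi>)
      in module.extend (tensor_product B U_lv r hw_space (hw_act \<phi>))
           (lv_module.fields (\<lambda>x X.
              \<Union>p\<in>X. K +>\<^bsub>free_space (carrier U_lv \<times> carrier hw_space)\<^esub>
                lin_ext (\<lambda>(u, z). pure (lv_incl x \<otimes>\<^bsub>U_lv\<^esub> u) z) p)))"

definition lv_irreducible_hw :: "(lvir \<Rightarrow> complex) \<Rightarrow> verma_vec set lv_module" where
  "lv_irreducible_hw \<phi> =
     lv_quotient (lv_verma \<phi>) (THE N. maximal_proper_submodule N (lv_verma \<phi>))"

inductive_set exp_polynomial :: "(int \<Rightarrow> complex) set" where
  var: "(\<lambda>k. of_int k) \<in> exp_polynomial"
| exp: "a \<noteq> 0 \<Longrightarrow> (\<lambda>k. a powi k) \<in> exp_polynomial"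
| add: "f \<in> exp_polynomial \<Longrightarrow> g \<in> exp_polynomial \<Longrightarrow> (\<lambda>k. f k + g k) \<in> exp_polynomial"
| scale: "f \<in> exp_polynomial \<Longrightarrow> (\<lambda>k. c * f k) \<in> exp_polynomial"
| mult: "f \<in> exp_polynomial \<Longrightarrow> g \<in> exp_polynomial \<Longrightarrow> (\<lambda>k. f k * g k) \<in> exp_polynomial"

end

theory Submission
  imports Defs "HOL-Library.Multiset" "HOL-Library.Product_Lexorder" "HOL-Library.Function_Algebras"
    "HOL-Computational_Algebra.Fundamental_Theorem_Algebra"
begin

text \<open>A function on the integers is exp-polynomial iff it satisfies a linear recurrence with constant
  coefficients. By the theorem of Poincare, Birkhoff and Witt (rewriting of words in basis elements,
  with the Jacobi identity giving confluence) the Verma module has a basis of monomials in the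
  $d_{-n} \otimes t^j$, $n > 0$. If $\sum_i p_i \varphi(d_0 \otimes t^{k+i}) = 0$ for all $k$, then
  $\sum_i p_i d_{-1} \otimes t^i$ takes the highest weight vector to a singular vector; conversely,
  comparing leading monomials in the action of the $d_1 \otimes t^k$ on a singular vector produces
  such a recurrence. The irreducible quotient is the image of the Verma module in the functions
  $u \mapsto$ (coefficient of the highest weight vector in $u \cdot m$) on words $u$. If both
  $\varphi(d_0 \otimes t^k)$ and $\varphi(c \otimes t^k)$ are annihilated by $p$, so is this
  image by $\mathrm{Vir} \otimes (p)$, and finitely many exponents suffice in each weight; linear
  dependence in the weights $\varphi(d_0) - 1$ and $\varphi(d_0) - 2$ gives the converse.\<close>


section \<open>Linear algebra of finitely supported functions\<close>

text \<open>Below the top every weight space of the Verma module is infinite-dimensional, since all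
  powers of t occur. No determinant of a contravariant form is available to decide reducibility, and
  the free exponent k of d_1 t^k takes its place: for suitable k a letter created by the action has
  an exponent found nowhere else, so the terms that contain it have to cancel among themselves. The
  roles of d_0 and c come from the central term (n^3 - n)/12. It vanishes for n = 1, so vectors
  built from letters d_{-1} t^j see only the values on d_0. It is 1/2 for n = 2, so the second
  weight recovers the values on c once those on d_0 are known. A polynomial p acts on two-sided
  sequences through the shift, as Laurent polynomials in t do. There t is a unit, so p may be taken
  with nonzero constant term; then the powers 1, ..., t^(deg p - 1) span all powers of t modulo p,
  which bounds the exponents that are needed. The modules of the statement consist of cosets, the
  irreducible one of cosets of cosets. Every property is therefore carried along isomorphisms to
  modules of finitely supported functions or of functions on words.\<close>

abbreviation (input) "keys \<equiv> Poly_Mapping.keys"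
abbreviation (input) "lookup \<equiv> Poly_Mapping.lookup"
abbreviation (input) "single \<equiv> Poly_Mapping.single"

lemma lookup_scal [simp]: "lookup (scal c p) a = c * lookup p a"
  unfolding scal_def by (simp add: Poly_Mapping.map.rep_eq when_def)

lemma scal_eqs [simp]:
  "scal c 0 = 0" "scal 0 p = 0" "scal 1 p = p" "scal a (scal b p) = scal (a * b) p"
  "scal c (- p) = - scal c p"
  by (rule poly_mapping_eqI; simp add: lookup_minus)+

lemma scal_add: "scal c (p + q) = scal c p + scal c q"
  and scal_diff: "scal c (p - q) = scal c p - scal c q"
  and scal_add_left: "scal (a + b) p = scal a p + scal b p"
  and scal_minus_left: "scal (- a) p = - scal a p"
  by (rule poly_mapping_eqI; simp add: lookup_add lookup_minus algebra_simps)+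

lemma scal_sum: "scal c (sum f A) = (\<Sum>a\<in>A. scal c (f a))"
  by (induction A rule: infinite_finite_induct) (auto simp: scal_add)

lemma scal_single [simp]: "scal c (single a b) = single a (c * b)"
  by (rule poly_mapping_eqI) (simp add: lookup_single when_def)

lemma keys_scal: "keys (scal c p) \<subseteq> keys p"
  by (auto simp: in_keys_iff)

interpretation pm: vector_space scal
  by unfold_locales (simp_all add: scal_add scal_add_left)

lemma poly_mapping_expand:
  assumes "finite S" "keys p \<subseteq> S"
  shows "p = (\<Sum>a\<in>S. single a (lookup p a))"
  using assms
  by (intro poly_mapping_eqI) (auto simp: lookup_sum lookup_single when_def in_keys_iff)

text \<open>Only basis elements in the support of \<open>p\<close> have to be treated, so a support
  condition on \<open>p\<close> reaches the \<open>single\<close> case, while scaling and addition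
  carry no side condition. This fits predicates that are linear in the vector.\<close>

lemma pm_keys_induct [case_names zero single scale add]:
  fixes p :: "'a \<Rightarrow>\<^sub>0 complex"
  assumes "P 0" "\<And>a. a \<in> keys p \<Longrightarrow> P (single a 1)"
    "\<And>c q. P q \<Longrightarrow> P (scal c q)" "\<And>q r. P q \<Longrightarrow> P r \<Longrightarrow> P (q + r)"
  shows "P p"
proof -
  have "P (\<Sum>a\<in>S. single a (lookup p a))"
    if "S \<subseteq> keys p" "finite S" for S
    using that(2,1)
  proof (induction S)
    case (insert a S)
    have "P (scal (lookup p a) (single a 1))"
      using insert.prems by (intro assms(2,3)) auto
    then show ?case using insert by (simp add: assms(4))
  qed (simp add: assms(1))
  from this[OF subset_refl] show ?thesis
    using poly_mapping_expand[OF finite_keys subset_refl, of p] by simp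
qed

lemma lin_ext_superset:
  assumes "finite S" "keys p \<subseteq> S"
  shows "lin_ext h p = (\<Sum>a\<in>S. scal (lookup p a) (h a))"
  unfolding lin_ext_def using assms by (intro sum.mono_neutral_left) (auto simp: in_keys_iff)

lemma lin_ext_add: "lin_ext h (p + q) = lin_ext h p + lin_ext h q"
proof -
  let ?S = "keys p \<union> keys q"
  have "keys (p + q) \<subseteq> ?S" by (rule keys_add)
  then show ?thesis
    by (simp add: lin_ext_superset[of ?S] lookup_add scal_add_left sum.distrib)
qed

lemma lin_ext_scal: "lin_ext h (scal c p) = scal c (lin_ext h p)"
  by (simp add: lin_ext_superset[of "keys p" "scal c p"] keys_scal)
    (simp add: lin_ext_def scal_sum)

lemma lin_ext_single [simp]: "lin_ext h (single a c) = scal c (h a)"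
  by (simp add: lin_ext_superset[of "{a}"])

lemma lin_ext_zero [simp]: "lin_ext h 0 = 0"
  by (simp add: lin_ext_def)

lemma lin_ext_minus: "lin_ext h (- p) = - lin_ext h p"
  using lin_ext_scal[of h "-1" p] by (simp add: scal_minus_left)

lemma lin_ext_diff: "lin_ext h (p - q) = lin_ext h p - lin_ext h q"
  using lin_ext_add[of h p "- q"] by (simp add: lin_ext_minus)

lemma lin_ext_sum: "lin_ext h (sum f A) = (\<Sum>a\<in>A. lin_ext h (f a))"
  by (induction A rule: infinite_finite_induct) (auto simp: lin_ext_add)

lemmas lin_ext_linear = lin_ext_add lin_ext_diff lin_ext_minus lin_ext_scal

lemma lin_ext_cong [fundef_cong]:
  "p = q \<Longrightarrow> (\<And>a. a \<in> keys q \<Longrightarrow> h a = g a) \<Longrightarrow> lin_ext h p = lin_ext g q"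
  by (simp add: lin_ext_def)

lemma lin_ext_comp:
  assumes "\<And>x y. F (x + y) = F x + F y" "\<And>c x. F (scal c x) = scal c (F x)"
  shows "F (lin_ext h p) = lin_ext (\<lambda>a. F (h a)) p"
proof -
  have "F 0 = 0" using assms(1)[of 0 0] by simp
  then show ?thesis
    by (induction p rule: pm_keys_induct) (simp_all add: lin_ext_linear assms)
qed

lemma lin_ext_pointwise_add: "lin_ext (\<lambda>a. h a + g a) p = lin_ext h p + lin_ext g p"
  by (simp add: lin_ext_def scal_add sum.distrib)

lemma lin_ext_pointwise_minus: "lin_ext (\<lambda>a. - h a) p = - lin_ext h p"
  by (simp add: lin_ext_def sum_negf)

lemma lin_ext_swap: "lin_ext (\<lambda>a. lin_ext (h a) q) p = lin_ext (\<lambda>b. lin_ext (\<lambda>a. h a b) p) q"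
  unfolding lin_ext_def scal_sum by (subst sum.swap) (simp add: mult.commute)

lemma keys_lin_ext:
  assumes "\<And>a. a \<in> keys p \<Longrightarrow> keys (h a) \<subseteq> S"
  shows "keys (lin_ext h p) \<subseteq> S"
proof
  fix x assume "x \<in> keys (lin_ext h p)"
  then obtain a where "a \<in> keys p"
    "x \<in> keys (scal (lookup p a) (h a))"
    unfolding lin_ext_def using keys_sum by fast
  then show "x \<in> S" using assms keys_scal by fast
qed

lemma scal_mult_left: "scal c p * q = scal c (p * q)"
  for p q :: "'a::monoid_add \<Rightarrow>\<^sub>0 complex"
  unfolding scal_def mult_map_scale_conv_mult by (simp add: mult.assoc)

lemma scal_mult_right: "p * scal c q = scal c (p * q)"
  for p q :: "'a::monoid_add \<Rightarrow>\<^sub>0 complex"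
proof (induction p rule: pm_keys_induct)
  case (single a)
  show ?case
  proof (induction q arbitrary: c rule: pm_keys_induct)
    case (scale d q)
    then show ?case by (simp only: scal_eqs(4))
  qed (simp_all add: mult_single scal_add distrib_left)
next
  case (scale d p)
  then show ?case by (simp add: scal_mult_left mult.commute)
qed (simp_all add: scal_add distrib_right)

section \<open>Words as a basis of the tensor algebra\<close>

abbreviation word :: "'b list \<Rightarrow> 'b free_mon \<Rightarrow>\<^sub>0 complex" where
  "word u \<equiv> single (Mon u) 1"

lemma word_append: "word (u @ v) = word u * word v"
  by (simp add: mult_single plus_free_mon_def)

lemma word_Cons: "word (x # v) = word [x] * word v"
  using word_append[of "[x]" v] by simp

lemma word_Nil: "word [] = 1"
  by (simp add: zero_free_mon_def[symmetric])

lemma deg1_linear: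
  "deg1 (p + q) = deg1 p + deg1 q" "deg1 (p - q) = deg1 p - deg1 q"
  "deg1 (- p) = - deg1 p" "deg1 (scal c p) = scal c (deg1 p)" "deg1 0 = 0"
  by (simp_all add: deg1_def lin_ext_linear)

lemma deg1_single [simp]: "deg1 (single b c) = scal c (word [b])"
  by (simp add: deg1_def)

lemma tensor_induct [case_names zero word scale add]:
  assumes "P 0" "\<And>w. Mon w \<in> keys p \<Longrightarrow> P (word w)"
    "\<And>c q. P q \<Longrightarrow> P (scal c q)" "\<And>q r. P q \<Longrightarrow> P r \<Longrightarrow> P (q + r)"
  shows "P p"
proof (rule pm_keys_induct)
  fix m assume "m \<in> keys p"
  then show "P (single m 1)" using assms(2)[of "letters m"] by simp
qed (fact assms)+

subsection \<open>Inversions\<close>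

text \<open>Second component of the termination measure of straightening: exchanging a descent keeps
  the length and lowers this number, and replacing the two letters by one letter of their bracket
  lowers the length.\<close>

fun inversions :: "'b::linorder list \<Rightarrow> nat" where
  "inversions [] = 0"
| "inversions (x # xs) = length (filter (\<lambda>y. y < x) xs) + inversions xs"

lemma inversions_swap: "y < x \<Longrightarrow> inversions (u @ y # x # v) < inversions (u @ x # y # v)"
  by (induction u) auto

lemma exists_descent:
  assumes "\<not> sorted w"
  shows "\<exists>u x y v. w = u @ x # y # v \<and> y < x"
proof -
  from assms obtain i where i: "Suc i < length w" "w ! Suc i < w ! i"
    unfolding sorted_iff_nth_Suc by (auto simp: not_le)
  then have "drop i w = w ! i # w ! Suc i # drop (Suc (Suc i)) w"
    by (simp add: Cons_nth_drop_Suc)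
  then have "w = take i w @ w ! i # w ! Suc i # drop (Suc (Suc i)) w"
    using append_take_drop_id[of i w] by simp
  with i(2) show ?thesis by (intro exI conjI)
qed

text \<open>An arbitrary choice that makes rewriting a function. That the result does not depend on
  it is the confluence statement \<open>nf_swap\<close>.\<close>

definition descent :: "'b::linorder list \<Rightarrow> 'b list \<times> 'b \<times> 'b \<times> 'b list" where
  "descent w = (SOME (u, x, y, v). w = u @ x # y # v \<and> y < x)"

lemma descent:
  assumes "\<not> sorted w" "descent w = (u, x, y, v)"
  shows "w = u @ x # y # v" "y < x"
proof -
  obtain u0 x0 y0 v0 where "w = u0 @ x0 # y0 # v0 \<and> y0 < x0"
    using exists_descent[OF assms(1)] by (elim exE)
  then have "case descent w of (u, x, y, v) \<Rightarrow> w = u @ x # y # v \<and> y < x"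
    unfolding descent_def by - (rule someI[of _ "(u0, x0, y0, v0)"], simp)
  then show "w = u @ x # y # v" "y < x" using assms by auto
qed

lemma descent_smaller:
  "y < x \<Longrightarrow> (u @ y # x # v, u @ x # y # v)
    \<in> inv_image (less_than <*lex*> less_than) (\<lambda>w. (length w, inversions w))"
  "(u @ z # v, u @ x # y # v)
    \<in> inv_image (less_than <*lex*> less_than) (\<lambda>w. (length w, inversions w))"
  by (simp_all add: inversions_swap)

section \<open>Straightening of words and the theorem of Poincare, Birkhoff and Witt\<close>

locale lie_basis =
  fixes br :: "'b::linorder \<Rightarrow> 'b \<Rightarrow> ('b \<Rightarrow>\<^sub>0 complex)"
  assumes antisym: "br x y = - br y x"
    and jacobi: "lin_ext (br x) (br y z) + lin_ext (br y) (br z x) + lin_ext (br z) (br x y) = 0"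
begin

text \<open>Rewrites a descent x y into y x + [x, y]. Values are indexed by multisets because a
  sorted word is determined by its multiset of letters.\<close>

function nf :: "'b list \<Rightarrow> ('b multiset \<Rightarrow>\<^sub>0 complex)" where
  "nf w = (if sorted w then single (mset w) 1
     else case descent w of (u, x, y, v) \<Rightarrow>
       nf (u @ y # x # v) + lin_ext (\<lambda>z. nf (u @ z # v)) (br x y))"
  by pat_completeness auto
termination
apply (relation "inv_image (less_than <*lex*> less_than) (\<lambda>w. (length w, inversions w))")
  apply (rule wf_inv_image, rule wf_lex_prod, rule wf_less_than, rule wf_less_than)
  subgoal premises p for w u q x r y v
  proof -
    have "descent w = (u, x, y, v)" using p(2-4) by simp
    then show ?thesis using descent[OF p(1)] descent_smaller(1) by metis
  qed
  subgoal premises p for w u q x r y v z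
  proof -
    have "descent w = (u, x, y, v)" using p(2-4) by simp
    then show ?thesis using descent[OF p(1)] descent_smaller(2) by metis
  qed
  done

declare nf.simps [simp del]

abbreviation reduct :: "'b list \<Rightarrow> 'b \<Rightarrow> 'b \<Rightarrow> 'b list \<Rightarrow> ('b multiset \<Rightarrow>\<^sub>0 complex)" where
  "reduct u x y v \<equiv> nf (u @ y # x # v) + lin_ext (\<lambda>z. nf (u @ z # v)) (br x y)"

lemma nf_sorted: "sorted w \<Longrightarrow> nf w = single (mset w) 1"
  by (subst nf.simps) simp

lemma nf_unsorted:
  assumes "\<not> sorted w"
  obtains u x y v where "w = u @ x # y # v" "y < x" "nf w = reduct u x y v"
proof -
  obtain u x y v where d: "descent w = (u, x, y, v)" by (metis prod.exhaust)
  have "nf w = reduct u x y v"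
    by (subst nf.simps) (simp add: assms d)
  with descent[OF assms d] that show ?thesis by blast
qed

lemma br_self: "br x x = 0"
proof -
  have "br x x + br x x = 0" using antisym[of x x] by (metis add.right_inverse)
  then have "scal 2 (br x x) = 0" using scal_add_left[of 1 1 "br x x"] by simp
  then have "scal (1/2) (scal 2 (br x x)) = 0" by simp
  then show ?thesis by simp
qed

lemma lin_ext_br: "lin_ext (\<lambda>t. br t a) p = - lin_ext (br a) p"
  using antisym lin_ext_pointwise_minus[of "br a" p] by (metis (no_types, lifting) lin_ext_cong)

text \<open>Confluence of the rewriting of words: two descents are either disjoint, or they overlap
  in a letter and the Jacobi identity closes the diamond.\<close>

lemma nf_swap_descent:
  "w = u @ x # y # v \<Longrightarrow> y < x \<Longrightarrow> nf w = reduct u x y v"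
proof (induction w arbitrary: u x y v
    rule: wf_induct_rule[OF wf_inv_image[OF wf_lex_prod[OF wf_less_than wf_less_than],
        where f = "\<lambda>w. (length w, inversions w)"]])
  case (1 w)
  note IH = 1(1)
  have smaller: "nf (u @ x # y # v) = reduct u x y v"
    if "length (u @ x # y # v) = length w" "inversions (u @ x # y # v) < inversions w" "y < x"
    for u x y v
    using that by (intro IH[of "u @ x # y # v"]) auto
  \<comment> \<open>A letter that comes out of a bracket stands in no known order to its neighbours,
    so for shorter words the exchange rule is needed without \<open>y < x\<close>. Antisymmetry
    turns the rule for y x into the one for x y.\<close>
  have shorter: "nf (u @ x # y # v) = reduct u x y v" if "length (u @ x # y # v) < length w"
    for u x y v
  proof -
    consider "y < x" | "x = y" | "x < y" by fastforce
    then show ?thesis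
    proof cases
      case 1 then show ?thesis using that by (intro IH[of "u @ x # y # v"]) auto
    next
      case 2 then show ?thesis by (simp add: br_self)
    next
      case 3
      then have "nf (u @ y # x # v) = reduct u y x v"
        using that by (intro IH[of "u @ y # x # v"]) auto
      then show ?thesis by (simp add: antisym[of x y] lin_ext_minus)
    qed
  qed
  have diamond: "reduct u x y v = reduct u' x' y' v'"
    if w: "w = u @ x # y # v" "w = u' @ x' # y' # v'" and "y < x" "y' < x'"
      and len: "length u < length u'" for u x y v u' x' y' v'
  proof (cases "length u' = Suc (length u)")
    case True
    have "take (Suc (length u)) w = u @ [x]" "drop (Suc (length u)) w = y # v" using w(1) by auto
    moreover have "take (Suc (length u)) w = u'" "drop (Suc (length u)) w = x' # y' # v'"
      using w(2) True by auto
    ultimately have eqs: "u' = u @ [x]" "x' = y" "v = y' # v'" by auto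
    \<comment> \<open>Overlapping descents: the word contains x y z with z < y < x. Both reductions
      are continued down to z y x, and the leftover terms have one letter less.\<close>
    define z where "z = y'"
    have ord: "y < x" "z < y" "z < x" using \<open>y < x\<close> \<open>y' < x'\<close> eqs z_def by auto
    let ?L = "\<lambda>h. lin_ext (\<lambda>t. nf (u @ h t @ v'))"
    define G where "G = lin_ext (\<lambda>s. nf (u @ s # v'))"
    have w': "w = u @ x # y # z # v'" using w(1) eqs z_def by simp
    have inv: "inversions (u @ y # x # z # v') < inversions w"
      "inversions (u @ y # z # x # v') < inversions w"
      "inversions (u @ x # z # y # v') < inversions w"
      "inversions (u @ z # x # y # v') < inversions w"
      using inversions_swap[OF ord(1), of u "z # v'"] inversions_swap[OF ord(3), of "u @ [y]" v']
        inversions_swap[OF ord(2), of "u @ [x]" v'] inversions_swap[OF ord(3), of "u" "y # v'"]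
      unfolding w' by auto
    have e: "nf (u @ y # x # z # v') = nf (u @ y # z # x # v') + ?L (\<lambda>t. [y, t]) (br x z)"
      "nf (u @ y # z # x # v') = nf (u @ z # y # x # v') + ?L (\<lambda>t. [t, x]) (br y z)"
      "nf (u @ x # z # y # v') = nf (u @ z # x # y # v') + ?L (\<lambda>t. [t, y]) (br x z)"
      "nf (u @ z # x # y # v') = nf (u @ z # y # x # v') + ?L (\<lambda>t. [z, t]) (br x y)"
      using smaller[of "u @ [y]" x z v'] smaller[of u y z "x # v'"]
        smaller[of u x z "y # v'"] smaller[of "u @ [z]" x y v'] inv ord w' by simp_all
    \<comment> \<open>Bracket letters end up on either side of the third letter \<open>a\<close>.
      Moving all of them to one side costs a double bracket, collected by \<open>G\<close>; these
      double brackets are the three terms of the Jacobi identity.\<close>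
    have comm: "?L (\<lambda>t. [t, a]) p = ?L (\<lambda>t. [a, t]) p - G (lin_ext (br a) p)" for a p
    proof -
      have "nf (u @ t # a # v') = nf (u @ a # t # v') + G (br t a)" for t
        using shorter[of u t a v'] w' by (simp add: G_def)
      then have "?L (\<lambda>t. [t, a]) p = ?L (\<lambda>t. [a, t]) p + lin_ext (\<lambda>t. G (br t a)) p"
        by (simp add: lin_ext_pointwise_add)
      also have "lin_ext (\<lambda>t. G (br t a)) p = G (lin_ext (\<lambda>t. br t a) p)"
        by (rule lin_ext_comp[symmetric]) (simp_all add: G_def lin_ext_linear)
      finally show ?thesis by (simp add: lin_ext_br G_def lin_ext_linear)
    qed
    have "G (lin_ext (br x) (br y z)) + G (lin_ext (br y) (br z x)) + G (lin_ext (br z) (br x y)) = 0"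
      using jacobi[of x y z] by (simp flip: lin_ext_add add: G_def)
    then have "G (lin_ext (br x) (br y z)) - G (lin_ext (br y) (br x z)) + G (lin_ext (br z) (br x y)) = 0"
      by (simp add: antisym[of z x] lin_ext_linear G_def)
    moreover have "reduct u x y v = nf (u @ y # x # z # v') + ?L (\<lambda>t. [t, z]) (br x y)"
      "reduct u' x' y' v' = nf (u @ x # z # y # v') + ?L (\<lambda>t. [x, t]) (br y z)"
      by (simp_all add: eqs z_def)
    ultimately show ?thesis
      unfolding e comm by (simp add: algebra_simps) (metis add_left_imp_eq)
  next
    case False
    with len have len': "length u + 2 \<le> length u'" by simp
    \<comment> \<open>Disjoint descents with \<open>m\<close> in between: each reduction leaves the
      other descent intact, so performing both, in either order, leads to the same four
      terms.\<close>
    define m where "m = drop (length u + 2) u'"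
    have "take (length u + 2) w = u @ [x, y]" using w(1) by simp
    moreover have "take (length u + 2) w = take (length u + 2) u'" using w(2) len' by simp
    ultimately have "u' = (u @ [x, y]) @ m"
      using append_take_drop_id[of "length u + 2" u'] unfolding m_def by metis
    then have u': "u' = u @ x # y # m" by simp
    then have v: "v = m @ x' # y' # v'" using w by simp
    have inv: "inversions (u @ y # x # m @ x' # y' # v') < inversions w"
      "inversions (u @ x # y # m @ y' # x' # v') < inversions w"
      using inversions_swap[OF \<open>y < x\<close>, of u "m @ x' # y' # v'"]
        inversions_swap[OF \<open>y' < x'\<close>, of "u @ x # y # m" v'] w u' v by auto
    have 1: "nf (u @ y # x # m @ x' # y' # v')
      = nf (u @ y # x # m @ y' # x' # v') + lin_ext (\<lambda>z'. nf (u @ y # x # m @ z' # v')) (br x' y')"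
      using smaller[of "u @ y # x # m" x' y' v'] inv \<open>y' < x'\<close> w v by simp
    have 2: "nf (u @ x # y # m @ y' # x' # v')
      = nf (u @ y # x # m @ y' # x' # v') + lin_ext (\<lambda>z. nf (u @ z # m @ y' # x' # v')) (br x y)"
      using smaller[of "u" x y "m @ y' # x' # v'"] inv \<open>y < x\<close> w v by simp
    have 3: "nf (u @ z # m @ x' # y' # v')
      = nf (u @ z # m @ y' # x' # v') + lin_ext (\<lambda>z'. nf (u @ z # m @ z' # v')) (br x' y')" for z
      using shorter[of "u @ z # m" x' y' v'] w v by simp
    have 4: "nf (u @ x # y # m @ z' # v')
      = nf (u @ y # x # m @ z' # v') + lin_ext (\<lambda>z. nf (u @ z # m @ z' # v')) (br x y)" for z'
      using shorter[of "u" x y "m @ z' # v'"] w v by simp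
    have swap: "lin_ext (\<lambda>z. lin_ext (\<lambda>z'. nf (u @ z # m @ z' # v')) (br x' y')) (br x y)
      = lin_ext (\<lambda>z'. lin_ext (\<lambda>z. nf (u @ z # m @ z' # v')) (br x y)) (br x' y')"
      by (rule lin_ext_swap)
    show ?thesis
      by (simp add: u' v 1 2 3 4 lin_ext_pointwise_add swap algebra_simps)
  qed
  have "\<not> sorted w" using 1(2,3) by (auto simp: sorted_append)
  then obtain u0 x0 y0 v0 where d: "w = u0 @ x0 # y0 # v0" "y0 < x0" "nf w = reduct u0 x0 y0 v0"
    by (rule nf_unsorted)
  consider "length u < length u0" | "length u0 < length u" | "length u = length u0" by linarith
  then show ?case
  proof cases
    case 3
    then show ?thesis using d 1(2) by simp
  qed (use diamond[OF 1(2) d(1) 1(3) d(2)] diamond[OF d(1) 1(2) d(2) 1(3)] d(3) in simp_all)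
qed

lemma nf_swap: "nf (u @ x # y # v) = reduct u x y v"
proof -
  consider "y < x" | "x = y" | "x < y" by fastforce
  then show ?thesis
  proof cases
    case 3
    then show ?thesis using nf_swap_descent[of "u @ y # x # v" u y x v]
      by (simp add: antisym[of x y] lin_ext_minus)
  qed (use nf_swap_descent in \<open>simp_all add: br_self\<close>)
qed

definition normal_form :: "('b free_mon \<Rightarrow>\<^sub>0 complex) \<Rightarrow> ('b multiset \<Rightarrow>\<^sub>0 complex)" where
  "normal_form = lin_ext (\<lambda>w. nf (letters w))"

lemma normal_form_linear:
  "normal_form (p + q) = normal_form p + normal_form q"
  "normal_form (p - q) = normal_form p - normal_form q"
  "normal_form (- p) = - normal_form p"
  "normal_form (scal c p) = scal c (normal_form p)"
  "normal_form 0 = 0"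
  by (simp_all add: normal_form_def lin_ext_linear)

lemma normal_form_word: "normal_form (word w) = nf w"
  by (simp add: normal_form_def)

definition comm_rel :: "'b \<Rightarrow> 'b \<Rightarrow> ('b free_mon \<Rightarrow>\<^sub>0 complex)" where
  "comm_rel x y = word [x] * word [y] - word [y] * word [x] - deg1 (br x y)"

lemma word_deg1_word:
  "word u * deg1 p * word v = lin_ext (\<lambda>z. word (u @ z # v)) p"
proof -
  have "word u * deg1 p * word v = lin_ext (\<lambda>z. word u * word [z] * word v) p"
    unfolding deg1_def
    by (rule lin_ext_comp) (simp_all add: distrib_left distrib_right scal_mult_left scal_mult_right)
  then show ?thesis by (simp add: mult_single plus_free_mon_def)
qed

lemma comm_rel_word:
  "word u * comm_rel x y * word v
      = word (u @ x # y # v) - word (u @ y # x # v) - lin_ext (\<lambda>z. word (u @ z # v)) (br x y)"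
  unfolding comm_rel_def word_deg1_word[symmetric]
  by (simp add: right_diff_distrib left_diff_distrib mult_single plus_free_mon_def)

lemma normal_form_comm_rel_word: "normal_form (word u * comm_rel x y * word v) = 0"
proof -
  have "word u * comm_rel x y * word v
      = word (u @ x # y # v) - word (u @ y # x # v) - lin_ext (\<lambda>z. word (u @ z # v)) (br x y)"
    by (rule comm_rel_word)
  moreover have "normal_form (lin_ext (\<lambda>z. word (u @ z # v)) (br x y))
      = lin_ext (\<lambda>z. nf (u @ z # v)) (br x y)"
    by (subst lin_ext_comp[of normal_form]) (simp_all add: normal_form_linear normal_form_word)
  ultimately show ?thesis using nf_swap[of u x y v] by (simp add: normal_form_linear normal_form_word)
qed

text \<open>The two-sided ideal generated by the commutation relations is killed, so
  \<open>normal_form\<close> factors through the enveloping algebra. As sorted words are already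
  normal, this is the linear independence half of the theorem.\<close>

theorem normal_form_comm_rel: "normal_form (p * comm_rel x y * q) = 0"
proof (induction p rule: tensor_induct)
  case (word u)
  show ?case
    by (induction q rule: tensor_induct)
      (simp_all add: normal_form_comm_rel_word normal_form_linear distrib_left scal_mult_right)
qed (simp_all add: normal_form_linear distrib_right scal_mult_left)

end

section \<open>Characters of a subalgebra and the modules induced from them\<close>

definition fun_ext :: "('a \<Rightarrow> complex) \<Rightarrow> ('a \<Rightarrow>\<^sub>0 complex) \<Rightarrow> complex" where
  "fun_ext f p = (\<Sum>a\<in>keys p. lookup p a * f a)"

lemma fun_ext_lookup:
  "fun_ext f p = lookup (lin_ext (\<lambda>a. single () (f a)) p) ()"
  by (simp add: fun_ext_def lin_ext_def lookup_sum)

lemma fun_ext_linear: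
  "fun_ext f (p + q) = fun_ext f p + fun_ext f q" "fun_ext f (p - q) = fun_ext f p - fun_ext f q"
  "fun_ext f (- p) = - fun_ext f p" "fun_ext f (scal c p) = c * fun_ext f p" "fun_ext f 0 = 0"
  by (simp_all add: fun_ext_lookup lin_ext_linear lookup_add lookup_minus)

lemma fun_ext_single [simp]: "fun_ext f (single a c) = c * f a"
  by (simp add: fun_ext_lookup)

definition char_eval :: "('b \<Rightarrow> complex) \<Rightarrow> ('b free_mon \<Rightarrow>\<^sub>0 complex) \<Rightarrow> complex" where
  "char_eval \<chi> = fun_ext (\<lambda>w. prod_list (map \<chi> (letters w)))"

lemma char_eval_linear:
  "char_eval \<chi> (p + q) = char_eval \<chi> p + char_eval \<chi> q"
  "char_eval \<chi> (p - q) = char_eval \<chi> p - char_eval \<chi> q"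
  "char_eval \<chi> (- p) = - char_eval \<chi> p" "char_eval \<chi> (scal c p) = c * char_eval \<chi> p"
  "char_eval \<chi> 0 = 0"
  by (simp_all add: char_eval_def fun_ext_linear)

lemma char_eval_word [simp]: "char_eval \<chi> (single w c) = c * prod_list (map \<chi> (letters w))"
  by (simp add: char_eval_def)

lemma char_eval_mult: "char_eval \<chi> (p * q) = char_eval \<chi> p * char_eval \<chi> q"
proof (induction p rule: tensor_induct)
  case (word u)
  show ?case
    by (induction q rule: tensor_induct)
      (simp_all add: char_eval_linear distrib_left scal_mult_right mult_single plus_free_mon_def)
qed (simp_all add: char_eval_linear distrib_right scal_mult_left)

lemma char_eval_deg1: "char_eval \<chi> (deg1 p) = fun_ext \<chi> p"
  by (induction p rule: pm_keys_induct) (simp_all add: deg1_linear char_eval_linear fun_ext_linear)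

abbreviation words_over :: "'b set \<Rightarrow> 'b free_mon set" where
  "words_over S \<equiv> {w. set (letters w) \<subseteq> S}"

text \<open>A linear section of \<open>normal_form\<close>, used to lift vectors of the models back
  to the tensor algebra, where they can be multiplied.\<close>

definition mset_word :: "('b::linorder multiset \<Rightarrow>\<^sub>0 complex) \<Rightarrow> ('b free_mon \<Rightarrow>\<^sub>0 complex)" where
  "mset_word = lin_ext (\<lambda>\<mu>. word (sorted_list_of_multiset \<mu>))"

lemma mset_word_linear:
  "mset_word (p + q) = mset_word p + mset_word q" "mset_word (p - q) = mset_word p - mset_word q"
  "mset_word (- p) = - mset_word p" "mset_word (scal c p) = scal c (mset_word p)" "mset_word 0 = 0"
  by (simp_all add: mset_word_def lin_ext_linear)

lemma mset_word_single: "sorted w \<Longrightarrow> mset_word (single (mset w) c) = scal c (word w)"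
  by (simp add: mset_word_def sorted_list_of_multiset_mset sorted_sort_id)

context lie_basis
begin

text \<open>The spanning half of the theorem as an induction rule: up to relations, sorted words
  span. Relations form a case of their own, so the rule speaks of elements of the tensor algebra and
  no quotient has to be formed. Closure of \<open>S\<close> under the bracket keeps the rewriting
  inside \<open>S\<close>.\<close>

lemma pbw_induct [consumes 2, case_names zero add scale sorted rel]:
  assumes S: "\<forall>x\<in>S. \<forall>y\<in>S. keys (br x y) \<subseteq> S"
    and p: "keys p \<subseteq> words_over S"
    and zero: "P 0" and add: "\<And>q r. P q \<Longrightarrow> P r \<Longrightarrow> P (q + r)"
    and scale: "\<And>c q. P q \<Longrightarrow> P (scal c q)"
    and sorted: "\<And>w. sorted w \<Longrightarrow> set w \<subseteq> S \<Longrightarrow> P (word w)"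
    and rel: "\<And>u x y v. set u \<subseteq> S \<Longrightarrow> x \<in> S \<Longrightarrow> y \<in> S \<Longrightarrow> set v \<subseteq> S
      \<Longrightarrow> P (word u * comm_rel x y * word v)"
  shows "P p"
proof -
  have over_S: "P (word w)" if "set w \<subseteq> S" for w
    using that
  proof (induction w rule: wf_induct_rule[OF wf_inv_image[OF wf_lex_prod[OF wf_less_than wf_less_than],
        where f = "\<lambda>w. (length w, inversions w)"]])
    case (1 w)
    show ?case
    proof (cases "sorted w")
      case True
      then show ?thesis using sorted 1(2) by blast
    next
      case False
      then obtain u x y v where d: "w = u @ x # y # v" "y < x" by (rule nf_unsorted)
      have xy: "x \<in> S" "y \<in> S" "set u \<subseteq> S" "set v \<subseteq> S" using 1(2) d by auto
      have swapped: "P (word (u @ y # x # v))"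
        using xy d inversions_swap[OF d(2)] by (intro 1(1)) auto
      have letter: "P (word (u @ z # v))" if "z \<in> S" for z
        using xy d that by (intro 1(1)) auto
      have "P (lin_ext (\<lambda>z. word (u @ z # v)) q)" if q: "keys q \<subseteq> S" for q
        by (induction q rule: pm_keys_induct)
          (use q letter in \<open>auto simp: lin_ext_linear zero intro: add scale\<close>)
      from this[of "br x y"] have "P (lin_ext (\<lambda>z. word (u @ z # v)) (br x y))"
        using S xy by blast
      then have "P (word (u @ y # x # v) + lin_ext (\<lambda>z. word (u @ z # v)) (br x y)
          + word u * comm_rel x y * word v)"
        using swapped rel xy by (intro add) auto
      then show ?thesis
        by (simp add: comm_rel_word d)
    qed
  qed
  show ?thesis
  proof (induction p rule: tensor_induct)
    case (word w)
    then have "set w \<subseteq> S" using p by fastforce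
    then show ?case by (rule over_S)
  qed (fact zero scale add)+
qed

end

text \<open>\<open>B\<close> spans a subalgebra and \<chi> is a one-dimensional module of it,
  because \<chi> vanishes on brackets. The order puts letters outside \<open>B\<close> first, so in
  a sorted word the letters of \<open>B\<close> stand on the right, next to the generating vector on
  which they act by \<chi>.\<close>

locale lie_character = lie_basis br
  for br :: "'b::linorder \<Rightarrow> 'b \<Rightarrow> ('b \<Rightarrow>\<^sub>0 complex)" +
  fixes B :: "'b set" and \<chi> :: "'b \<Rightarrow> complex"
  assumes below: "x \<notin> B \<Longrightarrow> y \<in> B \<Longrightarrow> x < y"
    and br_B: "x \<in> B \<Longrightarrow> y \<in> B \<Longrightarrow> keys (br x y) \<subseteq> B"
    and char_br: "x \<in> B \<Longrightarrow> y \<in> B \<Longrightarrow> fun_ext \<chi> (br x y) = 0"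
begin

lemma sorted_split:
  assumes "sorted w"
  obtains s y where "w = s @ y" "sorted s" "sorted y" "set s \<inter> B = {}" "set y \<subseteq> B"
proof -
  have "w = filter (\<lambda>x. x \<notin> B) w @ filter (\<lambda>x. x \<in> B) w"
    using assms
  proof (induction w)
    case (Cons x w)
    show ?case
    proof (cases "x \<in> B")
      case True
      then have "set w \<subseteq> B" using Cons.prems below by fastforce
      then have "filter (\<lambda>x. x \<notin> B) w = []" "filter (\<lambda>x. x \<in> B) w = w"
        by (auto simp: filter_empty_conv filter_id_conv)
      then show ?thesis using True by simp
    next
      case False
      then show ?thesis using Cons by simp
    qed
  qed simp
  with assms that[of "filter (\<lambda>x. x \<notin> B) w" "filter (\<lambda>x. x \<in> B) w"] show ?thesis
    by (auto simp: sorted_wrt_filter)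
qed

text \<open>The map p \<mapsto> p v_0 into the module induced from \<chi>, in the basis of monomials
  in letters outside \<open>B\<close>: after straightening, the letters of \<open>B\<close> are
  replaced by their scalars.\<close>

definition induced :: "('b free_mon \<Rightarrow>\<^sub>0 complex) \<Rightarrow> ('b multiset \<Rightarrow>\<^sub>0 complex)" where
  "induced p = lin_ext (\<lambda>\<mu>. single (filter_mset (\<lambda>x. x \<notin> B) \<mu>)
     (\<Prod>x\<in>#filter_mset (\<lambda>x. x \<in> B) \<mu>. \<chi> x)) (normal_form p)"

lemma induced_linear:
  "induced (p + q) = induced p + induced q" "induced (p - q) = induced p - induced q"
  "induced (- p) = - induced p" "induced (scal c p) = scal c (induced p)" "induced 0 = 0"
  by (simp_all add: induced_def lin_ext_linear normal_form_linear)

lemma induced_comm_rel: "induced (p * comm_rel x y * q) = 0"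
  by (simp add: induced_def normal_form_comm_rel)

lemma char_eval_comm_rel: "x \<in> B \<Longrightarrow> y \<in> B \<Longrightarrow> char_eval \<chi> (comm_rel x y) = 0"
  by (simp add: comm_rel_def char_eval_linear char_eval_mult char_eval_deg1 char_br)

lemma induced_sorted:
  assumes "sorted (s @ y)" "set s \<inter> B = {}" "set y \<subseteq> B"
  shows "induced (word (s @ y)) = single (mset s) (prod_list (map \<chi> y))"
proof -
  have "filter (\<lambda>x. x \<notin> B) s = s" "filter (\<lambda>x. x \<notin> B) y = []"
    "filter (\<lambda>x. x \<in> B) s = []" "filter (\<lambda>x. x \<in> B) y = y"
    using assms(2,3) by (auto simp: filter_empty_conv filter_id_conv disjoint_iff subset_iff
        intro!: filter_True)
  then show ?thesis
    using nf_sorted[OF assms(1)]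
    by (simp add: induced_def normal_form_word flip: mset_filter mset_append mset_map)
      (simp flip: prod_mset_prod_list)
qed

lemma induced_sorted_mult:
  assumes s: "sorted s" "set s \<inter> B = {}" and p: "keys p \<subseteq> words_over B"
  shows "induced (word s * p) = single (mset s) (char_eval \<chi> p)"
proof -
  have "\<forall>x\<in>B. \<forall>y\<in>B. keys (br x y) \<subseteq> B" using br_B by blast
  from this p show ?thesis
  proof (induction p rule: pbw_induct)
    case (sorted w)
    then have "sorted (s @ w)"
      using s below by (auto simp: sorted_append intro!: less_imp_le)
    from induced_sorted[OF this] show ?case using s sorted by (simp add: word_append)
  next
    case (rel u x y v)
    then show ?case
      using induced_comm_rel[of "word s * word u" x y "word v"]
      by (simp add: char_eval_mult char_eval_comm_rel mult.assoc)
  qed (simp_all add: char_eval_linear induced_linear distrib_left scal_mult_right single_add)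
qed

text \<open>Compatibility with the right action of the subalgebra. This is what lets
  \<open>induced\<close> pass to the tensor product over its enveloping algebra.\<close>

theorem induced_mult_right:
  assumes p: "keys p \<subseteq> words_over B"
  shows "induced (t * p) = scal (char_eval \<chi> p) (induced t)"
proof -
  have "\<forall>x\<in>UNIV. \<forall>y\<in>UNIV. keys (br x y) \<subseteq> UNIV"
    "keys t \<subseteq> words_over UNIV" by simp_all
  then show ?thesis
  proof (induction t rule: pbw_induct)
    case (sorted w)
    then obtain s y where w: "w = s @ y" "sorted s" "sorted y" "set s \<inter> B = {}" "set y \<subseteq> B"
      using sorted_split by blast
    have "keys (word y * p) \<subseteq> words_over B"
      using keys_mult[of "word y" p] p w(5) by (fastforce simp: plus_free_mon_def)
    then have "induced (word s * (word y * p))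
        = single (mset s) (char_eval \<chi> (word y * p))"
      using w by (intro induced_sorted_mult)
    then show ?case using induced_sorted[of s y] w sorted
      by (simp add: word_append mult.assoc char_eval_mult mult.commute)
  next
    case (rel u x y v)
    show ?case
      using induced_comm_rel[of "word u" x y "word v"] induced_comm_rel[of "word u" x y "word v * p"]
      by (simp add: mult.assoc)
  qed (simp_all add: induced_linear distrib_right scal_mult_left scal_add mult.commute)
qed

abbreviation lower_msets :: "'b multiset set" where
  "lower_msets \<equiv> {\<mu>. set_mset \<mu> \<inter> B = {}}"

lemma keys_induced: "keys (induced p) \<subseteq> lower_msets"
  unfolding induced_def by (rule keys_lin_ext) auto

lemma induced_mset_word:
  assumes "keys m \<subseteq> lower_msets"
  shows "induced (mset_word m) = m"
proof (induction m rule: pm_keys_induct)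
  case (single \<mu>)
  let ?s = "sorted_list_of_multiset \<mu>"
  have "set ?s \<inter> B = {}" using assms single by auto
  then show ?case using induced_sorted[of ?s "[]"] by (simp add: mset_word_def)
qed (auto simp: mset_word_linear induced_linear)

text \<open>The vector t (q v_0) depends on q only through q v_0. So left multiplication gives a
  well-defined action on the coordinates, computed with the sorted representative.\<close>

theorem induced_mult_left: "induced (t * q) = induced (t * mset_word (induced q))"
proof -
  have "\<forall>x\<in>UNIV. \<forall>y\<in>UNIV. keys (br x y) \<subseteq> UNIV"
    "keys q \<subseteq> words_over UNIV" by simp_all
  then show ?thesis
  proof (induction q rule: pbw_induct)
    case (sorted w)
    then obtain s y where w: "w = s @ y" "sorted s" "sorted y" "set s \<inter> B = {}" "set y \<subseteq> B"
      using sorted_split by blast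
    have "induced (t * word s * word y) = scal (char_eval \<chi> (word y)) (induced (t * word s))"
      using w by (intro induced_mult_right) simp
    then show ?case using induced_sorted[of s y] w sorted
      by (simp add: word_append mult.assoc mset_word_single scal_mult_right induced_linear
          del: scal_single)
  next
    case (rel u x y v)
    show ?case
      using induced_comm_rel[of "word u" x y "word v"] induced_comm_rel[of "t * word u" x y "word v"]
      by (simp add: mult.assoc mset_word_linear induced_linear)
  qed (simp_all add: induced_linear distrib_left scal_mult_right mset_word_linear)
qed

end

section \<open>The loop-Virasoro algebra\<close>

text \<open>Degree comes first so that letters of negative degree precede all others, as
  \<open>lie_character\<close> demands. The middle entry separates \<open>Ct j\<close> from
  \<open>Dt 0 j\<close>.\<close>

fun lvb_rank :: "lvb \<Rightarrow> int \<times> int \<times> int" where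
  "lvb_rank (Dt i j) = (i, 1, j)"
| "lvb_rank (Ct j) = (0, 0, j)"

lemma lvb_rank_inject: "lvb_rank x = lvb_rank y \<longleftrightarrow> x = y"
  by (cases x; cases y) auto

instantiation lvb :: linorder
begin

definition "x \<le> y \<longleftrightarrow> lvb_rank x \<le> lvb_rank y"
definition "x < y \<longleftrightarrow> lvb_rank x < lvb_rank y"

instance
  by standard (auto simp: less_eq_lvb_def less_lvb_def less_le_not_le lvb_rank_inject[symmetric])

end

lemma lvb_bracket_antisym: "lvb_bracket x y = - lvb_bracket y x"
proof (cases x; cases y)
  fix i j k l assume xy: "x = Dt i j" "y = Dt k l"
  show ?thesis
  proof (cases "i + k = 0")
    case True
    then have "k = - i" by simp
    then show ?thesis
      by (simp add: xy add.commute[of l] minus_divide_left flip: single_uminus single_add)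
  next
    case False
    then show ?thesis
      by (simp add: xy add.commute[of k] add.commute[of l] flip: single_uminus)
  qed
qed auto

lemma lvb_jacobi:
  "lin_ext (lvb_bracket x) (lvb_bracket y z) + lin_ext (lvb_bracket y) (lvb_bracket z x)
    + lin_ext (lvb_bracket z) (lvb_bracket x y) = 0"
proof (cases x; cases y; cases z)
  fix i j k l m n assume xyz: "x = Dt i j" "y = Dt k l" "z = Dt m n"
  define C where "C a b e = (if i + k + m = 0 then
    single (Ct (j + l + n)) (of_int ((e - b) * (a ^ 3 - a)) / 12 :: complex) else 0)"
    for a b e :: int
  define D where "D a b e =
    single (Dt (i + k + m) (j + l + n)) (of_int ((e - b) * (b + e - a)) :: complex)"
    for a b e :: int
  have br: "lin_ext (lvb_bracket (Dt a a')) (lvb_bracket (Dt b b') (Dt e e')) = D a b e + C a b e"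
    if "a + b + e = i + k + m" "a' + b' + e' = j + l + n" for a a' b b' e e'
  proof -
    have "a + (b + e) = i + k + m" "a' + (b' + e') = j + l + n" using that by simp_all
    then show ?thesis
      by (simp add: lin_ext_add scal_add C_def D_def)
  qed
  \<comment> \<open>The central parts cancel by the cocycle identity of i^3 - i, which holds only on
    the plane i + k + m = 0.\<close>
  have C: "C i k m + C k m i + C m i k = 0"
  proof (cases "i + k + m = 0")
    case True
    then have m: "m = - i - k" by simp
    have "(m - k) * (i ^ 3 - i) + (i - m) * (k ^ 3 - k) + (k - i) * (m ^ 3 - m) = 0"
      unfolding m by (simp add: algebra_simps power3_eq_cube)
    then have "of_int ((m - k) * (i ^ 3 - i)) / 12 + of_int ((i - m) * (k ^ 3 - k)) / 12
        + of_int ((k - i) * (m ^ 3 - m)) / 12 = (0 :: complex)"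
      unfolding add_divide_distrib[symmetric] of_int_add[symmetric] by simp
    then show ?thesis using True by (simp add: C_def single_add[symmetric])
  qed (simp add: C_def)
  have "(m - k) * (k + m - i) + (i - m) * (m + i - k) + (k - i) * (i + k - m) = 0"
    by (simp add: algebra_simps)
  then have "of_int ((m - k) * (k + m - i)) + of_int ((i - m) * (m + i - k))
      + of_int ((k - i) * (i + k - m)) = (0 :: complex)"
    unfolding of_int_add[symmetric] by simp
  then have D: "D i k m + D k m i + D m i k = 0"
    unfolding D_def single_add[symmetric] by simp
  have "lin_ext (lvb_bracket x) (lvb_bracket y z) = D i k m + C i k m"
    "lin_ext (lvb_bracket y) (lvb_bracket z x) = D k m i + C k m i"
    "lin_ext (lvb_bracket z) (lvb_bracket x y) = D m i k + C m i k"
    unfolding xyz by (intro br; simp)+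
  then have "lin_ext (lvb_bracket x) (lvb_bracket y z) + lin_ext (lvb_bracket y) (lvb_bracket z x)
      + lin_ext (lvb_bracket z) (lvb_bracket x y)
    = (D i k m + D k m i + D m i k) + (C i k m + C k m i + C m i k)"
    by (simp only: ac_simps)
  then show ?thesis
    using C D by simp
qed (auto simp: lin_ext_add scal_add)

text \<open>The scalars vanish on brackets: two elements of nonnegative degree have a bracket of
  degree 0 only if both have degree 0, and then both k - i and i^3 - i are 0.\<close>

interpretation hw: lie_character lvb_bracket lvb_nonneg "hw_scalar \<phi>" for \<phi>
proof
  fix x y z
  show "lvb_bracket x y = - lvb_bracket y x" by (rule lvb_bracket_antisym)
  show "lin_ext (lvb_bracket x) (lvb_bracket y z) + lin_ext (lvb_bracket y) (lvb_bracket z x)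
    + lin_ext (lvb_bracket z) (lvb_bracket x y) = 0" by (rule lvb_jacobi)
  show "x < y" if "x \<notin> lvb_nonneg" "y \<in> lvb_nonneg"
    using that by (cases x; cases y) (auto simp: less_lvb_def lvb_nonneg_def)
  assume B: "x \<in> lvb_nonneg" "y \<in> lvb_nonneg"
  then show "keys (lvb_bracket x y) \<subseteq> lvb_nonneg"
    by (cases x; cases y)
      (auto simp: lvb_nonneg_def split: if_splits dest!: subsetD[OF keys_add])
  show "fun_ext (hw_scalar \<phi>) (lvb_bracket x y) = 0"
    using B by (cases x; cases y) (auto simp: lvb_nonneg_def hw_scalar_def fun_ext_linear add_nonneg_eq_0_iff)
qed

lemma hw_eval_char_eval: "hw_eval \<phi> = char_eval (hw_scalar \<phi>)"
  by (simp add: fun_eq_iff hw_eval_def char_eval_def fun_ext_def)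

lemma lv_bracket_linear:
  "lv_bracket (x + x') y = lv_bracket x y + lv_bracket x' y"
  "lv_bracket (scal c x) y = scal c (lv_bracket x y)" "lv_bracket 0 y = 0"
  "lv_bracket x (y + y') = lv_bracket x y + lv_bracket x y'"
  "lv_bracket x (scal c y) = scal c (lv_bracket x y)" "lv_bracket x 0 = 0"
  by (simp_all add: lv_bracket_def lin_ext_linear lin_ext_pointwise_add)
    (simp_all add: lin_ext_def scal_sum mult.left_commute)

lemma lv_bracket_single [simp]:
  "lv_bracket (single a c) (single b d) = scal (c * d) (lvb_bracket a b)"
  by (simp add: lv_bracket_def)

definition env_gen :: "lvir \<Rightarrow> lvir \<Rightarrow> lv_tensor" where
  "env_gen x y = deg1 x * deg1 y - deg1 y * deg1 x - deg1 (lv_bracket x y)"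

lemma env_gen_linear:
  "env_gen (x + x') y = env_gen x y + env_gen x' y" "env_gen (scal c x) y = scal c (env_gen x y)"
  "env_gen 0 y = 0"
  "env_gen x (y + y') = env_gen x y + env_gen x y'" "env_gen x (scal c y) = scal c (env_gen x y)"
  "env_gen x 0 = 0"
  by (simp_all add: env_gen_def deg1_linear lv_bracket_linear algebra_simps scal_mult_left
      scal_mult_right scal_diff)

lemma env_gen_single: "env_gen (single a 1) (single b 1) = hw.comm_rel a b"
  by (simp add: env_gen_def hw.comm_rel_def)

lemma env_gen_induct:
  assumes "keys x \<subseteq> S" "keys y \<subseteq> S"
    and "\<And>a b. a \<in> S \<Longrightarrow> b \<in> S \<Longrightarrow> P (hw.comm_rel a b)"
    and "P 0" "\<And>p q. P p \<Longrightarrow> P q \<Longrightarrow> P (p + q)" "\<And>c p. P p \<Longrightarrow> P (scal c p)"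
  shows "P (env_gen x y)"
proof (induction x rule: pm_keys_induct)
  case (single a)
  show ?case
    by (induction y rule: pm_keys_induct)
      (use assms single in \<open>auto simp: env_gen_linear env_gen_single\<close>)
qed (use assms(4-) in \<open>auto simp: env_gen_linear\<close>)

lemma induced_env_gen: "hw.induced \<phi> (p * env_gen x y * q) = 0"
  by (rule env_gen_induct[of x UNIV y])
    (simp_all add: hw.induced_comm_rel hw.induced_linear distrib_left distrib_right
      scal_mult_left scal_mult_right)

lemma char_eval_env_gen:
  assumes "keys x \<subseteq> lvb_nonneg" "keys y \<subseteq> lvb_nonneg"
  shows "char_eval (hw_scalar \<phi>) (env_gen x y) = 0"
  using assms by (rule env_gen_induct) (simp_all add: hw.char_eval_comm_rel char_eval_linear)

lemma keys_lv_bracket: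
  assumes "\<And>a b. a \<in> S \<Longrightarrow> b \<in> S \<Longrightarrow> keys (lvb_bracket a b) \<subseteq> S"
    and "keys x \<subseteq> S" "keys y \<subseteq> S"
  shows "keys (lv_bracket x y) \<subseteq> S"
  unfolding lv_bracket_def using assms by (intro keys_lin_ext) blast

section \<open>Homomorphisms of modules\<close>

text \<open>Only closure is asked of scalars and action, one Lie algebra element at a time. The
  notion thus also covers \<open>free_verma\<close>, where the action is not yet linear in the Lie
  algebra element.\<close>

definition lv_space :: "'v lv_module \<Rightarrow> bool" where
  "lv_space V \<longleftrightarrow> abelian_group V \<and> (\<forall>c. \<forall>v\<in>carrier V. c \<odot>\<^bsub>V\<^esub> v \<in> carrier V)
     \<and> (\<forall>x. \<forall>v\<in>carrier V. act V x v \<in> carrier V)"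

definition lv_epi :: "('v \<Rightarrow> 'w) \<Rightarrow> 'v lv_module \<Rightarrow> 'w lv_module \<Rightarrow> bool" where
  "lv_epi h V W \<longleftrightarrow> lv_space V \<and> lv_space W \<and> h ` carrier V = carrier W
     \<and> (\<forall>u\<in>carrier V. \<forall>v\<in>carrier V. h (u \<oplus>\<^bsub>V\<^esub> v) = h u \<oplus>\<^bsub>W\<^esub> h v)
     \<and> (\<forall>c. \<forall>v\<in>carrier V. h (c \<odot>\<^bsub>V\<^esub> v) = c \<odot>\<^bsub>W\<^esub> h v)
     \<and> (\<forall>x. \<forall>v\<in>carrier V. h (act V x v) = act W x (h v))"

definition lv_iso :: "('v \<Rightarrow> 'w) \<Rightarrow> 'v lv_module \<Rightarrow> 'w lv_module \<Rightarrow> bool" where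
  "lv_iso h V W \<longleftrightarrow> lv_epi h V W \<and> inj_on h (carrier V)"

lemma lv_spaceD:
  assumes "lv_space V"
  shows "abelian_group V" "v \<in> carrier V \<Longrightarrow> c \<odot>\<^bsub>V\<^esub> v \<in> carrier V"
    "v \<in> carrier V \<Longrightarrow> act V x v \<in> carrier V"
  using assms by (auto simp: lv_space_def)

lemma lv_epiD:
  assumes "lv_epi h V W"
  shows "lv_space V" "lv_space W" "h ` carrier V = carrier W"
    "v \<in> carrier V \<Longrightarrow> h v \<in> carrier W"
    "u \<in> carrier V \<Longrightarrow> v \<in> carrier V \<Longrightarrow> h (u \<oplus>\<^bsub>V\<^esub> v) = h u \<oplus>\<^bsub>W\<^esub> h v"
    "v \<in> carrier V \<Longrightarrow> h (c \<odot>\<^bsub>V\<^esub> v) = c \<odot>\<^bsub>W\<^esub> h v"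
    "v \<in> carrier V \<Longrightarrow> h (act V x v) = act W x (h v)"
  using assms by (auto simp: lv_epi_def)

lemma lv_epi_group_hom:
  assumes "lv_epi h V W"
  shows "group_hom (add_monoid V) (add_monoid W) h"
proof -
  interpret V: abelian_group V using lv_spaceD(1) lv_epiD(1) assms .
  interpret W: abelian_group W using lv_spaceD(1) lv_epiD(2) assms .
  show ?thesis
    using lv_epiD[OF assms] by unfold_locales (auto simp: hom_def)
qed

lemma lv_epi_zero: "lv_epi h V W \<Longrightarrow> h \<zero>\<^bsub>V\<^esub> = \<zero>\<^bsub>W\<^esub>"
  using group_hom.hom_one[OF lv_epi_group_hom] by fastforce

lemma lv_epi_comp:
  assumes "lv_epi g V W" "lv_epi h W Z"
  shows "lv_epi (h \<circ> g) V Z"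
  using lv_epiD[OF assms(1)] lv_epiD[OF assms(2)] unfolding lv_epi_def
  by (simp add: image_image[of h g, symmetric])

lemma lv_epi_finsum:
  assumes h: "lv_epi h V W" and "finite A" "\<And>a. a \<in> A \<Longrightarrow> f a \<in> carrier V"
  shows "h (\<Oplus>\<^bsub>V\<^esub>a\<in>A. f a) = (\<Oplus>\<^bsub>W\<^esub>a\<in>A. h (f a))" "(\<Oplus>\<^bsub>V\<^esub>a\<in>A. f a) \<in> carrier V"
proof -
  interpret V: abelian_group V using lv_spaceD(1) lv_epiD(1) h .
  interpret W: abelian_group W using lv_spaceD(1) lv_epiD(2) h .
  have "h (\<Oplus>\<^bsub>V\<^esub>a\<in>A. f a) = (\<Oplus>\<^bsub>W\<^esub>a\<in>A. h (f a)) \<and> (\<Oplus>\<^bsub>V\<^esub>a\<in>A. f a) \<in> carrier V"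
    using assms(2,3)
  proof (induction A)
    case (insert a A)
    have "f \<in> A \<rightarrow> carrier V" "f a \<in> carrier V" "(\<lambda>a. h (f a)) \<in> A \<rightarrow> carrier W" "h (f a) \<in> carrier W"
      using insert.prems lv_epiD(4)[OF h] by auto
    then show ?case using insert by (simp add: lv_epiD(5)[OF h])
  qed (simp add: lv_epi_zero[OF h])
  then show "h (\<Oplus>\<^bsub>V\<^esub>a\<in>A. f a) = (\<Oplus>\<^bsub>W\<^esub>a\<in>A. h (f a))" "(\<Oplus>\<^bsub>V\<^esub>a\<in>A. f a) \<in> carrier V"
    by simp_all
qed

subsection \<open>Quotients\<close>

lemma lv_quotient_simps [simp]:
  "carrier (lv_quotient V N) = a_rcosets\<^bsub>V\<^esub> N" "\<zero>\<^bsub>lv_quotient V N\<^esub> = N"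
  "X \<oplus>\<^bsub>lv_quotient V N\<^esub> Y = set_add V X Y"
  "c \<odot>\<^bsub>lv_quotient V N\<^esub> X = (\<Union>x\<in>X. N +>\<^bsub>V\<^esub> (c \<odot>\<^bsub>V\<^esub> x))"
  "act (lv_quotient V N) a X = (\<Union>x\<in>X. N +>\<^bsub>V\<^esub> act V a x)"
  by (simp_all add: lv_quotient_def quot_module_def FactRing_def module.defs ring.defs lv_module.defs)

text \<open>The first isomorphism theorem. The cosets of the kernel are the fibres of
  \<open>h\<close>, so the unions that define the operations of the quotient run over copies of one
  coset; well-definedness need not be checked separately.\<close>

lemma lv_quotient_iso:
  assumes h: "lv_epi h V W" and N: "N = {v \<in> carrier V. h v = \<zero>\<^bsub>W\<^esub>}"
  shows "lv_iso (\<lambda>X. the_elem (h ` X)) (lv_quotient V N) W"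
    and "\<And>v. v \<in> carrier V \<Longrightarrow> N +>\<^bsub>V\<^esub> v = {u \<in> carrier V. h u = h v}"
    and "\<And>v. v \<in> carrier V \<Longrightarrow> the_elem (h ` (N +>\<^bsub>V\<^esub> v)) = h v"
proof -
  interpret V: abelian_group V using lv_spaceD(1) lv_epiD(1) h .
  interpret W: abelian_group W using lv_spaceD(1) lv_epiD(2) h .
  note hD = lv_epiD[OF h]
  note VD = lv_spaceD[OF hD(1)] and WD = lv_spaceD[OF hD(2)]
  have diff: "h (u \<ominus>\<^bsub>V\<^esub> v) = z" if "u \<in> carrier V" "v \<in> carrier V" "z \<in> carrier W" "h u = z \<oplus>\<^bsub>W\<^esub> h v"
    for u v z
  proof -
    have "h (u \<ominus>\<^bsub>V\<^esub> v) \<oplus>\<^bsub>W\<^esub> h v = h ((u \<ominus>\<^bsub>V\<^esub> v) \<oplus>\<^bsub>V\<^esub> v)"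
      using that by (simp add: hD(5))
    also have "(u \<ominus>\<^bsub>V\<^esub> v) \<oplus>\<^bsub>V\<^esub> v = u"
      using that by (simp add: a_minus_def V.a_assoc V.l_neg)
    finally show ?thesis using that hD(4) by simp
  qed
  have minus_add: "(u \<ominus>\<^bsub>V\<^esub> v) \<oplus>\<^bsub>V\<^esub> v = u" if "u \<in> carrier V" "v \<in> carrier V" for u v
    using that by (simp add: a_minus_def V.a_assoc V.l_neg)
  show coset: "N +>\<^bsub>V\<^esub> v = {u \<in> carrier V. h u = h v}" if v: "v \<in> carrier V" for v
  proof (intro equalityI subsetI)
    fix u assume "u \<in> N +>\<^bsub>V\<^esub> v"
    then show "u \<in> {u \<in> carrier V. h u = h v}"
      using v hD(4)[OF v] by (auto simp: a_r_coset_def' N hD(5))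
  next
    fix u assume u: "u \<in> {u \<in> carrier V. h u = h v}"
    then have "u \<ominus>\<^bsub>V\<^esub> v \<in> N" using v hD(4)[OF v] by (auto simp: N intro: diff)
    then have "(u \<ominus>\<^bsub>V\<^esub> v) \<oplus>\<^bsub>V\<^esub> v \<in> N +>\<^bsub>V\<^esub> v" by (auto simp: a_r_coset_def')
    then show "u \<in> N +>\<^bsub>V\<^esub> v" using minus_add u v by simp
  qed
  \<comment> \<open>Elements of the quotient are renamed by their value in \<open>W\<close>; each
    operation then becomes the one of \<open>W\<close> under \<open>fib\<close>.\<close>
  define fib where "fib z = {u \<in> carrier V. h u = z}" for z
  define Q where "Q = lv_quotient V N"
  define g where "g = (\<lambda>X. the_elem (h ` X))"
  have cls: "N +>\<^bsub>V\<^esub> v = fib (h v)" if "v \<in> carrier V" for v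
    using coset[OF that] by (simp add: fib_def)
  have ex: "\<exists>v\<in>carrier V. h v = z" if "z \<in> carrier W" for z
    using that hD(3) by (metis imageE)
  have g_fib: "g (fib z) = z" if "z \<in> carrier W" for z
  proof -
    have "h ` fib z = {z}" using ex[OF that] by (auto simp: fib_def)
    then show ?thesis by (simp add: g_def)
  qed
  show "the_elem (h ` (N +>\<^bsub>V\<^esub> v)) = h v" if "v \<in> carrier V" for v
    using g_fib[of "h v"] hD(4) that by (simp add: cls g_def)
  have carr: "carrier Q = fib ` carrier W"
    unfolding Q_def lv_quotient_simps A_RCOSETS_def' hD(3)[symmetric] using cls by auto
  have zero: "\<zero>\<^bsub>Q\<^esub> = fib \<zero>\<^bsub>W\<^esub>" by (simp add: Q_def N fib_def)
  have add: "fib y \<oplus>\<^bsub>Q\<^esub> fib z = fib (y \<oplus>\<^bsub>W\<^esub> z)" if yz: "y \<in> carrier W" "z \<in> carrier W" for y z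
  proof -
    obtain v where v: "v \<in> carrier V" "h v = z" using ex yz by blast
    have "u \<in> set_add V (fib y) (fib z)" if "u \<in> fib (y \<oplus>\<^bsub>W\<^esub> z)" for u
    proof -
      have "u \<in> carrier V" "h u = y \<oplus>\<^bsub>W\<^esub> h v" using that v by (auto simp: fib_def)
      then have "u \<ominus>\<^bsub>V\<^esub> v \<in> fib y" "(u \<ominus>\<^bsub>V\<^esub> v) \<oplus>\<^bsub>V\<^esub> v = u"
        using v yz minus_add by (auto simp: fib_def intro: diff)
      moreover have "v \<in> fib z" using v by (simp add: fib_def)
      ultimately show ?thesis unfolding set_add_def' by force
    qed
    then show ?thesis
      by (auto simp: Q_def set_add_def') (auto simp: fib_def hD(5))
  qed
  have smult: "c \<odot>\<^bsub>Q\<^esub> fib z = fib (c \<odot>\<^bsub>W\<^esub> z)" if "z \<in> carrier W" for c z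
  proof -
    have "N +>\<^bsub>V\<^esub> (c \<odot>\<^bsub>V\<^esub> x) = fib (c \<odot>\<^bsub>W\<^esub> z)" if "x \<in> fib z" for x
      using that cls[of "c \<odot>\<^bsub>V\<^esub> x"] VD(2) hD(6) by (auto simp: fib_def)
    moreover have "fib z \<noteq> {}" using ex[OF that] by (auto simp: fib_def)
    ultimately show ?thesis by (auto simp: Q_def)
  qed
  have action: "act Q x (fib z) = fib (act W x z)" if "z \<in> carrier W" for x z
  proof -
    have "N +>\<^bsub>V\<^esub> (act V x v) = fib (act W x z)" if "v \<in> fib z" for v
      using that cls[of "act V x v"] VD(3) hD(7) by (auto simp: fib_def)
    moreover have "fib z \<noteq> {}" using ex[OF that] by (auto simp: fib_def)
    ultimately show ?thesis by (auto simp: Q_def)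
  qed
  have "abelian_group Q"
  proof (rule abelian_groupI)
    fix X assume "X \<in> carrier Q"
    then obtain z where z: "z \<in> carrier W" "X = fib z" using carr by auto
    then have "fib (\<ominus>\<^bsub>W\<^esub> z) \<oplus>\<^bsub>Q\<^esub> X = \<zero>\<^bsub>Q\<^esub>" by (simp add: add zero W.l_neg)
    then show "\<exists>Y\<in>carrier Q. Y \<oplus>\<^bsub>Q\<^esub> X = \<zero>\<^bsub>Q\<^esub>" using z by (auto simp: carr)
  qed (auto simp: carr add zero W.a_assoc, simp_all add: W.a_comm)
  then have "lv_space Q"
    using WD by (auto simp: lv_space_def carr smult action)
  then have "lv_epi g Q W"
    using hD(2) WD by (auto simp: lv_epi_def carr add smult action g_fib image_image)
  moreover have "inj_on g (carrier Q)"
    by (auto simp: inj_on_def carr g_fib)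
  ultimately show "lv_iso (\<lambda>X. the_elem (h ` X)) (lv_quotient V N) W"
    by (simp add: lv_iso_def Q_def g_def)
qed

subsection \<open>Invariance under isomorphism\<close>

lemma lv_iso_sym:
  assumes "lv_iso h V W"
  shows "lv_iso (inv_into (carrier V) h) W V"
proof -
  let ?g = "inv_into (carrier V) h"
  have h: "lv_epi h V W" and inj: "inj_on h (carrier V)" using assms by (auto simp: lv_iso_def)
  note hD = lv_epiD[OF h]
  have g: "?g (h v) = v" if "v \<in> carrier V" for v using inj that by simp
  interpret V: abelian_group V using lv_spaceD(1) lv_epiD(1) h .
  have "lv_epi ?g W V"
    unfolding lv_epi_def hD(3)[symmetric]
    using hD(1,2) g lv_spaceD[OF hD(1)]
    by (auto simp: image_image simp flip: hD(5-7))
  moreover have "inj_on ?g (carrier W)"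
    using inj_on_inv_into[of "carrier W" h "carrier V"] hD(3) by simp
  ultimately show ?thesis by (simp add: lv_iso_def)
qed

lemma lv_epi_submodule_image:
  assumes h: "lv_epi h V W" and N: "lv_submodule N V"
  shows "lv_submodule (h ` N) W"
proof -
  note hD = lv_epiD[OF h]
  have sub: "subgroup N (add_monoid V)" "\<And>c x. x \<in> N \<Longrightarrow> c \<odot>\<^bsub>V\<^esub> x \<in> N"
    "\<And>a x. x \<in> N \<Longrightarrow> act V a x \<in> N"
    using N unfolding lv_submodule_def submodule_def submodule_axioms_def
    by (auto simp: complex_field_def)
  then have "N \<subseteq> carrier V" using subgroup.subset by fastforce
  moreover have "subgroup (h ` N) (add_monoid W)"
    using group_hom.subgroup_img_is_subgroup[OF lv_epi_group_hom[OF h] sub(1)] .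
  ultimately show ?thesis
    using sub hD(6,7)
    unfolding lv_submodule_def submodule_def submodule_axioms_def
    by (auto simp: image_iff subset_iff Bex_def) (metis)+
qed

lemma lv_submodule_subset: "lv_submodule N V \<Longrightarrow> N \<subseteq> carrier V"
  unfolding lv_submodule_def submodule_def using subgroup.subset by fastforce

lemma lv_iso_reducible:
  assumes "lv_iso h V W" "lv_reducible V"
  shows "lv_reducible W"
proof -
  have h: "lv_epi h V W" and inj: "inj_on h (carrier V)" using assms by (auto simp: lv_iso_def)
  obtain N where N: "lv_submodule N V" "N \<noteq> {\<zero>\<^bsub>V\<^esub>}" "N \<noteq> carrier V"
    using assms(2) by (auto simp: lv_reducible_def)
  interpret V: abelian_group V using lv_spaceD(1) lv_epiD(1) h .
  have sub: "N \<subseteq> carrier V" by (rule lv_submodule_subset[OF N(1)])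
  have "h ` N \<noteq> h ` {\<zero>\<^bsub>V\<^esub>}" "h ` N \<noteq> h ` carrier V"
    using N(2,3) sub inj_on_image_eq_iff[OF inj sub, of "{\<zero>\<^bsub>V\<^esub>}"]
      inj_on_image_eq_iff[OF inj sub, of "carrier V"] by simp_all
  then show ?thesis
    using lv_epi_submodule_image[OF h N(1)] lv_epi_zero[OF h] lv_epiD(3)[OF h]
    unfolding lv_reducible_def by (intro exI[of _ "h ` N"]) simp
qed

lemma lv_iso_harish_chandra:
  assumes "lv_iso h V W" "harish_chandra V"
  shows "harish_chandra W"
proof -
  have h: "lv_epi h V W" and inj: "inj_on h (carrier V)" using assms by (auto simp: lv_iso_def)
  note hD = lv_epiD[OF h]
  note VD = lv_spaceD[OF hD(1)]
  interpret W: abelian_group W using lv_spaceD(1) lv_epiD(2) h .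
  have weight: "h ` weight_space V \<mu> = weight_space W \<mu>" for \<mu>
  proof -
    have "w \<in> h ` weight_space V \<mu>" if w: "w \<in> weight_space W \<mu>" for w
    proof -
      obtain v where v: "v \<in> carrier V" "w = h v" using w hD(3) by (auto simp: weight_space_def)
      then have "h (act V (d_t 0 0) v) = h (\<mu> \<odot>\<^bsub>V\<^esub> v)" using w hD(6,7) by (simp add: weight_space_def)
      then have "act V (d_t 0 0) v = \<mu> \<odot>\<^bsub>V\<^esub> v" using inj VD v by (auto simp: inj_on_def)
      then show ?thesis using v by (auto simp: weight_space_def)
    qed
    moreover have "h v \<in> weight_space W \<mu>" if "v \<in> weight_space V \<mu>" for v
      using that hD(4)[of v] hD(6)[of v \<mu>] hD(7)[of v "d_t 0 0"] by (simp add: weight_space_def)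
    ultimately show ?thesis by blast
  qed
  have "\<exists>F w. finite F \<and> (\<forall>\<mu>\<in>F. w \<mu> \<in> weight_space W \<mu>) \<and> x = (\<Oplus>\<^bsub>W\<^esub>\<mu>\<in>F. w \<mu>)"
    if x: "x \<in> carrier W" for x
  proof -
    obtain v where v: "v \<in> carrier V" "x = h v" using x hD(3) by auto
    then obtain F w where F: "finite F" "\<And>\<mu>. \<mu> \<in> F \<Longrightarrow> w \<mu> \<in> weight_space V \<mu>" "v = (\<Oplus>\<^bsub>V\<^esub>\<mu>\<in>F. w \<mu>)"
      using assms(2) unfolding harish_chandra_def by blast
    then have "x = (\<Oplus>\<^bsub>W\<^esub>\<mu>\<in>F. h (w \<mu>))"
      using lv_epi_finsum(1)[OF h F(1), of w] v by (auto simp: weight_space_def)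
    moreover have "\<forall>\<mu>\<in>F. h (w \<mu>) \<in> weight_space W \<mu>" using F(2) by (auto simp flip: weight)
    ultimately show ?thesis using F(1)
      by (intro exI[of _ F] exI[of _ "\<lambda>\<mu>. h (w \<mu>)"]) simp
  qed
  moreover have "finite_dimensional W (weight_space W \<mu>)" for \<mu>
  proof -
    obtain B where B: "finite B" "B \<subseteq> weight_space V \<mu>"
      "\<And>v. v \<in> weight_space V \<mu> \<Longrightarrow> \<exists>c. v = (\<Oplus>\<^bsub>V\<^esub>b\<in>B. c b \<odot>\<^bsub>V\<^esub> b)"
      using assms(2) unfolding harish_chandra_def finite_dimensional_def by meson
    have BV: "B \<subseteq> carrier V" using B(2) by (auto simp: weight_space_def)
    have injB: "inj_on h B" using inj BV by (rule inj_on_subset)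
    have "\<exists>c. x = (\<Oplus>\<^bsub>W\<^esub>b\<in>h ` B. c b \<odot>\<^bsub>W\<^esub> b)" if x: "x \<in> weight_space W \<mu>" for x
    proof -
      obtain v where v: "v \<in> weight_space V \<mu>" "x = h v" using x by (auto simp flip: weight)
      obtain c where c: "v = (\<Oplus>\<^bsub>V\<^esub>b\<in>B. c b \<odot>\<^bsub>V\<^esub> b)" using B(3)[OF v(1)] by blast
      let ?c = "\<lambda>w. c (inv_into B h w)"
      have "x = (\<Oplus>\<^bsub>W\<^esub>b\<in>B. h (c b \<odot>\<^bsub>V\<^esub> b))"
        unfolding v(2) c by (rule lv_epi_finsum(1)[OF h B(1)]) (use BV VD in auto)
      also have "\<dots> = (\<Oplus>\<^bsub>W\<^esub>b\<in>B. ?c (h b) \<odot>\<^bsub>W\<^esub> h b)"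
        by (rule W.finsum_cong') (use BV hD injB lv_spaceD[OF hD(2)] in \<open>auto simp: subset_iff\<close>)
      also have "\<dots> = (\<Oplus>\<^bsub>W\<^esub>b\<in>h ` B. ?c b \<odot>\<^bsub>W\<^esub> b)"
        by (rule W.finsum_reindex[symmetric])
          (use BV hD injB lv_spaceD[OF hD(2)] in \<open>auto simp: subset_iff\<close>)
      finally show ?thesis by (rule exI[of _ ?c])
    qed
    moreover have "finite (h ` B)" "h ` B \<subseteq> weight_space W \<mu>"
      using B(1) image_mono[OF B(2), of h] by (simp_all add: weight)
    ultimately show ?thesis unfolding finite_dimensional_def by (intro exI[of _ "h ` B"]) simp
  qed
  ultimately show ?thesis unfolding harish_chandra_def by simp
qed

subsection \<open>Modules on a type with an addition\<close>

lemma abelian_group_plusI: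
  fixes V :: "('v::ab_group_add, 'm) ring_scheme"
  assumes [simp]: "zero V = 0" "add V = (+)" and "0 \<in> carrier V"
    and "\<And>x y. x \<in> carrier V \<Longrightarrow> y \<in> carrier V \<Longrightarrow> x + y \<in> carrier V"
    and uminus: "\<And>x. x \<in> carrier V \<Longrightarrow> - x \<in> carrier V"
  shows "abelian_group V" "\<And>x. x \<in> carrier V \<Longrightarrow> inv\<^bsub>add_monoid V\<^esub> x = - x"
proof -
  show V: "abelian_group V"
    by (rule abelian_groupI) (use assms in \<open>auto simp: add_ac intro!: bexI[OF _ uminus]\<close>)
  interpret V: abelian_group V by (rule V)
  show "inv\<^bsub>add_monoid V\<^esub> x = - x" if "x \<in> carrier V" for x
    using V.minus_equality[of "- x" x] that uminus by (simp add: a_inv_def)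
qed

lemma finsum_eq_sum:
  fixes V :: "('v::ab_group_add, 'm) ring_scheme"
  assumes "abelian_group V" "zero V = 0" "add V = (+)" "\<And>a. a \<in> A \<Longrightarrow> f a \<in> carrier V"
  shows "(\<Oplus>\<^bsub>V\<^esub>a\<in>A. f a) = (\<Sum>a\<in>A. f a)"
proof -
  interpret V: abelian_group V by (rule assms(1))
  show ?thesis
  proof (cases "finite A")
    case True
    then show ?thesis using assms(4)
    proof (induction A)
      case (insert a A)
      then have "f \<in> A \<rightarrow> carrier V" "f a \<in> carrier V" by auto
      then show ?case using insert assms(3) by simp
    qed (use assms(2) in simp)
  qed (use assms(2) in \<open>simp add: finsum_def finprod_def\<close>)
qed

section \<open>The Verma module on a basis of monomials\<close>

text \<open>Coordinates in monomials in letters of negative degree. The action lifts a vector to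
  sorted words, multiplies on the left and straightens; by \<open>hw.induced_mult_left\<close> this
  is the action on the induced module.\<close>

definition verma_model :: "(lvir \<Rightarrow> complex) \<Rightarrow> (lvb multiset \<Rightarrow>\<^sub>0 complex) lv_module" where
  "verma_model \<phi> = \<lparr>carrier = {m. keys m \<subseteq> {\<mu>. set_mset \<mu> \<inter> lvb_nonneg = {}}},
     monoid.mult = undefined, one = undefined, zero = 0, add = (+), module.smult = scal,
     act = (\<lambda>x m. hw.induced \<phi> (deg1 x * mset_word m))\<rparr>"

lemma verma_model_simps [simp]:
  "carrier (verma_model \<phi>) = {m. keys m \<subseteq> {\<mu>. set_mset \<mu> \<inter> lvb_nonneg = {}}}"
  "\<zero>\<^bsub>verma_model \<phi>\<^esub> = 0" "add (verma_model \<phi>) = (+)" "module.smult (verma_model \<phi>) = scal"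
  "act (verma_model \<phi>) x m = hw.induced \<phi> (deg1 x * mset_word m)"
  by (simp_all add: verma_model_def)

lemma keys_add_subset:
  "keys p \<subseteq> S \<Longrightarrow> keys q \<subseteq> S \<Longrightarrow> keys (p + q) \<subseteq> S"
  using keys_add[of p q] by blast

lemma keys_scal_subset: "keys p \<subseteq> S \<Longrightarrow> keys (scal c p) \<subseteq> S"
  using keys_scal[of c p] by blast

lemma verma_model_space: "lv_space (verma_model \<phi>)"
proof -
  have "abelian_group (verma_model \<phi>)"
    by (rule abelian_group_plusI) (simp_all add: keys_add_subset)
  then show ?thesis
    using hw.keys_induced[of \<phi>] by (simp add: lv_space_def keys_scal_subset)
qed

subsection \<open>Enveloping algebras\<close>

lemma tensor_algebra_simps [simp]:
  "carrier (tensor_algebra S) = {p. keys p \<subseteq> words_over S}"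
  "monoid.mult (tensor_algebra S) = (*)" "\<one>\<^bsub>tensor_algebra S\<^esub> = 1" "\<zero>\<^bsub>tensor_algebra S\<^esub> = 0"
  "add (tensor_algebra S) = (+)" "module.smult (tensor_algebra S) = scal"
  by (simp_all add: tensor_algebra_def free_space_def)

lemma keys_mult_words:
  "keys p \<subseteq> words_over S \<Longrightarrow> keys q \<subseteq> words_over S
    \<Longrightarrow> keys (p * q) \<subseteq> words_over S"
  for p q :: "'b free_mon \<Rightarrow>\<^sub>0 complex"
  using keys_mult[of p q] by (fastforce simp: plus_free_mon_def)

lemma keys_deg1: "keys x \<subseteq> S \<Longrightarrow> keys (deg1 x) \<subseteq> words_over S"
  unfolding deg1_def by (rule keys_lin_ext) auto

lemma keys_diff_subset:
  "keys p \<subseteq> S \<Longrightarrow> keys q \<subseteq> S \<Longrightarrow> keys (p - q) \<subseteq> S"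
  for p q :: "'a \<Rightarrow>\<^sub>0 complex"
  using keys_add_subset[of p S "- q"] by simp

lemma tensor_algebra_group:
  "abelian_group (tensor_algebra S)"
  "keys p \<subseteq> words_over S \<Longrightarrow> inv\<^bsub>add_monoid (tensor_algebra S)\<^esub> p = - p"
  by (rule abelian_group_plusI; simp add: keys_add_subset)+

lemma tensor_algebra_ring: "ring (tensor_algebra S)"
proof (rule ringI)
  show "abelian_group (tensor_algebra S)" by (rule tensor_algebra_group)
  show "monoid (tensor_algebra S)"
    by (rule monoidI) (simp_all add: keys_mult_words mult.assoc zero_free_mon_def)
qed (simp_all add: algebra_simps)

lemma tensor_idealI:
  assumes "I \<subseteq> carrier (tensor_algebra S)" "0 \<in> I" "\<And>p q. p \<in> I \<Longrightarrow> q \<in> I \<Longrightarrow> p + q \<in> I"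
    "\<And>p. p \<in> I \<Longrightarrow> - p \<in> I"
    and "\<And>p q. p \<in> I \<Longrightarrow> keys q \<subseteq> words_over S \<Longrightarrow> p * q \<in> I \<and> q * p \<in> I"
  shows "ideal I (tensor_algebra S)"
proof (rule idealI[OF tensor_algebra_ring])
  have "inv\<^bsub>add_monoid (tensor_algebra S)\<^esub> p = - p" if "p \<in> I" for p
    using tensor_algebra_group(2) subsetD[OF assms(1) that] by simp
  then show "subgroup I (add_monoid (tensor_algebra S))"
    using assms(1-4) by unfold_locales simp_all
qed (use assms in auto)

lemma lv_env_ideal_gen: "lv_env_ideal S = Idl\<^bsub>tensor_algebra S\<^esub>
     {env_gen x y | x y. keys x \<subseteq> S \<and> keys y \<subseteq> S}"
  by (simp add: lv_env_ideal_def env_gen_def)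

lemma lv_env_ideal_minimal:
  assumes "ideal I (tensor_algebra S)"
    and "\<And>x y. keys x \<subseteq> S \<Longrightarrow> keys y \<subseteq> S \<Longrightarrow> env_gen x y \<in> I"
  shows "lv_env_ideal S \<subseteq> I"
  unfolding lv_env_ideal_gen
  by (rule ring.genideal_minimal[OF tensor_algebra_ring assms(1)]) (use assms(2) in auto)

lemma keys_env_gen:
  assumes "\<And>a b. a \<in> S \<Longrightarrow> b \<in> S \<Longrightarrow> keys (lvb_bracket a b) \<subseteq> S"
    and "keys x \<subseteq> S" "keys y \<subseteq> S"
  shows "keys (env_gen x y) \<subseteq> words_over S"
  unfolding env_gen_def
  by (intro keys_diff_subset keys_mult_words keys_deg1 keys_lv_bracket assms)

lemma lv_env_ideal:
  assumes S: "\<And>a b. a \<in> S \<Longrightarrow> b \<in> S \<Longrightarrow> keys (lvb_bracket a b) \<subseteq> S"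
  shows "ideal (lv_env_ideal S) (tensor_algebra S)"
    "\<And>x y. keys x \<subseteq> S \<Longrightarrow> keys y \<subseteq> S \<Longrightarrow> env_gen x y \<in> lv_env_ideal S"
proof -
  let ?G = "{env_gen x y | x y. keys x \<subseteq> S \<and> keys y \<subseteq> S}"
  have G: "?G \<subseteq> carrier (tensor_algebra S)"
  proof safe
    fix x y :: lvir assume "keys x \<subseteq> S" "keys y \<subseteq> S"
    from keys_env_gen[OF S this] show "env_gen x y \<in> carrier (tensor_algebra S)" by simp
  qed
  show "ideal (lv_env_ideal S) (tensor_algebra S)"
    unfolding lv_env_ideal_gen by (rule ring.genideal_ideal[OF tensor_algebra_ring G])
  show "env_gen x y \<in> lv_env_ideal S" if "keys x \<subseteq> S" "keys y \<subseteq> S" for x y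
    using ring.genideal_self[OF tensor_algebra_ring G] that unfolding lv_env_ideal_gen by blast
qed

lemma tensor_idealD:
  assumes "ideal I (tensor_algebra S)"
  shows "I \<subseteq> carrier (tensor_algebra S)" "0 \<in> I" "\<And>p q. p \<in> I \<Longrightarrow> q \<in> I \<Longrightarrow> p + q \<in> I"
    "\<And>p. p \<in> I \<Longrightarrow> - p \<in> I" "\<And>p q. p \<in> I \<Longrightarrow> q \<in> I \<Longrightarrow> p - q \<in> I"
    "\<And>p q. p \<in> I \<Longrightarrow> keys q \<subseteq> words_over S \<Longrightarrow> p * q \<in> I"
    "\<And>p q. p \<in> I \<Longrightarrow> keys q \<subseteq> words_over S \<Longrightarrow> q * p \<in> I"
proof -
  interpret ideal I "tensor_algebra S" by (rule assms)
  have sub: "subgroup I (add_monoid (tensor_algebra S))" by (rule a_subgroup)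
  show c: "I \<subseteq> carrier (tensor_algebra S)" "0 \<in> I" and add: "\<And>p q. p \<in> I \<Longrightarrow> q \<in> I \<Longrightarrow> p + q \<in> I"
    using subgroup.subset[OF sub] subgroup.one_closed[OF sub] subgroup.m_closed[OF sub] by simp_all
  show minus: "- p \<in> I" if "p \<in> I" for p
    using subgroup.m_inv_closed[OF sub that] tensor_algebra_group(2)[of p S] subsetD[OF c(1) that]
    by simp
  show "p - q \<in> I" if "p \<in> I" "q \<in> I" for p q
    using add[OF that(1) minus[OF that(2)]] by simp
  show "p * q \<in> I" "q * p \<in> I" if "p \<in> I" "keys q \<subseteq> words_over S" for p q
    using I_l_closed[of p q] I_r_closed[of p q] that by simp_all
qed

abbreviation "IU \<equiv> lv_env_ideal UNIV"
abbreviation "IB \<equiv> lv_env_ideal lvb_nonneg"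

lemma ideal_IU: "ideal IU (tensor_algebra UNIV)" and env_gen_IU: "env_gen x y \<in> IU"
  using lv_env_ideal[of UNIV] by simp_all

lemma ideal_IB: "ideal IB (tensor_algebra lvb_nonneg)"
  by (rule lv_env_ideal) (rule hw.br_B)

lemmas IU_simps = tensor_idealD[OF ideal_IU, simplified]
lemmas IB_simps = tensor_idealD[OF ideal_IB]

text \<open>The kernel of \<open>hw.induced\<close> is a left ideal but not a right one: d_1 lies in
  it and d_1 d_{-2} does not. Allowing arbitrary factors on both sides gives a two-sided ideal,
  which must contain the enveloping ideal.\<close>

lemma IU_induced: "p \<in> IU \<Longrightarrow> hw.induced \<phi> p = 0"
proof -
  have "ideal {p. \<forall>a b. hw.induced \<phi> (a * p * b) = 0} (tensor_algebra UNIV)"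
  proof (rule tensor_idealI)
    fix p q assume "p \<in> {p. \<forall>a b. hw.induced \<phi> (a * p * b) = 0}"
    then have "hw.induced \<phi> (a * p * (q * b)) = 0" "hw.induced \<phi> ((a * q) * p * b) = 0" for a b
      by simp_all
    then show "p * q \<in> {p. \<forall>a b. hw.induced \<phi> (a * p * b) = 0} \<and>
        q * p \<in> {p. \<forall>a b. hw.induced \<phi> (a * p * b) = 0}"
      by (simp add: mult.assoc)
  qed (simp_all add: distrib_left distrib_right hw.induced_linear)
  then have "IU \<subseteq> {p. \<forall>a b. hw.induced \<phi> (a * p * b) = 0}"
    by (rule lv_env_ideal_minimal) (simp add: induced_env_gen)
  then show "hw.induced \<phi> p = 0" if "p \<in> IU"
    using that by (auto dest!: subsetD spec[of _ 1])
qed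

text \<open>All representatives of a coset evaluate to the same scalar, which gives the image in
  \<open>hw_act\<close> its single element.\<close>

lemma IB_char: "p \<in> IB \<Longrightarrow> char_eval (hw_scalar \<phi>) p = 0"
proof -
  let ?J = "{p. keys p \<subseteq> words_over lvb_nonneg \<and> char_eval (hw_scalar \<phi>) p = 0}"
  have "ideal ?J (tensor_algebra lvb_nonneg)"
    by (rule tensor_idealI)
      (simp_all add: keys_add_subset keys_mult_words char_eval_linear char_eval_mult Collect_mono)
  then have "IB \<subseteq> ?J"
    by (rule lv_env_ideal_minimal)
      (simp add: char_eval_env_gen keys_env_gen hw.br_B)
  then show "p \<in> IB \<Longrightarrow> char_eval (hw_scalar \<phi>) p = 0" by auto
qed

text \<open>Hence the union in \<open>lv_env_incl\<close> is over equal cosets.\<close>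

lemma IB_IU: "IB \<subseteq> IU"
proof -
  have "ideal (IU \<inter> {p. keys p \<subseteq> words_over lvb_nonneg}) (tensor_algebra lvb_nonneg)"
    by (rule tensor_idealI) (simp_all add: keys_add_subset keys_mult_words IU_simps)
  then have "IB \<subseteq> IU \<inter> {p. keys p \<subseteq> words_over lvb_nonneg}"
    by (rule lv_env_ideal_minimal)
      (simp add: env_gen_IU keys_env_gen hw.br_B)
  then show ?thesis by blast
qed

lemma comm_rel_IU: "word u * hw.comm_rel x y * word v \<in> IU"
  unfolding env_gen_single[symmetric] by (intro IU_simps env_gen_IU)

section \<open>Computation with cosets in the enveloping algebras\<close>

definition cosU :: "lv_tensor \<Rightarrow> lv_tensor set" where
  "cosU p = {q. q - p \<in> IU}"

lemma cosU_eq_iff: "cosU p = cosU q \<longleftrightarrow> p - q \<in> IU"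
proof
  assume "cosU p = cosU q"
  moreover have "p \<in> cosU p" by (simp add: cosU_def IU_simps)
  ultimately show "p - q \<in> IU" by (simp add: cosU_def)
next
  assume *: "p - q \<in> IU"
  have "x - p \<in> IU \<longleftrightarrow> x - q \<in> IU" for x
    using IU_simps(3)[OF _ *, of "x - p"] IU_simps(5)[OF _ *, of "x - q"] by auto
  then show "cosU p = cosU q" by (simp add: cosU_def)
qed

lemma cosU_self: "p \<in> cosU p"
  by (simp add: cosU_def IU_simps)

lemma coset_IU: "IU +>\<^bsub>tensor_algebra UNIV\<^esub> p = cosU p"
proof -
  have "x \<in> IU +>\<^bsub>tensor_algebra UNIV\<^esub> p" if "x - p \<in> IU" for x
    using that by (auto simp: a_r_coset_def' intro!: bexI[of _ "x - p"])
  then show ?thesis by (auto simp: a_r_coset_def' cosU_def)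
qed

lemma U_carrier: "carrier U_lv = range cosU"
  by (auto simp: lv_env_def quot_module_def FactRing_def ring.defs module.defs A_RCOSETS_def' coset_IU)

lemma U_ops:
  "cosU p \<oplus>\<^bsub>U_lv\<^esub> cosU q = cosU (p + q)" "cosU p \<otimes>\<^bsub>U_lv\<^esub> cosU q = cosU (p * q)"
  "c \<odot>\<^bsub>U_lv\<^esub> cosU p = cosU (scal c p)"
proof -
  have "x \<in> set_add (tensor_algebra UNIV) (cosU p) (cosU q)" if "x \<in> cosU (p + q)" for x
  proof -
    have "x - q \<in> cosU p" "x = (x - q) + q" using that by (simp_all add: cosU_def algebra_simps)
    then show ?thesis using cosU_self[of q] unfolding set_add_def' by force
  qed
  moreover have "x \<in> cosU (p + q)" if "x \<in> set_add (tensor_algebra UNIV) (cosU p) (cosU q)" for x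
  proof -
    have "\<exists>a\<in>cosU p. \<exists>b\<in>cosU q. x = a + b" using that by (simp add: set_add_def')
    then obtain a b where "a - p \<in> IU" "b - q \<in> IU" "x = a + b" unfolding cosU_def by blast
    then show ?thesis using IU_simps(3)[of "a - p" "b - q"] by (simp add: cosU_def algebra_simps)
  qed
  ultimately show "cosU p \<oplus>\<^bsub>U_lv\<^esub> cosU q = cosU (p + q)"
    by (auto simp: lv_env_def quot_module_def FactRing_def ring.defs module.defs)
  have "cosU (a * b) = cosU (p * q)" if "a \<in> cosU p" "b \<in> cosU q" for a b
  proof -
    have "a * b - p * q = (a - p) * b + p * (b - q)" by (simp add: algebra_simps)
    then show ?thesis using that unfolding cosU_eq_iff by (simp add: cosU_def IU_simps)
  qed
  then have "(\<Union>a\<in>cosU p. \<Union>b\<in>cosU q. cosU (a * b)) = cosU (p * q)"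
    by (intro UN_constant_eq[OF cosU_self] ballI)
  then show "cosU p \<otimes>\<^bsub>U_lv\<^esub> cosU q = cosU (p * q)"
    by (simp add: lv_env_def quot_module_def FactRing_def ring.defs module.defs rcoset_mult_def coset_IU)
  have "cosU (scal c a) = cosU (scal c p)" if "a \<in> cosU p" for a
  proof -
    have "scal c a - scal c p = scal c 1 * (a - p)" by (simp add: scal_mult_left scal_diff)
    then show ?thesis using that unfolding cosU_eq_iff by (simp add: cosU_def IU_simps)
  qed
  then have "(\<Union>a\<in>cosU p. cosU (scal c a)) = cosU (scal c p)"
    by (intro UN_constant_eq[OF cosU_self] ballI)
  then show "c \<odot>\<^bsub>U_lv\<^esub> cosU p = cosU (scal c p)"
    by (simp add: lv_env_def quot_module_def FactRing_def ring.defs module.defs coset_IU)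
qed

lemma lv_incl_cosU: "lv_incl x = cosU (deg1 x)"
  by (simp add: lv_incl_def coset_IU)

definition cosB :: "lv_tensor \<Rightarrow> lv_tensor set" where
  "cosB p = IB +>\<^bsub>tensor_algebra lvb_nonneg\<^esub> p"

lemma B_carrier: "carrier (lv_env lvb_nonneg) = cosB ` {p. keys p \<subseteq> words_over lvb_nonneg}"
  by (auto simp: lv_env_def quot_module_def FactRing_def ring.defs module.defs A_RCOSETS_def' cosB_def)

lemma cosB_mem: "q \<in> cosB p \<longleftrightarrow> q - p \<in> IB"
  by (auto simp: cosB_def a_r_coset_def' intro!: bexI[of _ "q - p"])

lemma lv_env_incl_cosB: "lv_env_incl (cosB p) = cosU p"
proof -
  have "cosU q = cosU p" if "q \<in> cosB p" for q
    using subsetD[OF IB_IU, of "q - p"] that by (simp add: cosU_eq_iff cosB_mem)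
  moreover have "p \<in> cosB p" by (simp add: cosB_mem IB_simps)
  ultimately show ?thesis unfolding lv_env_incl_def coset_IU by (intro UN_constant_eq ballI)
qed

lemma hw_act_cosB: "hw_act \<phi> (cosB p) z = char_eval (hw_scalar \<phi>) p * z"
proof -
  have "the_elem (hw_eval \<phi> ` cosB p) = hw_eval \<phi> p"
    unfolding hw_eval_char_eval
  proof (rule the_elem_image_unique)
    have "p \<in> cosB p" by (simp add: cosB_mem IB_simps)
    then show "cosB p \<noteq> {}" using ex_in_conv[of "cosB p"] by metis
    show "char_eval (hw_scalar \<phi>) q = char_eval (hw_scalar \<phi>) p" if "q \<in> cosB p" for q
      using IB_char[of "q - p" \<phi>] that by (simp add: cosB_mem char_eval_linear)
  qed
  then show ?thesis by (simp add: hw_act_def hw_eval_char_eval)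
qed

subsection \<open>The tensor product\<close>

abbreviation tensor_space :: "(complex, lv_tensor set \<times> complex \<Rightarrow>\<^sub>0 complex) module" where
  "tensor_space \<equiv> free_space (carrier U_lv \<times> carrier hw_space)"

definition verma_null :: "(lvir \<Rightarrow> complex) \<Rightarrow> (lv_tensor set \<times> complex \<Rightarrow>\<^sub>0 complex) set" where
  "verma_null \<phi> = tensor_null (lv_env lvb_nonneg) U_lv (\<lambda>u X. u \<otimes>\<^bsub>U_lv\<^esub> lv_env_incl X)
     hw_space (hw_act \<phi>)"

text \<open>The action of \<open>lv_verma\<close> before the tensor relations are imposed. It
  exhibits \<open>lv_verma\<close> as an \<open>lv_quotient\<close>, so that the first isomorphism
  theorem applies; linearity in \<open>x\<close> appears only after passing to the quotient.\<close>

definition free_verma :: "(lv_tensor set \<times> complex \<Rightarrow>\<^sub>0 complex) lv_module" where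
  "free_verma = \<lparr>carrier = carrier tensor_space, monoid.mult = undefined, one = undefined,
     zero = 0, add = (+), module.smult = scal,
     act = (\<lambda>x. lin_ext (\<lambda>(u, z). pure (lv_incl x \<otimes>\<^bsub>U_lv\<^esub> u) z))\<rparr>"

lemma free_space_simps [simp]:
  "carrier (free_space S) = {p. keys p \<subseteq> S}" "zero (free_space S) = 0"
  "add (free_space S) = (+)" "module.smult (free_space S) = scal"
  by (simp_all add: free_space_def)

lemma hw_space_simps [simp]:
  "carrier hw_space = UNIV" "add hw_space = (+)" "module.smult hw_space = (*)"
  by (simp_all add: hw_space_def complex_field_def ring.defs module.defs)

lemma free_verma_simps [simp]:
  "carrier free_verma = {p. keys p \<subseteq> range cosU \<times> UNIV}" "zero free_verma = 0"
  "add free_verma = (+)" "module.smult free_verma = scal"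
  "act free_verma x = lin_ext (\<lambda>(u, z). pure (lv_incl x \<otimes>\<^bsub>U_lv\<^esub> u) z)"
  by (simp_all add: free_verma_def U_carrier)

lemma lv_verma_quotient: "lv_verma \<phi> = lv_quotient free_verma (verma_null \<phi>)"
  by (simp add: lv_verma_def lv_quotient_def quot_module_def tensor_product_def verma_null_def
      FactRing_def A_RCOSETS_def' a_r_coset_def' set_add_def' rcoset_mult_def
      free_space_def free_verma_def module.defs ring.defs lv_module.defs Let_def fun_eq_iff)

text \<open>The tensor of u and z goes to z times u v_0. \<open>SOME\<close> picks a representative
  of the coset \<open>u\<close>; by \<open>IU_induced\<close> the choice is immaterial.\<close>

definition verma_map ::
  "(lvir \<Rightarrow> complex) \<Rightarrow> (lv_tensor set \<times> complex \<Rightarrow>\<^sub>0 complex) \<Rightarrow> (lvb multiset \<Rightarrow>\<^sub>0 complex)" where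
  "verma_map \<phi> = lin_ext (\<lambda>(u, z). scal z (hw.induced \<phi> (SOME p. p \<in> u)))"

lemma verma_map_linear:
  "verma_map \<phi> (p + q) = verma_map \<phi> p + verma_map \<phi> q"
  "verma_map \<phi> (p - q) = verma_map \<phi> p - verma_map \<phi> q"
  "verma_map \<phi> (- p) = - verma_map \<phi> p"
  "verma_map \<phi> (scal c p) = scal c (verma_map \<phi> p)" "verma_map \<phi> 0 = 0"
  by (simp_all add: verma_map_def lin_ext_linear)

lemma verma_map_pure:
  "verma_map \<phi> (single (cosU p, z) c) = scal (c * z) (hw.induced \<phi> p)"
proof -
  have "(SOME q. q \<in> cosU p) \<in> cosU p" using cosU_self by (rule someI)
  then have "(SOME q. q \<in> cosU p) - p \<in> IU" by (simp add: cosU_def)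
  from IU_induced[OF this, of \<phi>] have "hw.induced \<phi> (SOME q. q \<in> cosU p) = hw.induced \<phi> p"
    by (simp add: hw.induced_linear)
  then show ?thesis by (simp add: verma_map_def)
qed

lemma free_verma_group:
  "abelian_group free_verma"
  "p \<in> carrier free_verma \<Longrightarrow> inv\<^bsub>add_monoid free_verma\<^esub> p = - p"
  by (rule abelian_group_plusI; simp add: keys_add_subset)+

lemma free_verma_act_pure:
  "act free_verma x (single (cosU p, z) c) = single (cosU (deg1 x * p), z) c"
  by (simp add: lv_incl_cosU U_ops)

lemma free_verma_induct [consumes 1, case_names zero pure scale add]:
  assumes p: "p \<in> carrier free_verma"
    and "P 0" "\<And>q z. P (pure (cosU q) z)" "\<And>c q. P q \<Longrightarrow> P (scal c q)"
    "\<And>q r. P q \<Longrightarrow> P r \<Longrightarrow> P (q + r)"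
  shows "P p"
proof (induction p rule: pm_keys_induct)
  case (single a)
  then obtain q where "fst a = cosU q" using p by auto
  then show ?case using assms(3)[of q "snd a"] by (metis prod.collapse)
qed (fact assms)+

lemma keys_induced_lower: "keys (hw.induced \<phi> p) \<subseteq> {\<mu>. set_mset \<mu> \<inter> lvb_nonneg = {}}"
  using hw.keys_induced .

lemma keys_act_free: "p \<in> carrier free_verma \<Longrightarrow> act free_verma x p \<in> carrier free_verma"
proof (induction p rule: free_verma_induct)
  case (pure q z)
  show ?case unfolding free_verma_act_pure by simp
qed (simp_all add: lin_ext_linear keys_add_subset keys_scal_subset)

lemma verma_map_epi: "lv_epi (verma_map \<phi>) free_verma (verma_model \<phi>)"
proof -
  have "lv_space free_verma"
    using free_verma_group(1) keys_act_free by (auto simp: lv_space_def dest: subsetD[OF keys_scal])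
  moreover have "verma_map \<phi> p \<in> carrier (verma_model \<phi>)" if "p \<in> carrier free_verma" for p
    using that
  proof (induction p rule: free_verma_induct)
    case (pure q z)
    show ?case unfolding verma_map_pure verma_model_simps mem_Collect_eq
      by (intro keys_scal_subset keys_induced_lower)
  qed (simp_all add: verma_map_linear keys_add_subset keys_scal_subset)
  moreover have "m \<in> verma_map \<phi> ` carrier free_verma" if "m \<in> carrier (verma_model \<phi>)" for m
  proof (rule image_eqI)
    show "m = verma_map \<phi> (pure (cosU (mset_word m)) 1)"
      using that hw.induced_mset_word[of m \<phi>] by (simp add: verma_map_pure)
  qed simp
  moreover have "verma_map \<phi> (act free_verma x p) = act (verma_model \<phi>) x (verma_map \<phi> p)"
    if "p \<in> carrier free_verma" for x p
    using that
  proof (induction p rule: free_verma_induct)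
    case (pure q z)
    show ?case
      unfolding free_verma_act_pure verma_map_pure
      using hw.induced_mult_left[of \<phi> "deg1 x" q]
      by (simp add: mset_word_linear scal_mult_right hw.induced_linear)
  qed (simp_all add: verma_map_linear lin_ext_linear mset_word_linear distrib_left hw.induced_linear
      scal_mult_right)
  ultimately show ?thesis
    using verma_model_space unfolding lv_epi_def by (auto simp: verma_map_linear)
qed

lemma verma_null_submodule:
  "verma_null \<phi> = \<Inter>{N. submodule N complex_field tensor_space \<and>
    tensor_relations (lv_env lvb_nonneg) U_lv (\<lambda>u X. u \<otimes>\<^bsub>U_lv\<^esub> lv_env_incl X) hw_space (hw_act \<phi>) \<subseteq> N}"
  by (simp add: verma_null_def tensor_null_def subspace_generated_def)

lemma tensor_space_group:
  "abelian_group tensor_space"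
  "p \<in> carrier tensor_space \<Longrightarrow> inv\<^bsub>add_monoid tensor_space\<^esub> p = - p"
  by (rule abelian_group_plusI; simp add: keys_add_subset)+

lemma submodule_tensor_spaceI:
  assumes "N \<subseteq> carrier tensor_space" "0 \<in> N" "\<And>p q. p \<in> N \<Longrightarrow> q \<in> N \<Longrightarrow> p + q \<in> N"
    "\<And>c p. p \<in> N \<Longrightarrow> scal c p \<in> N"
  shows "submodule N complex_field tensor_space"
proof -
  have "inv\<^bsub>add_monoid tensor_space\<^esub> p \<in> N" if "p \<in> N" for p
    using tensor_space_group(2)[OF subsetD[OF assms(1) that]] assms(4)[OF that, of "- 1"]
    by (simp add: scal_minus_left)
  then have "subgroup N (add_monoid tensor_space)"
    using assms by unfold_locales simp_all
  then show ?thesis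
    using assms(4) by (simp add: submodule_def submodule_axioms_def)
qed

lemma submodule_tensor_spaceD:
  assumes "submodule N complex_field tensor_space"
  shows "0 \<in> N" "\<And>p q. p \<in> N \<Longrightarrow> q \<in> N \<Longrightarrow> p + q \<in> N" "\<And>c p. p \<in> N \<Longrightarrow> scal c p \<in> N"
    "N \<subseteq> carrier tensor_space"
proof -
  interpret N: submodule N complex_field tensor_space by (rule assms)
  show "0 \<in> N" "\<And>p q. p \<in> N \<Longrightarrow> q \<in> N \<Longrightarrow> p + q \<in> N" "\<And>c p. p \<in> N \<Longrightarrow> scal c p \<in> N"
    "N \<subseteq> carrier tensor_space"
    using N.one_closed N.m_closed N.smult_closed N.subset by (simp_all add: complex_field_def)
qed

definition null_equiv where
  "null_equiv \<phi> p q \<longleftrightarrow> p - q \<in> verma_null \<phi>"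

lemma verma_null_closed:
  "0 \<in> verma_null \<phi>" "p \<in> verma_null \<phi> \<Longrightarrow> q \<in> verma_null \<phi> \<Longrightarrow> p + q \<in> verma_null \<phi>"
  "p \<in> verma_null \<phi> \<Longrightarrow> scal c p \<in> verma_null \<phi>"
  unfolding verma_null_submodule using submodule_tensor_spaceD by blast+

lemma verma_null_minus: "p \<in> verma_null \<phi> \<Longrightarrow> - p \<in> verma_null \<phi>"
  using verma_null_closed(3)[of p \<phi> "- 1"] by (simp add: scal_minus_left)

lemma null_equiv_refl: "null_equiv \<phi> p p"
  by (simp add: null_equiv_def verma_null_closed)

lemma null_equiv_sym: "null_equiv \<phi> p q \<Longrightarrow> null_equiv \<phi> q p"
  using verma_null_minus[of "p - q" \<phi>] by (simp add: null_equiv_def)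

lemma null_equiv_trans [trans]: "null_equiv \<phi> p q \<Longrightarrow> null_equiv \<phi> q r \<Longrightarrow> null_equiv \<phi> p r"
  using verma_null_closed(2)[of "p - q" \<phi> "q - r"] by (simp add: null_equiv_def)

lemma null_equiv_add:
  "null_equiv \<phi> p q \<Longrightarrow> null_equiv \<phi> p' q' \<Longrightarrow> null_equiv \<phi> (p + p') (q + q')"
  using verma_null_closed(2)[of "p - q" \<phi> "p' - q'"] by (simp add: null_equiv_def algebra_simps)

lemma null_equiv_scal: "null_equiv \<phi> p q \<Longrightarrow> null_equiv \<phi> (scal c p) (scal c q)"
  using verma_null_closed(3)[of "p - q" \<phi> c] by (simp add: null_equiv_def scal_diff)

lemma tensor_relationsI:
  assumes "m \<in> carrier M" "n \<in> carrier N"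
  shows "m' \<in> carrier M \<Longrightarrow>
      pure (m \<oplus>\<^bsub>M\<^esub> m') n - pure m n - pure m' n \<in> tensor_relations A M r N l"
    "pure (c \<odot>\<^bsub>M\<^esub> m) n - scal c (pure m n) \<in> tensor_relations A M r N l"
    "pure m (c \<odot>\<^bsub>N\<^esub> n) - scal c (pure m n) \<in> tensor_relations A M r N l"
    "a \<in> carrier A \<Longrightarrow> pure (r m a) n - pure m (l a n) \<in> tensor_relations A M r N l"
  unfolding tensor_relations_def
  subgoal by (rule UnI1, rule UnI1, rule UnI1, rule UnI1) (use assms in blast)
  subgoal by (rule UnI1, rule UnI1, rule UnI2) (use assms in blast)
  subgoal by (rule UnI1, rule UnI2) (use assms in blast)
  subgoal by (rule UnI2) (use assms in blast)
  done

lemma null_equiv_relations: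
  "null_equiv \<phi> (pure (cosU (p + q)) z) (pure (cosU p) z + pure (cosU q) z)"
  "null_equiv \<phi> (pure (cosU (scal c p)) z) (scal c (pure (cosU p) z))"
  "null_equiv \<phi> (pure (cosU p) z) (scal z (pure (cosU p) 1))"
  "keys b \<subseteq> words_over lvb_nonneg \<Longrightarrow>
    null_equiv \<phi> (pure (cosU (p * b)) z) (pure (cosU p) (char_eval (hw_scalar \<phi>) b * z))"
proof -
  let ?R = "tensor_relations (lv_env lvb_nonneg) U_lv (\<lambda>u X. u \<otimes>\<^bsub>U_lv\<^esub> lv_env_incl X) hw_space (hw_act \<phi>)"
  have R: "r \<in> verma_null \<phi>" if "r \<in> ?R" for r
    using that unfolding verma_null_submodule by blast
  have U: "cosU p \<in> carrier U_lv" for p by (simp add: U_carrier)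
  have "pure (cosU p \<oplus>\<^bsub>U_lv\<^esub> cosU q) z - pure (cosU p) z - pure (cosU q) z \<in> ?R"
    by (intro tensor_relationsI(1)) (simp_all add: U)
  from R[OF this] show "null_equiv \<phi> (pure (cosU (p + q)) z) (pure (cosU p) z + pure (cosU q) z)"
    by (simp add: null_equiv_def U_ops algebra_simps)
  have "pure (c \<odot>\<^bsub>U_lv\<^esub> cosU p) z - scal c (pure (cosU p) z) \<in> ?R"
    by (intro tensor_relationsI(2)) (simp_all add: U)
  from R[OF this] show "null_equiv \<phi> (pure (cosU (scal c p)) z) (scal c (pure (cosU p) z))"
    by (simp add: null_equiv_def U_ops)
  have "pure (cosU p) (z \<odot>\<^bsub>hw_space\<^esub> 1) - scal z (pure (cosU p) 1) \<in> ?R"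
    by (intro tensor_relationsI(3)) (simp_all add: U)
  from R[OF this] show "null_equiv \<phi> (pure (cosU p) z) (scal z (pure (cosU p) 1))"
    by (simp add: null_equiv_def)
  assume b: "keys b \<subseteq> words_over lvb_nonneg"
  then have "cosB b \<in> carrier (lv_env lvb_nonneg)" by (auto simp: B_carrier)
  then have "pure (cosU p \<otimes>\<^bsub>U_lv\<^esub> lv_env_incl (cosB b)) z - pure (cosU p) (hw_act \<phi> (cosB b) z) \<in> ?R"
    using tensor_relationsI(4)[of "cosU p" U_lv z hw_space "cosB b" "lv_env lvb_nonneg"
        "\<lambda>u X. u \<otimes>\<^bsub>U_lv\<^esub> lv_env_incl X" "hw_act \<phi>"] U by simp
  from R[OF this]
  show "null_equiv \<phi> (pure (cosU (p * b)) z) (pure (cosU p) (char_eval (hw_scalar \<phi>) b * z))"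
    by (simp add: null_equiv_def U_ops lv_env_incl_cosB hw_act_cosB)
qed

lemma null_equiv_pure:
  assumes "p \<in> carrier free_verma"
  shows "\<exists>q. null_equiv \<phi> p (pure (cosU q) 1)"
  using assms
proof (induction p rule: free_verma_induct)
  case zero
  then show ?case using null_equiv_relations(2)[of \<phi> 0 0 1] null_equiv_sym by fastforce
next
  case (pure q z)
  then show ?case
    using null_equiv_trans[OF null_equiv_relations(3) null_equiv_sym[OF null_equiv_relations(2)]] by blast
next
  case (scale c q)
  then obtain r where "null_equiv \<phi> q (pure (cosU r) 1)" by blast
  from null_equiv_trans[OF null_equiv_scal[OF this] null_equiv_sym[OF null_equiv_relations(2)]]
  show ?case by blast
next
  case (add p q)
  then obtain r s where "null_equiv \<phi> p (pure (cosU r) 1)" "null_equiv \<phi> q (pure (cosU s) 1)" by blast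
  from null_equiv_trans[OF null_equiv_add[OF this] null_equiv_sym[OF null_equiv_relations(1)]]
  show ?case by blast
qed

text \<open>Spanning in the tensor product: in a sorted word the letters of nonnegative degree stand
  on the right, cross the tensor sign by the balancing relation and become scalars.\<close>

lemma null_equiv_normal:
  "null_equiv \<phi> (pure (cosU q) 1) (pure (cosU (mset_word (hw.induced \<phi> q))) 1)"
proof -
  have "\<forall>x\<in>UNIV. \<forall>y\<in>UNIV. keys (lvb_bracket x y) \<subseteq> UNIV"
    "keys q \<subseteq> words_over UNIV" by simp_all
  then show ?thesis
  proof (induction q rule: hw.pbw_induct)
    case zero
    then show ?case by (simp add: hw.induced_linear mset_word_linear null_equiv_refl)
  next
    case (add q r)
    have "null_equiv \<phi> (pure (cosU (q + r)) 1) (pure (cosU q) 1 + pure (cosU r) 1)"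
      by (rule null_equiv_relations)
    also have "null_equiv \<phi> (pure (cosU q) 1 + pure (cosU r) 1)
        (pure (cosU (mset_word (hw.induced \<phi> q))) 1 + pure (cosU (mset_word (hw.induced \<phi> r))) 1)"
      using add by (rule null_equiv_add)
    also have "null_equiv \<phi> \<dots> (pure (cosU (mset_word (hw.induced \<phi> q) + mset_word (hw.induced \<phi> r))) 1)"
      by (rule null_equiv_sym[OF null_equiv_relations(1)])
    finally show ?case by (simp add: hw.induced_linear mset_word_linear)
  next
    case (scale c q)
    have "null_equiv \<phi> (pure (cosU (scal c q)) 1) (scal c (pure (cosU q) 1))"
      by (rule null_equiv_relations)
    also have "null_equiv \<phi> (scal c (pure (cosU q) 1)) (scal c (pure (cosU (mset_word (hw.induced \<phi> q))) 1))"
      using scale by (rule null_equiv_scal)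
    also have "null_equiv \<phi> \<dots> (pure (cosU (scal c (mset_word (hw.induced \<phi> q)))) 1)"
      by (rule null_equiv_sym[OF null_equiv_relations(2)])
    finally show ?case by (simp add: hw.induced_linear mset_word_linear)
  next
    case (sorted w)
    then obtain s y where w: "w = s @ y" "sorted s" "sorted y" "set s \<inter> lvb_nonneg = {}" "set y \<subseteq> lvb_nonneg"
      using hw.sorted_split by blast
    define c where "c = char_eval (hw_scalar \<phi>) (word y)"
    have "null_equiv \<phi> (pure (cosU (word s * word y)) 1) (pure (cosU (word s)) (c * 1))"
      unfolding c_def by (rule null_equiv_relations(4)) (use w in simp)
    also have "null_equiv \<phi> \<dots> (scal (c * 1) (pure (cosU (word s)) 1))"
      by (rule null_equiv_relations)
    also have "null_equiv \<phi> \<dots> (pure (cosU (scal (c * 1) (word s))) 1)"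
      by (rule null_equiv_sym[OF null_equiv_relations(2)])
    finally show ?case
      using hw.induced_sorted[of s y \<phi>] w sorted
      by (simp add: c_def word_append mset_word_single del: scal_single)
  next
    case (rel u x y v)
    have "cosU (word u * hw.comm_rel x y * word v) = cosU 0"
      unfolding cosU_eq_iff by (simp add: comm_rel_IU)
    then show ?case
      by (simp add: hw.induced_comm_rel mset_word_linear null_equiv_refl)
  qed
qed

lemma tensor_relations_kernel:
  assumes "r \<in> tensor_relations (lv_env lvb_nonneg) U_lv (\<lambda>u X. u \<otimes>\<^bsub>U_lv\<^esub> lv_env_incl X)
      hw_space (hw_act \<phi>)"
  shows "r \<in> carrier free_verma \<and> verma_map \<phi> r = 0"
proof -
  consider p q z where "r = pure (cosU (p + q)) z - pure (cosU p) z - pure (cosU q) z"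
    | p z z' where "r = pure (cosU p) (z + z') - pure (cosU p) z - pure (cosU p) z'"
    | c p z where "r = pure (cosU (scal c p)) z - scal c (pure (cosU p) z)"
    | c p z where "r = pure (cosU p) (c * z) - scal c (pure (cosU p) z)"
    | p b z where "keys b \<subseteq> words_over lvb_nonneg"
      "r = pure (cosU (p * b)) z - pure (cosU p) (char_eval (hw_scalar \<phi>) b * z)"
    using assms unfolding tensor_relations_def U_carrier B_carrier hw_space_simps Un_iff mem_Collect_eq
    by (elim disjE exE conjE imageE) (simp_all add: U_ops lv_env_incl_cosB hw_act_cosB)
  then show ?thesis
  proof cases
    case 5
    then show ?thesis using hw.induced_mult_right[OF 5(1), of \<phi> p]
      by (simp add: verma_map_linear verma_map_pure keys_diff_subset mult.commute)
  qed (simp_all add: verma_map_linear verma_map_pure keys_diff_subset hw.induced_linear scal_add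
      scal_add_left mult.commute)
qed

text \<open>Every relation is killed by \<open>verma_map\<close>. Conversely a tensor is equivalent
  to some q \<otimes> 1, and q to its normal representative; if the image vanishes, this
  representative is 0.\<close>

lemma verma_null_kernel: "verma_null \<phi> = {p \<in> carrier free_verma. verma_map \<phi> p = 0}"
proof (intro equalityI subsetI)
  let ?N = "{p \<in> carrier free_verma. verma_map \<phi> p = 0}"
  have "submodule ?N complex_field tensor_space"
    by (rule submodule_tensor_spaceI)
      (simp_all add: U_carrier verma_map_linear keys_add_subset keys_scal_subset Collect_mono)
  moreover have "tensor_relations (lv_env lvb_nonneg) U_lv (\<lambda>u X. u \<otimes>\<^bsub>U_lv\<^esub> lv_env_incl X)
      hw_space (hw_act \<phi>) \<subseteq> ?N"
    using tensor_relations_kernel by blast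
  ultimately show null: "p \<in> ?N" if "p \<in> verma_null \<phi>" for p
    using that unfolding verma_null_submodule by blast
  fix p assume p: "p \<in> ?N"
  then obtain q where q: "null_equiv \<phi> p (pure (cosU q) 1)" using null_equiv_pure by blast
  then have "verma_map \<phi> (p - pure (cosU q) 1) = 0" using null by (simp add: null_equiv_def)
  then have "hw.induced \<phi> q = 0" using p by (simp add: verma_map_linear verma_map_pure)
  then have "null_equiv \<phi> (pure (cosU q) 1) (pure (cosU 0) 1)"
    using null_equiv_normal[of \<phi> q] by (simp add: mset_word_linear)
  moreover have "null_equiv \<phi> (pure (cosU 0) 1) 0"
    using null_equiv_relations(2)[of \<phi> 0 0 1] by simp
  ultimately have "null_equiv \<phi> p 0" using q null_equiv_trans by blast
  then show "p \<in> verma_null \<phi>" by (simp add: null_equiv_def)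
qed

definition verma_iso :: "(lvir \<Rightarrow> complex) \<Rightarrow> verma_vec \<Rightarrow> (lvb multiset \<Rightarrow>\<^sub>0 complex)" where
  "verma_iso \<phi> = (\<lambda>X. the_elem (verma_map \<phi> ` X))"

theorem verma_iso: "lv_iso (verma_iso \<phi>) (lv_verma \<phi>) (verma_model \<phi>)"
  unfolding verma_iso_def lv_verma_quotient
  by (rule lv_quotient_iso(1)[OF verma_map_epi]) (simp add: verma_null_kernel)

section \<open>Recurrences and exp-polynomial functions\<close>

text \<open>The polynomial \<open>p\<close> evaluated at the shift operator that sends f to k
  \<mapsto> f (k + 1). By \<open>shift_act_mult\<close> sequences become a module over the
  polynomial ring.\<close>

definition shift_act :: "complex poly \<Rightarrow> (int \<Rightarrow> complex) \<Rightarrow> int \<Rightarrow> complex" where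
  "shift_act p f k = (\<Sum>i\<le>degree p. coeff p i * f (k + int i))"

lemma shift_act_bound:
  assumes "degree p \<le> n"
  shows "shift_act p f k = (\<Sum>i\<le>n. coeff p i * f (k + int i))"
  unfolding shift_act_def
  by (rule sum.mono_neutral_left) (use assms in \<open>auto simp: coeff_eq_0\<close>)

lemma shift_act_pCons: "shift_act (pCons a p) f k = a * f k + shift_act p f (k + 1)"
proof -
  have "shift_act (pCons a p) f k = (\<Sum>i\<le>Suc (degree p). coeff (pCons a p) i * f (k + int i))"
    by (rule shift_act_bound) (rule degree_pCons_le)
  also have "\<dots> = a * f k + (\<Sum>i\<le>degree p. coeff p i * f (k + 1 + int i))"
    by (simp add: sum.atMost_Suc_shift add.assoc del: sum.atMost_Suc)
  finally show ?thesis by (simp add: shift_act_def)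
qed

lemma shift_act_0 [simp]: "shift_act 0 f k = 0"
  by (simp add: shift_act_def)

lemma shift_act_add: "shift_act (p + q) f k = shift_act p f k + shift_act q f k"
  using degree_add_le_max[of p q]
  by (simp add: shift_act_bound[of _ "max (degree p) (degree q)"] distrib_right sum.distrib)

lemma shift_act_smult: "shift_act (Polynomial.smult c p) f k = c * shift_act p f k"
  using degree_smult_le[of c p]
  by (simp add: shift_act_bound[of _ "degree p"] sum_distrib_left mult.assoc)

lemma shift_act_mult: "shift_act (p * q) f k = shift_act p (shift_act q f) k"
  by (induction p arbitrary: k)
    (simp_all add: shift_act_pCons shift_act_add shift_act_smult)

lemma shift_act_lincomb:
  "shift_act p (\<lambda>k. f k + g k) k = shift_act p f k + shift_act p g k"
  "shift_act p (\<lambda>k. c * f k) k = c * shift_act p f k"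
  "shift_act p (\<lambda>k. \<Sum>a\<in>A. h a k) k = (\<Sum>a\<in>A. shift_act p (h a) k)"
  "shift_act p (\<lambda>k. 0) k = 0"
proof -
  show "shift_act p (\<lambda>k. \<Sum>a\<in>A. h a k) k = (\<Sum>a\<in>A. shift_act p (h a) k)"
    unfolding shift_act_def by (simp add: sum_distrib_left sum.swap[of _ A])
qed (simp_all add: shift_act_def distrib_left sum.distrib sum_distrib_left mult_ac)

definition recurrent :: "(int \<Rightarrow> complex) \<Rightarrow> bool" where
  "recurrent f \<longleftrightarrow> (\<exists>p. p \<noteq> 0 \<and> (\<forall>k. shift_act p f k = 0))"

lemma shift_act_mult_0:
  assumes "\<forall>k. shift_act p f k = 0"
  shows "shift_act (p * q) f k = 0"
proof -
  have "shift_act p f = (\<lambda>k. 0)" using assms by auto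
  then show ?thesis
    using shift_act_mult[of q p f k] by (simp add: mult.commute shift_act_lincomb)
qed

lemma recurrent_add:
  assumes "recurrent f" "recurrent g"
  shows "recurrent (\<lambda>k. f k + g k)"
proof -
  obtain p q where pq: "p \<noteq> 0" "\<forall>k. shift_act p f k = 0" "q \<noteq> 0" "\<forall>k. shift_act q g k = 0"
    using assms by (auto simp: recurrent_def)
  have "shift_act (p * q) (\<lambda>k. f k + g k) k = 0" for k
    using shift_act_mult_0[OF pq(2), of q k] shift_act_mult_0[OF pq(4), of p k]
    by (simp add: shift_act_lincomb mult.commute)
  then show ?thesis using pq unfolding recurrent_def by (intro exI[of _ "p * q"]) simp
qed

lemma recurrent_scale: "recurrent f \<Longrightarrow> recurrent (\<lambda>k. c * f k)"
  by (auto simp: recurrent_def shift_act_lincomb)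

lemma recurrent_common:
  assumes "recurrent f" "recurrent g"
  obtains p where "p \<noteq> 0" "\<And>k. shift_act p f k = 0" "\<And>k. shift_act p g k = 0"
proof -
  obtain p q where pq: "p \<noteq> 0" "\<forall>k. shift_act p f k = 0" "q \<noteq> 0" "\<forall>k. shift_act q g k = 0"
    using assms by (auto simp: recurrent_def)
  show ?thesis
    using that[of "p * q"] pq shift_act_mult_0[OF pq(2), of q] shift_act_mult_0[OF pq(4), of p]
    by (simp add: mult.commute)
qed

text \<open>A power of the shift can be cancelled because the sequences are indexed by all integers.\<close>

lemma shift_act_unit_constant_term:
  assumes "p \<noteq> 0" "\<And>k. shift_act p f k = 0" "\<And>k. shift_act p g k = 0"
  obtains q where "coeff q 0 \<noteq> 0" "\<And>k. shift_act q f k = 0" "\<And>k. shift_act q g k = 0"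
proof -
  obtain q where q: "p = [:- 0, 1:] ^ order 0 p * q" "\<not> [:- 0, 1:] dvd q"
    using order_decomp[OF assms(1)] by blast
  have X: "shift_act ([:0, 1:] ^ n) h k = h (k + int n)" for n h k
    by (induction n arbitrary: k) (simp_all add: shift_act_mult shift_act_pCons add_ac one_pCons)
  have "shift_act q h k = 0" if "\<And>k. shift_act p h k = 0" for h k
  proof -
    have "shift_act q h k = shift_act p h (k - int (order 0 p))"
      by (subst q(1)) (simp add: shift_act_mult X)
    with that show ?thesis by simp
  qed
  moreover have "coeff q 0 \<noteq> 0"
    using q(2) poly_eq_0_iff_dvd[of q 0] by (simp add: poly_0_coeff_0)
  ultimately show ?thesis using that assms by blast
qed

text \<open>The coefficients \<open>b\<close> form a nonzero Laurent polynomial in the shift. Since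
  the relation holds for every integer k, it may be moved by \<open>Min J\<close>, which leaves an
  honest polynomial.\<close>

lemma recurrentI_laurent:
  assumes J: "finite J" "j0 \<in> J" "b j0 \<noteq> 0" and rec: "\<And>k. (\<Sum>j\<in>J. b j * f (k + j)) = 0"
  shows "recurrent f"
proof -
  define l where "l = Min J"
  define D where "D = nat (Max J - l)"
  define b' where "b' i = (if l + int i \<in> J then b (l + int i) else 0)" for i
  define p where "p = (\<Sum>i\<le>D. monom (b' i) i)"
  have range: "l \<le> j" "nat (j - l) \<le> D" "l + int (nat (j - l)) = j" if "j \<in> J" for j
  proof -
    show "l \<le> j" using J that by (simp add: l_def)
    moreover have "j \<le> Max J" using J that by simp
    ultimately show "nat (j - l) \<le> D" "l + int (nat (j - l)) = j" by (simp_all add: D_def)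
  qed
  have coeff: "coeff p i = (if i \<le> D then b' i else 0)" for i
    by (simp add: p_def coeff_sum)
  have "degree p \<le> D" by (rule degree_le) (simp add: coeff)
  have "shift_act p f k = 0" for k
  proof -
    have "shift_act p f k = (\<Sum>i\<le>D. b' i * f (k + int i))"
      unfolding shift_act_bound[OF \<open>degree p \<le> D\<close>] by (simp add: coeff)
    also have "\<dots> = (\<Sum>i\<in>(\<lambda>j. nat (j - l)) ` J. b' i * f (k + int i))"
    proof (rule sum.mono_neutral_right)
      show "\<forall>i\<in>{..D} - (\<lambda>j. nat (j - l)) ` J. b' i * f (k + int i) = 0"
      proof
        fix i assume i: "i \<in> {..D} - (\<lambda>j. nat (j - l)) ` J"
        have "i \<in> (\<lambda>j. nat (j - l)) ` J" if "l + int i \<in> J"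
          by (rule image_eqI[OF _ that]) simp
        with i show "b' i * f (k + int i) = 0" by (auto simp: b'_def)
      qed
    qed (use range in auto)
    also have "\<dots> = (\<Sum>j\<in>J. b j * f (k - l + j))"
    proof (subst sum.reindex)
      show "inj_on (\<lambda>j. nat (j - l)) J" using range(3) by (intro inj_onI) metis
      show "sum ((\<lambda>i. b' i * f (k + int i)) \<circ> (\<lambda>j. nat (j - l))) J = (\<Sum>j\<in>J. b j * f (k - l + j))"
        using range(1,3) by (intro sum.cong) (auto simp: b'_def algebra_simps)
    qed
    finally show ?thesis using rec by simp
  qed
  moreover have "coeff p (nat (j0 - l)) \<noteq> 0" using range[OF J(2)] J by (simp add: coeff b'_def)
  then have "p \<noteq> 0" by auto
  ultimately show ?thesis by (auto simp: recurrent_def)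
qed

subsection \<open>Exponential monomials\<close>

lemma exp_polynomial_const: "(\<lambda>k. c) \<in> exp_polynomial"
  using exp_polynomial.scale[OF exp_polynomial.exp[of 1], of c] by simp

lemma exp_polynomial_mono: "a \<noteq> 0 \<Longrightarrow> (\<lambda>k. of_int k ^ m * a powi k) \<in> exp_polynomial"
proof (induction m)
  case 0
  then show ?case using exp_polynomial.exp[of a] by simp
next
  case (Suc m)
  then show ?case
    using exp_polynomial.mult[OF exp_polynomial.var Suc.IH] by (simp add: mult.assoc)
qed

lemma exp_polynomial_sum:
  assumes "finite A" "\<And>a. a \<in> A \<Longrightarrow> f a \<in> exp_polynomial"
  shows "(\<lambda>k. \<Sum>a\<in>A. f a k) \<in> exp_polynomial"
  using assms by (induction A) (simp_all add: exp_polynomial_const exp_polynomial.add)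

text \<open>The linear span of the sequences k^m a^k, built up summand by summand. Closure under
  products is proved once, and the arguments on recurrences then only meet sums of such
  monomials.\<close>

inductive_set exp_span :: "(int \<Rightarrow> complex) set" where
  zero: "(\<lambda>k. 0) \<in> exp_span"
| mono: "f \<in> exp_span \<Longrightarrow> a \<noteq> 0 \<Longrightarrow> (\<lambda>k. c * (of_int k ^ m * a powi k) + f k) \<in> exp_span"

lemma exp_span_add: "f \<in> exp_span \<Longrightarrow> g \<in> exp_span \<Longrightarrow> (\<lambda>k. f k + g k) \<in> exp_span"
  by (induction f rule: exp_span.induct) (auto simp: add.assoc intro: exp_span.mono)

lemma exp_span_mono: "a \<noteq> 0 \<Longrightarrow> (\<lambda>k. c * (of_int k ^ m * a powi k)) \<in> exp_span"
  using exp_span.mono[OF exp_span.zero, of a c m] by simp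

lemma exp_span_mult_mono:
  assumes "f \<in> exp_span" "a \<noteq> 0"
  shows "(\<lambda>k. c * (of_int k ^ m * a powi k) * f k) \<in> exp_span"
  using assms(1)
proof (induction f rule: exp_span.induct)
  case zero
  then show ?case using exp_span.zero by simp
next
  case (mono f b d n)
  have "(\<lambda>k. c * (of_int k ^ m * a powi k) * (d * (of_int k ^ n * b powi k) + f k))
    = (\<lambda>k. (c * d) * (of_int k ^ (m + n) * (a * b) powi k) + c * (of_int k ^ m * a powi k) * f k)"
    by (simp add: fun_eq_iff algebra_simps power_add power_int_mult_distrib)
  then show ?case using exp_span.mono[OF mono.IH, of "a * b" "c * d" "m + n"] mono assms(2) by simp
qed

lemma exp_span_mult: "f \<in> exp_span \<Longrightarrow> g \<in> exp_span \<Longrightarrow> (\<lambda>k. f k * g k) \<in> exp_span"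
  by (induction f rule: exp_span.induct)
    (auto simp: distrib_right exp_span.zero intro: exp_span_add exp_span_mult_mono)

lemma exp_polynomial_span: "f \<in> exp_polynomial \<Longrightarrow> f \<in> exp_span"
proof (induction f rule: exp_polynomial.induct)
  case var
  then show ?case using exp_span_mono[of 1 1 1] by simp
next
  case (exp a)
  then show ?case using exp_span_mono[of a 1 0] by simp
next
  case (scale f c)
  then show ?case using exp_span_mult[OF exp_span_mono[of 1 c 0] scale.IH] by simp
qed (auto intro: exp_span_add exp_span_mult)

lemma power_Suc_shift:
  "(of_int (k + 1) :: complex) ^ m = of_int k ^ m + (\<Sum>i<m. of_nat (m choose i) * of_int k ^ i)"
proof -
  have "(of_int (k + 1) :: complex) ^ m = (\<Sum>i\<le>m. of_nat (m choose i) * of_int k ^ i * 1 ^ (m - i))"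
    unfolding of_int_add by (subst binomial_ring) simp
  also have "\<dots> = of_int k ^ m + (\<Sum>i<m. of_nat (m choose i) * of_int k ^ i)"
    by (simp add: lessThan_Suc_atMost[symmetric])
  finally show ?thesis .
qed

text \<open>The leading coefficient is a - c, so the operator lowers the degree in k exactly when c
  = a and keeps it otherwise; the rest is the binomial expansion of (k + 1)^m.\<close>

lemma shift_act_linear_mono:
  assumes "a \<noteq> 0"
  shows "shift_act [:- c, 1:] (\<lambda>k. of_int k ^ m * a powi k) k
    = (a - c) * (of_int k ^ m * a powi k)
      + (\<Sum>i<m. (a * of_nat (m choose i)) * (of_int k ^ i * a powi k))"
proof -
  have "shift_act [:- c, 1:] (\<lambda>k. of_int k ^ m * a powi k) k
      = of_int (k + 1) ^ m * (a * a powi k) - c * (of_int k ^ m * a powi k)"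
    using assms by (simp add: shift_act_pCons power_int_add_1' del: of_int_add)
  then show ?thesis
    unfolding power_Suc_shift by (simp add: algebra_simps sum_distrib_left)
qed

lemma mono_annihilated:
  "a \<noteq> 0 \<Longrightarrow> n < m \<Longrightarrow> shift_act ([:- a, 1:] ^ m) (\<lambda>k. of_int k ^ n * a powi k) k = 0"
proof (induction m arbitrary: n k)
  case (Suc m)
  have "shift_act ([:- a, 1:] ^ Suc m) (\<lambda>k. of_int k ^ n * a powi k) k
    = shift_act ([:- a, 1:] ^ m) (shift_act [:- a, 1:] (\<lambda>k. of_int k ^ n * a powi k)) k"
    by (simp only: power_Suc2 shift_act_mult)
  also have "\<dots> = shift_act ([:- a, 1:] ^ m)
      (\<lambda>k. \<Sum>i<n. (a * of_nat (n choose i)) * (of_int k ^ i * a powi k)) k"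
    by (simp only: shift_act_linear_mono[OF Suc.prems(1), abs_def] fun_eq_iff) simp
  also have "\<dots> = 0"
    using Suc by (simp only: shift_act_lincomb) simp
  finally show ?case .
qed simp

lemma exp_span_recurrent: "f \<in> exp_span \<Longrightarrow> recurrent f"
proof (induction f rule: exp_span.induct)
  case zero
  then show ?case unfolding recurrent_def by (intro exI[of _ 1]) (simp add: shift_act_lincomb)
next
  case (mono f a c m)
  have "recurrent (\<lambda>k. of_int k ^ m * a powi k)"
    unfolding recurrent_def using mono_annihilated[OF mono(2), of m "Suc m"]
    by (intro exI[of _ "[:- a, 1:] ^ Suc m"]) (simp del: power_Suc)
  then show ?case using mono.IH by (intro recurrent_add recurrent_scale)
qed

subsection \<open>First order recurrences\<close>

text \<open>A monomial is chosen whose image has the wanted leading term with a nonzero factor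
  \<open>e\<close>; the lower terms of the image are removed by the solutions \<open>G\<close> that
  the induction on m provides.\<close>

lemma mono_solution:
  assumes "a \<noteq> 0" "b \<noteq> 0"
  shows "\<exists>g\<in>exp_polynomial. \<forall>k. shift_act [:- a, 1:] g k = of_int k ^ m * b powi k"
proof (induction m rule: less_induct)
  case (less m)
  then obtain G where G: "\<And>i. i < m \<Longrightarrow> G i \<in> exp_polynomial"
    "\<And>i k. i < m \<Longrightarrow> shift_act [:- a, 1:] (G i) k = of_int k ^ i * b powi k" by metis
  obtain n e d where n: "e \<noteq> 0" "\<And>k. shift_act [:- a, 1:] (\<lambda>k. of_int k ^ n * b powi k) k
      = e * (of_int k ^ m * b powi k) + (\<Sum>i<m. d i * (of_int k ^ i * b powi k))"
  proof (cases "a = b")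
    \<comment> \<open>Resonance: the degree drops by one under the operator, so the ansatz has
      degree m + 1 and leading factor b (m + 1).\<close>
    case True
    show ?thesis
      by (rule that[of "b * of_nat (Suc m)" "Suc m" "\<lambda>i. b * of_nat (Suc m choose i)"])
        (use assms of_nat_neq_0[of m, where 'a = complex] in
          \<open>simp_all only: shift_act_linear_mono True sum.lessThan_Suc, simp_all\<close>)
  next
    case False
    then show ?thesis
      by (intro that[of "b - a" m "\<lambda>i. b * of_nat (m choose i)"])
        (simp_all add: shift_act_linear_mono assms)
  qed
  let ?g = "\<lambda>k. inverse e * (of_int k ^ n * b powi k) + (\<Sum>i<m. (- d i / e) * G i k)"
  have "?g \<in> exp_polynomial"
    by (intro exp_polynomial.add exp_polynomial.scale exp_polynomial_mono exp_polynomial_sum)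
      (use assms G in auto)
  moreover have "shift_act [:- a, 1:] ?g k = of_int k ^ m * b powi k" for k
  proof -
    have "shift_act [:- a, 1:] ?g k = inverse e * (e * (of_int k ^ m * b powi k)
        + (\<Sum>i<m. d i * (of_int k ^ i * b powi k))) + (\<Sum>i<m. (- d i / e) * (of_int k ^ i * b powi k))"
      unfolding shift_act_lincomb n(2) by (simp add: G(2) cong: sum.cong_simp)
    then show ?thesis
      using n(1) by (simp add: distrib_left sum_distrib_left sum_negf[symmetric] field_simps
          sum.distrib[symmetric])
  qed
  ultimately show ?case by blast
qed

lemma exp_polynomial_solution:
  assumes "h \<in> exp_polynomial" "a \<noteq> 0"
  shows "\<exists>g\<in>exp_polynomial. \<forall>k. shift_act [:- a, 1:] g k = h k"
  using exp_polynomial_span[OF assms(1)]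
proof (induction h rule: exp_span.induct)
  case zero
  show ?case by (intro bexI[of _ "\<lambda>k. 0"]) (simp_all add: shift_act_lincomb exp_polynomial_const)
next
  case (mono f b c m)
  then obtain g where g: "g \<in> exp_polynomial" "\<And>k. shift_act [:- a, 1:] g k = f k" by blast
  obtain g' where g': "g' \<in> exp_polynomial" "\<And>k. shift_act [:- a, 1:] g' k = of_int k ^ m * b powi k"
    using mono_solution[OF assms(2) mono(2)] by blast
  have "(\<lambda>k. c * g' k + g k) \<in> exp_polynomial"
    using g g' by (intro exp_polynomial.add exp_polynomial.scale)
  then show ?case
    by (rule bexI[rotated]) (simp only: shift_act_lincomb g g' simp_thms)
qed

lemma geometric_sequence:
  fixes f :: "int \<Rightarrow> complex"
  assumes "a \<noteq> 0" "\<And>k. f (k + 1) = a * f k"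
  shows "f k = f 0 * a powi k"
proof (induction k rule: int_induct[of _ 0])
  case (step1 i)
  then show ?case using assms by (simp add: power_int_add_1')
next
  case (step2 i)
  have "a * f (i - 1) = f i" using assms(2)[of "i - 1"] by simp
  then have "f (i - 1) = f i / a" using assms(1) by (simp add: field_simps)
  then show ?case using step2 assms(1) by (simp add: power_int_diff)
qed simp

lemma exp_polynomial_shift: "f \<in> exp_polynomial \<Longrightarrow> (\<lambda>k. f (k - 1)) \<in> exp_polynomial"
proof (induction f rule: exp_polynomial.induct)
  case var
  then show ?case
    using exp_polynomial.add[OF exp_polynomial.var exp_polynomial_const[of "- 1"]] by simp
next
  case (exp a)
  then show ?case
    using exp_polynomial.scale[OF exp_polynomial.exp[OF exp], of "inverse a"]
    by (simp add: power_int_diff divide_inverse mult.commute)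
qed (auto intro: exp_polynomial.intros)

text \<open>For the harder direction a root a of p is split off. Then g = (shift - a) f satisfies a
  recurrence of lower degree, an exp-polynomial h solves the same first order equation, and f - h is
  a multiple of a^k.\<close>

theorem recurrent_iff_exp_polynomial: "recurrent f \<longleftrightarrow> f \<in> exp_polynomial"
proof
  assume "f \<in> exp_polynomial"
  then show "recurrent f" by (intro exp_span_recurrent exp_polynomial_span)
next
  have "f \<in> exp_polynomial" if "p \<noteq> 0" "\<And>k. shift_act p f k = 0" for p f
    using that
  proof (induction "degree p" arbitrary: p f)
    case 0
    then obtain c where "p = [:c:]" "c \<noteq> 0" by (metis degree_eq_zeroE pCons_0_0)
    then have "f = (\<lambda>k. 0)" using 0(3) by (simp add: fun_eq_iff shift_act_pCons)
    then show ?case by (simp add: exp_polynomial_const)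
  next
    case (Suc n)
    then have "\<not> constant (poly p)" by (simp add: constant_degree)
    then obtain a where "poly p a = 0" using fundamental_theorem_of_algebra by blast
    then obtain q where q: "p = [:- a, 1:] * q" by (auto simp: poly_eq_0_iff_dvd)
    then have "q \<noteq> 0" using Suc.prems by auto
    then have "n = degree q" using Suc(2) q by (simp add: degree_mult_eq del: mult_pCons_left)
    define g where "g = shift_act [:- a, 1:] f"
    have "shift_act q g k = 0" for k
      unfolding g_def shift_act_mult[symmetric] using Suc.prems(2) q by (simp add: mult.commute)
    then have g: "g \<in> exp_polynomial" using Suc.hyps(1)[OF \<open>n = degree q\<close> \<open>q \<noteq> 0\<close>] by blast
    have g_eq: "g k = f (k + 1) - a * f k" for k by (simp add: g_def shift_act_pCons)
    show ?case
    proof (cases "a = 0")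
      \<comment> \<open>For the root 0 no geometric sequence arises: g k = f (k + 1), so f is a
        shift of g.\<close>
      case True
      then show ?thesis using exp_polynomial_shift[OF g] by (simp add: g_eq)
    next
      case False
      obtain h where h: "h \<in> exp_polynomial" "\<And>k. shift_act [:- a, 1:] h k = g k"
        using exp_polynomial_solution[OF g False] by blast
      have "f (k + 1) - h (k + 1) = a * (f k - h k)" for k
        using h(2)[of k] by (simp add: g_eq shift_act_pCons algebra_simps)
      from geometric_sequence[of a "\<lambda>k. f k - h k", OF False this]
      have "f = (\<lambda>k. h k + (f 0 - h 0) * a powi k)" by (auto simp: fun_eq_iff algebra_simps)
      then show ?thesis
        using exp_polynomial.add[OF h(1) exp_polynomial.scale[OF exp_polynomial.exp[OF False]]]
        by metis
    qed
  qed
  then show "recurrent f \<Longrightarrow> f \<in> exp_polynomial" by (auto simp: recurrent_def)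
qed

section \<open>Degree and length of normal forms\<close>

context lie_basis
begin

lemma nf_induct [case_names sorted swap]:
  assumes "\<And>w. sorted w \<Longrightarrow> Q w"
    and "\<And>u x y v. y < x \<Longrightarrow> Q (u @ y # x # v) \<Longrightarrow>
      (\<And>z. z \<in> keys (br x y) \<Longrightarrow> Q (u @ z # v)) \<Longrightarrow> Q (u @ x # y # v)"
  shows "Q w"
proof (induction w rule: wf_induct_rule[OF wf_inv_image[OF wf_lex_prod[OF wf_less_than wf_less_than],
        where f = "\<lambda>w. (length w, inversions w)"]])
  case (1 w)
  show ?case
  proof (cases "sorted w")
    case False
    then obtain u x y v where d: "w = u @ x # y # v" "y < x" by (rule nf_unsorted)
    have "Q (u @ y # x # v)" by (rule 1) (simp add: d inversions_swap)
    moreover have "Q (u @ z # v)" for z by (rule 1) (simp add: d)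
    ultimately show ?thesis unfolding d(1) using assms(2)[OF d(2)] by simp
  qed (rule assms(1))
qed

text \<open>Tool for invariants of straightening: a relation between words and monomials that passes
  from both kinds of reduct back to the word holds for every monomial of the normal form.\<close>

lemma keys_nf:
  assumes "\<And>w. sorted w \<Longrightarrow> R w (mset w)"
    and "\<And>u x y v \<mu>. y < x \<Longrightarrow> R (u @ y # x # v) \<mu> \<Longrightarrow> R (u @ x # y # v) \<mu>"
    and "\<And>u x y v z \<mu>. z \<in> keys (br x y) \<Longrightarrow> R (u @ z # v) \<mu> \<Longrightarrow> R (u @ x # y # v) \<mu>"
    and "\<mu> \<in> keys (nf w)"
  shows "R w \<mu>"
proof -
  have "keys (nf w) \<subseteq> {\<mu>. R w \<mu>}"
  proof (induction w rule: nf_induct)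
    case (sorted w)
    then show ?case using assms(1) by (simp add: nf_sorted)
  next
    case (swap u x y v)
    have "keys (lin_ext (\<lambda>z. nf (u @ z # v)) (br x y)) \<subseteq> {\<mu>. R (u @ x # y # v) \<mu>}"
      by (rule keys_lin_ext) (use swap(3) assms(3) in blast)
    moreover have "keys (nf (u @ y # x # v)) \<subseteq> {\<mu>. R (u @ x # y # v) \<mu>}"
      using swap(1,2) assms(2) by blast
    ultimately show ?case unfolding nf_swap[of u x y v] by (intro keys_add_subset)
  qed
  with assms(4) show ?thesis by blast
qed

lemma nf_over:
  assumes "\<And>x y. x \<in> S \<Longrightarrow> y \<in> S \<Longrightarrow> keys (br x y) \<subseteq> S" "set w \<subseteq> S"
    "\<mu> \<in> keys (nf w)"
  shows "set_mset \<mu> \<subseteq> S"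
proof -
  have "set w \<subseteq> S \<longrightarrow> set_mset \<mu> \<subseteq> S"
    by (rule keys_nf[where R = "\<lambda>w \<mu>. set w \<subseteq> S \<longrightarrow> set_mset \<mu> \<subseteq> S", OF _ _ _ assms(3)])
      (use assms(1) in auto)
  with assms(2) show ?thesis by blast
qed

text \<open>Brackets shorten words, so at the full length straightening merely permutes letters: the
  associated graded algebra is the symmetric algebra.\<close>

lemma nf_top:
  "length w \<le> size \<mu> \<Longrightarrow> lookup (nf w) \<mu> = (if \<mu> = mset w then 1 else 0)"
proof (induction w rule: nf_induct)
  case (sorted w)
  then show ?case by (simp add: nf_sorted lookup_single when_def)
next
  case (swap u x y v)
  have "lookup (lin_ext (\<lambda>z. nf (u @ z # v)) p) \<mu> = 0"
    if "\<And>z. z \<in> keys p \<Longrightarrow> lookup (nf (u @ z # v)) \<mu> = 0" for p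
    using that by (simp add: lin_ext_def lookup_sum)
  moreover have "lookup (nf (u @ z # v)) \<mu> = 0" if "z \<in> keys (br x y)" for z
  proof -
    have "\<mu> \<noteq> mset (u @ z # v)" using swap(4) by auto
    then show ?thesis using swap(3)[OF that] swap(4) by simp
  qed
  ultimately show ?case
    using swap(2,4) unfolding nf_swap[of u x y v] by (simp add: lookup_add add_mset_commute)
qed

lemma nf_commuting:
  "(\<And>x y. x \<in> set w \<Longrightarrow> y \<in> set w \<Longrightarrow> br x y = 0) \<Longrightarrow> nf w = single (mset w) 1"
proof (induction w rule: nf_induct)
  case (swap u x y v)
  then have "br x y = 0" by simp
  then have "nf (u @ x # y # v) = nf (u @ y # x # v)" unfolding nf_swap[of u x y v] by simp
  also have "\<dots> = single (mset (u @ y # x # v)) 1"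
    by (rule swap(2)) (use swap(4) in auto)
  finally show ?case by (simp add: add_mset_commute)
qed (rule nf_sorted)

end

lemma keys_lvb_bracket:
  "z \<in> keys (lvb_bracket x y) \<Longrightarrow> lvb_degree z = lvb_degree x + lvb_degree y"
  by (cases x; cases y) (auto split: if_splits dest!: subsetD[OF keys_add])

lemma nonneg_iff: "x \<in> lvb_nonneg \<longleftrightarrow> 0 \<le> lvb_degree x"
  by (simp add: lvb_nonneg_def)

abbreviation word_degree :: "lvb list \<Rightarrow> int" where
  "word_degree w \<equiv> sum_list (map lvb_degree w)"

abbreviation mset_degree :: "lvb multiset \<Rightarrow> int" where
  "mset_degree \<mu> \<equiv> (\<Sum>x\<in>#\<mu>. lvb_degree x)"

lemma nf_degree: "\<mu> \<in> keys (hw.nf w) \<Longrightarrow> mset_degree \<mu> = word_degree w"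
  by (rule hw.keys_nf[where R = "\<lambda>w \<mu>. mset_degree \<mu> = word_degree w"])
    (auto simp: sum_mset_sum_list[symmetric] keys_lvb_bracket)

text \<open>A bracket has at most one letter of negative degree per monomial, and none if both
  arguments have nonnegative degree, so the number of such letters never grows.\<close>

lemma nf_negative_letters:
  "\<mu> \<in> keys (hw.nf w) \<Longrightarrow>
    size (filter_mset (\<lambda>x. x \<notin> lvb_nonneg) \<mu>) \<le> length (filter (\<lambda>x. x \<notin> lvb_nonneg) w)"
  by (rule hw.keys_nf[where R = "\<lambda>w \<mu>.
      size (filter_mset (\<lambda>x. x \<notin> lvb_nonneg) \<mu>) \<le> length (filter (\<lambda>x. x \<notin> lvb_nonneg) w)"])
    (auto simp: nonneg_iff keys_lvb_bracket split: if_splits simp flip: mset_filter)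

text \<open>A letter of positive degree contributes the scalar 0, so the monomials that survive
  contain none.\<close>

lemma keys_induced_word:
  assumes "\<nu> \<in> keys (hw.induced \<phi> (word w))"
  obtains \<mu> where "\<mu> \<in> keys (hw.nf w)" "\<nu> = filter_mset (\<lambda>x. x \<notin> lvb_nonneg) \<mu>"
    "\<And>x. x \<in># \<mu> \<Longrightarrow> lvb_degree x \<le> 0"
proof -
  have "\<nu> \<in> (\<Union>\<mu>\<in>keys (hw.nf w). keys (single
      (filter_mset (\<lambda>x. x \<notin> lvb_nonneg) \<mu>)
      (\<Prod>x\<in>#filter_mset (\<lambda>x. x \<in> lvb_nonneg) \<mu>. hw_scalar \<phi> x)))"
    using assms unfolding hw.induced_def hw.normal_form_word
    by (rule rev_subsetD) (rule keys_lin_ext, blast)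
  then obtain \<mu> where \<mu>: "\<mu> \<in> keys (hw.nf w)" "\<nu> = filter_mset (\<lambda>x. x \<notin> lvb_nonneg) \<mu>"
    "(\<Prod>x\<in>#filter_mset (\<lambda>x. x \<in> lvb_nonneg) \<mu>. hw_scalar \<phi> x) \<noteq> 0"
    by (auto split: if_splits)
  have "lvb_degree x \<le> 0" if "x \<in># \<mu>" for x
  proof (rule ccontr)
    assume "\<not> lvb_degree x \<le> 0"
    then have "x \<in># filter_mset (\<lambda>x. x \<in> lvb_nonneg) \<mu>" "hw_scalar \<phi> x = 0"
      using that by (auto simp: nonneg_iff hw_scalar_def)
    then have "0 \<in># image_mset (hw_scalar \<phi>) (filter_mset (\<lambda>x. x \<in> lvb_nonneg) \<mu>)"
      by (metis image_eqI set_image_mset)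
    with \<mu>(3) show False by (simp add: prod_mset_zero_iff)
  qed
  with \<mu> that show ?thesis by blast
qed

lemma induced_word_degree:
  assumes "\<nu> \<in> keys (hw.induced \<phi> (word w))"
  shows "mset_degree \<nu> = word_degree w"
proof -
  obtain \<mu> where \<mu>: "\<mu> \<in> keys (hw.nf w)" "\<nu> = filter_mset (\<lambda>x. x \<notin> lvb_nonneg) \<mu>"
    "\<And>x. x \<in># \<mu> \<Longrightarrow> lvb_degree x \<le> 0"
    using keys_induced_word[OF assms] by blast
  have "mset_degree \<mu> = mset_degree \<nu>"
    unfolding \<mu>(2) using \<mu>(3)
  proof (induction \<mu>)
    case (add x \<mu>)
    then have "x \<in> lvb_nonneg \<Longrightarrow> lvb_degree x = 0" by (fastforce simp: nonneg_iff)
    with add show ?case by auto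
  qed simp
  then show ?thesis using nf_degree[OF \<mu>(1)] by simp
qed

lemma induced_word_size:
  assumes "length (filter (\<lambda>x. x \<notin> lvb_nonneg) w) < size \<nu>"
  shows "lookup (hw.induced \<phi> (word w)) \<nu> = 0"
proof (rule ccontr)
  assume "lookup (hw.induced \<phi> (word w)) \<nu> \<noteq> 0"
  then have "\<nu> \<in> keys (hw.induced \<phi> (word w))" by (simp add: in_keys_iff)
  then obtain \<mu> where "\<mu> \<in> keys (hw.nf w)" "\<nu> = filter_mset (\<lambda>x. x \<notin> lvb_nonneg) \<mu>"
    by (rule keys_induced_word)
  with nf_negative_letters assms show False by fastforce
qed

lemma induced_negative_word:
  assumes "set w \<inter> lvb_nonneg = {}"
  shows "hw.induced \<phi> (word w) = hw.nf w"
proof -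
  have "set_mset \<mu> \<subseteq> - lvb_nonneg" if "\<mu> \<in> keys (hw.nf w)" for \<mu>
  proof (rule hw.nf_over[OF _ _ that])
    show "keys (lvb_bracket x y) \<subseteq> - lvb_nonneg"
      if "x \<in> - lvb_nonneg" "y \<in> - lvb_nonneg" for x y
      using that keys_lvb_bracket[of _ x y] by (auto simp: nonneg_iff)
  qed (use assms in auto)
  then have "keys (hw.nf w) \<subseteq> {\<mu>. set_mset \<mu> \<inter> lvb_nonneg = {}}" by blast
  then have eq: "filter_mset (\<lambda>x. x \<notin> lvb_nonneg) \<mu> = \<mu>" "filter_mset (\<lambda>x. x \<in> lvb_nonneg) \<mu> = {#}"
    if "\<mu> \<in> keys (hw.nf w)" for \<mu>
    using that by (auto intro!: multiset_eqI simp: count_eq_zero_iff disjoint_iff subset_iff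
        dest!: eq_commute[of 0, THEN iffD1])
  have "hw.induced \<phi> (word w) = lin_ext (\<lambda>\<mu>. single \<mu> 1) (hw.nf w)"
    unfolding hw.induced_def hw.normal_form_word by (rule lin_ext_cong) (simp_all add: eq)
  also have "\<dots> = hw.nf w"
    using poly_mapping_expand[OF finite_keys subset_refl, of "hw.nf w"] by (simp add: lin_ext_def)
  finally show ?thesis .
qed

lemma induced_comm:
  "hw.induced \<phi> (p * (word (x # y # []) * q)) =
    hw.induced \<phi> (p * (word (y # x # []) * q)) + hw.induced \<phi> (p * (deg1 (lvb_bracket x y) * q))"
  using hw.induced_comm_rel[of \<phi> p x y q]
  by (simp add: hw.comm_rel_def hw.induced_linear algebra_simps word_Cons[of _ "[_]"])

subsection \<open>The vacuum coefficient\<close>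

text \<open>The Harish-Chandra projection onto degree 0 letters followed by evaluation at \<phi>,
  read off as the coefficient of v_0 in p v_0.\<close>

definition vac :: "(lvir \<Rightarrow> complex) \<Rightarrow> lv_tensor \<Rightarrow> complex" where
  "vac \<phi> p = lookup (hw.induced \<phi> p) {#}"

lemma vac_linear:
  "vac \<phi> (p + q) = vac \<phi> p + vac \<phi> q" "vac \<phi> (p - q) = vac \<phi> p - vac \<phi> q"
  "vac \<phi> (- p) = - vac \<phi> p" "vac \<phi> (scal c p) = c * vac \<phi> p" "vac \<phi> 0 = 0"
  by (simp_all add: vac_def hw.induced_linear lookup_add lookup_minus)

lemma induced_one: "hw.induced \<phi> 1 = single {#} 1"
  using induced_negative_word[of "[]" \<phi>] hw.nf_sorted[of "[]"] by (simp add: word_Nil)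

lemma vac_one [simp]: "vac \<phi> 1 = 1"
  by (simp add: vac_def induced_one)

lemma vac_word_degree: "word_degree w \<noteq> 0 \<Longrightarrow> vac \<phi> (word w) = 0"
  using induced_word_degree[of "{#}" \<phi> w] by (auto simp: vac_def in_keys_iff)

lemma vac_char: "keys p \<subseteq> words_over lvb_nonneg \<Longrightarrow>
    vac \<phi> (t * p) = char_eval (hw_scalar \<phi>) p * vac \<phi> t"
  by (simp add: vac_def hw.induced_mult_right)

lemma vac_comm_rel: "vac \<phi> (p * hw.comm_rel x y * q) = 0"
  by (simp add: vac_def hw.induced_comm_rel)

lemma bracket_UNIV: "\<forall>x\<in>UNIV. \<forall>y\<in>UNIV. keys (lvb_bracket x y) \<subseteq> UNIV"
  "keys q \<subseteq> words_over UNIV"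
  by simp_all

text \<open>All weights of the Verma module lie at or below that of v_0, so a left factor of
  negative degree ends strictly below it.\<close>

lemma vac_negative:
  assumes "x \<notin> lvb_nonneg"
  shows "vac \<phi> (word [x] * p) = 0"
  using bracket_UNIV(1) bracket_UNIV(2)[of p]
proof (induction p rule: hw.pbw_induct)
  case (sorted w)
  then obtain s y where w: "w = s @ y" "set s \<inter> lvb_nonneg = {}" "set y \<subseteq> lvb_nonneg"
    using hw.sorted_split by blast
  have "word_degree s \<le> 0"
    using w(2) by (induction s) (auto simp: nonneg_iff)
  then have "word_degree (x # s) \<noteq> 0" using assms by (simp add: nonneg_iff)
  then have "vac \<phi> (word (x # s)) = 0" by (rule vac_word_degree)
  moreover have "word [x] * word w = word (x # s) * word y"
    by (simp add: w(1) word_append word_Cons[of x s] mult.assoc)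
  ultimately show ?case using vac_char[of "word y" \<phi> "word (x # s)"] w(3) by simp
next
  case (rel u a b v)
  show ?case using vac_comm_rel[of \<phi> "word [x] * word u" a b "word v"] by (simp add: mult.assoc)
qed (simp_all add: vac_linear distrib_left scal_mult_right)

lemma induced_d0:
  "hw.induced \<phi> (p * (word [Dt 0 0] * word w)) =
    scal (\<phi> (d_t 0 0) + of_int (word_degree w)) (hw.induced \<phi> (p * word w))"
proof (induction w arbitrary: p)
  case Nil
  have "hw_scalar \<phi> (Dt 0 0) = \<phi> (d_t 0 0)" by (simp add: hw_scalar_def)
  then show ?case
    using hw.induced_mult_right[of "word [Dt 0 0]" \<phi> p] by (simp add: word_Nil nonneg_iff)
next
  case (Cons b w)
  have br: "lvb_bracket (Dt 0 0) b = scal (of_int (lvb_degree b)) (single b 1)"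
    by (cases b) auto
  have "hw.induced \<phi> (p * (word [Dt 0 0] * word (b # w)))
    = hw.induced \<phi> (p * (word [Dt 0 0, b] * word w))"
    by (simp add: mult_single plus_free_mon_def)
  also have "\<dots> = hw.induced \<phi> (p * (word [b, Dt 0 0] * word w))
      + hw.induced \<phi> (p * (deg1 (lvb_bracket (Dt 0 0) b) * word w))"
    by (rule induced_comm)
  also have "p * (word [b, Dt 0 0] * word w) = (p * word [b]) * (word [Dt 0 0] * word w)"
    unfolding word_Cons[of b "[Dt 0 0]"] by (simp only: mult.assoc)
  also have "p * (deg1 (lvb_bracket (Dt 0 0) b) * word w)
      = scal (of_int (lvb_degree b)) ((p * word [b]) * word w)"
    unfolding br deg1_linear deg1_single scal_mult_left scal_mult_right scal_eqs by (simp only: mult.assoc)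
  also have "hw.induced \<phi> ((p * word [b]) * (word [Dt 0 0] * word w))
      = scal (\<phi> (d_t 0 0) + of_int (word_degree w)) (hw.induced \<phi> (p * word [b] * word w))"
    by (rule Cons.IH)
  also have "scal (\<phi> (d_t 0 0) + of_int (word_degree w)) (hw.induced \<phi> (p * word [b] * word w))
      + hw.induced \<phi> (scal (of_int (lvb_degree b)) (p * word [b] * word w))
    = scal (\<phi> (d_t 0 0) + of_int (word_degree (b # w))) (hw.induced \<phi> (p * word [b] * word w))"
    unfolding hw.induced_linear scal_add_left[symmetric] by (simp add: add_ac)
  finally show ?case by (simp add: word_Cons[of b w] mult.assoc)
qed

section \<open>Singular vectors\<close>

lemma lookup_lin_ext:
  "lookup (lin_ext h p) b
    = (\<Sum>a\<in>keys p. lookup p a * lookup (h a) b)"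
  by (simp add: lin_ext_def lookup_sum)

lemma induced_word_mset_word:
  "hw.induced \<phi> (word u * mset_word m)
    = lin_ext (\<lambda>\<mu>. hw.induced \<phi> (word (u @ sorted_list_of_multiset \<mu>))) m"
  unfolding mset_word_def word_append
  by (subst lin_ext_comp[of "\<lambda>p. hw.induced \<phi> (word u * p)"])
    (simp_all add: distrib_left scal_mult_right hw.induced_linear)

section \<open>The action of d_1 t^k and d_0 t^k on monomials\<close>

fun lvb_exponent :: "lvb \<Rightarrow> int" where
  "lvb_exponent (Dt i j) = j"
| "lvb_exponent (Ct j) = j"

text \<open>The letter that occurs in the bracket of d_1 t^k with a letter of negative degree;
  \<open>translate\<close> plays this role for d_0 t^k. The clauses for \<open>Ct\<close> keep the
  exponent rule and injectivity free of case distinctions.\<close>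

fun raise :: "int \<Rightarrow> lvb \<Rightarrow> lvb" where
  "raise k (Dt i j) = Dt (i + 1) (j + k)"
| "raise k (Ct j) = Ct (j + k)"

fun translate :: "int \<Rightarrow> lvb \<Rightarrow> lvb" where
  "translate k (Dt i j) = Dt i (j + k)"
| "translate k (Ct j) = Ct (j + k)"

lemma lvb_exponent_simps [simp]:
  "lvb_exponent (raise k x) = lvb_exponent x + k"
  "lvb_exponent (translate k x) = lvb_exponent x + k"
  by (cases x; simp)+

lemma raise_inject [simp]: "raise k x = raise k y \<longleftrightarrow> x = y"
  and translate_inject [simp]: "translate k x = translate k y \<longleftrightarrow> x = y"
  and translate_translate: "translate k (translate j x) = translate (k + j) x"
  and lvb_degree_translate [simp]: "lvb_degree (translate k x) = lvb_degree x"
  by (cases x; cases y; simp)+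

text \<open>If all exponents lie in [-K, K], adding 2 K + 1 moves every one of them out of this
  range. A letter shifted in this way is recognisably new.\<close>

lemma separating_shift:
  assumes "finite Z"
  obtains k where "\<And>x z. x \<in> Z \<Longrightarrow> z \<in> Z \<Longrightarrow> lvb_exponent x + k \<noteq> lvb_exponent z"
proof -
  have "\<exists>K. \<forall>z\<in>Z. \<bar>lvb_exponent z\<bar> \<le> K"
    using assms by (intro exI[of _ "Max ((\<lambda>z. \<bar>lvb_exponent z\<bar>) ` Z)"]) simp
  then obtain K where K: "\<And>z. z \<in> Z \<Longrightarrow> \<bar>lvb_exponent z\<bar> \<le> K" by blast
  show ?thesis
  proof (rule that)
    fix x z assume "x \<in> Z" "z \<in> Z"
    then show "lvb_exponent x + (2 * K + 1) \<noteq> lvb_exponent z" using K[of x] K[of z] by linarith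
  qed
qed

lemma negative_letter_cases:
  assumes "x \<notin> lvb_nonneg"
  obtains i j where "x = Dt i j" "i < 0"
  using assms by (cases x) (auto simp: nonneg_iff)

text \<open>The condition on \<open>m\<close> selects -1, 0 and 1, the degrees where the central
  term of the bracket vanishes.\<close>

lemma letter_Cons:
  assumes "m ^ 3 = m"
  shows "hw.induced \<phi> (word (Dt m k # Dt i j # s)) =
    hw.induced \<phi> (word [Dt i j] * mset_word (hw.induced \<phi> (word (Dt m k # s))))
    + scal (of_int (i - m)) (hw.induced \<phi> (word (Dt (i + m) (j + k) # s)))"
proof -
  have br: "lvb_bracket (Dt m k) (Dt i j) = scal (of_int (i - m)) (single (Dt (i + m) (j + k)) 1)"
    unfolding lvb_bracket.simps using assms by (simp add: add.commute del: of_int_power of_int_diff)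
  have "hw.induced \<phi> (word (Dt m k # Dt i j # s)) = hw.induced \<phi> (1 * (word [Dt m k, Dt i j] * word s))"
    by (simp add: mult_single plus_free_mon_def)
  also have "\<dots> = hw.induced \<phi> (1 * (word [Dt i j, Dt m k] * word s))
      + hw.induced \<phi> (1 * (deg1 (lvb_bracket (Dt m k) (Dt i j)) * word s))"
    by (rule induced_comm)
  also have "1 * (deg1 (lvb_bracket (Dt m k) (Dt i j)) * word s)
      = scal (of_int (i - m)) (word (Dt (i + m) (j + k) # s))"
    unfolding br deg1_linear deg1_single scal_mult_left scal_eqs
    by (simp add: mult_single plus_free_mon_def)
  also have "1 * (word [Dt i j, Dt m k] * word s) = word [Dt i j] * word (Dt m k # s)"
    by (simp add: mult_single plus_free_mon_def)
  finally show ?thesis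
    by (simp only: hw.induced_linear hw.induced_mult_left[of \<phi> "word [Dt i j]" "word (Dt m k # s)"])
qed

lemmas d1_Cons = letter_Cons[of 1, OF power_one]

lemma hw_scalar_Dt [simp]: "hw_scalar \<phi> (Dt i j) = (if i = 0 then \<phi> (d_t 0 j) else 0)"
  by (simp add: hw_scalar_def)

lemma length_sorted_list_of_multiset [simp]: "length (sorted_list_of_multiset \<mu>) = size \<mu>"
  by (metis mset_sorted_list_of_multiset size_mset)

lemma induced_nonneg_letter:
  "x \<in> lvb_nonneg \<Longrightarrow> hw.induced \<phi> (word [x]) = single {#} (hw_scalar \<phi> x)"
  using hw.induced_mult_right[of "word [x]" \<phi> 1] by (simp add: induced_one del: single_one)

text \<open>At the largest possible size, multiplication by a negative letter is that of the
  symmetric algebra, by \<open>hw.nf_top\<close>: the coefficient is found by dividing the letter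
  out.\<close>

lemma lookup_negative_mult:
  assumes "y \<notin> lvb_nonneg" "keys m \<subseteq> {\<kappa>. set_mset \<kappa> \<inter> lvb_nonneg = {} \<and> size \<kappa> < size \<mu>}"
  shows "lookup (hw.induced \<phi> (word [y] * mset_word m)) \<mu>
    = (if y \<in># \<mu> then lookup m (\<mu> - {#y#}) else 0)"
proof (induction m rule: pm_keys_induct)
  case (single \<kappa>)
  then have "set (y # sorted_list_of_multiset \<kappa>) \<inter> lvb_nonneg = {}"
    "length (y # sorted_list_of_multiset \<kappa>) \<le> size \<mu>"
    using assms by auto
  then have "lookup (hw.induced \<phi> (word (y # sorted_list_of_multiset \<kappa>))) \<mu>
      = (if \<mu> = add_mset y \<kappa> then 1 else 0)"
    using hw.nf_top[of "y # sorted_list_of_multiset \<kappa>" \<mu>] by (simp add: induced_negative_word)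
  then show ?case
    using induced_word_mset_word[of \<phi> "[y]" "single \<kappa> 1"]
    by (auto simp: lookup_single when_def)
qed (auto simp: mset_word_linear hw.induced_linear distrib_left scal_mult_right lookup_add)

text \<open>Modulo shorter monomials, $d_1 \otimes t^k$ acts as a derivation of the symmetric algebra.\<close>

lemma d1_top:
  assumes "set s \<inter> lvb_nonneg = {}" "length s \<le> size \<mu>"
  shows "lookup (hw.induced \<phi> (word (Dt 1 k # s))) \<mu> =
    (\<Sum>y\<in>#mset s. if lvb_degree y \<le> - 2 \<and> \<mu> = add_mset (raise k y) (mset s - {#y#})
       then of_int (lvb_degree y - 1) else 0)"
  using assms
proof (induction s arbitrary: \<mu>)
  case Nil
  then show ?case by (simp add: induced_nonneg_letter nonneg_iff)
next
  case (Cons y s)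
  obtain i j where y: "y = Dt i j" "i < 0" using Cons.prems by (auto elim: negative_letter_cases)
  define F where "F z \<mu> = (if lvb_degree z \<le> - 2 \<and> \<mu> = add_mset (raise k z) (mset s - {#z#})
       then of_int (lvb_degree z - 1) else 0 :: complex)" for z \<mu>
  have first: "lookup
      (hw.induced \<phi> (word [y] * mset_word (hw.induced \<phi> (word (Dt 1 k # s))))) \<mu>
      = (if y \<in># \<mu> then (\<Sum>z\<in>#mset s. F z (\<mu> - {#y#})) else 0)"
  proof -
    have "size \<kappa> \<le> length s" if "\<kappa> \<in> keys (hw.induced \<phi> (word (Dt 1 k # s)))" for \<kappa>
    proof (rule ccontr)
      assume "\<not> size \<kappa> \<le> length s"
      then have "length s < size \<kappa>" by simp
      with length_filter_le have "length (filter (\<lambda>x. x \<notin> lvb_nonneg) s) < size \<kappa>"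
        by (rule le_less_trans)
      then have "length (filter (\<lambda>x. x \<notin> lvb_nonneg) (Dt 1 k # s)) < size \<kappa>"
        by (simp add: nonneg_iff)
      from induced_word_size[OF this] that show False by (simp add: in_keys_iff)
    qed
    then have "keys (hw.induced \<phi> (word (Dt 1 k # s)))
        \<subseteq> {\<kappa>. set_mset \<kappa> \<inter> lvb_nonneg = {} \<and> size \<kappa> < size \<mu>}"
      using hw.keys_induced[of \<phi> "word (Dt 1 k # s)"] Cons.prems(2) by fastforce
    moreover have "y \<notin> lvb_nonneg" using Cons.prems by auto
    ultimately have "lookup
        (hw.induced \<phi> (word [y] * mset_word (hw.induced \<phi> (word (Dt 1 k # s))))) \<mu>
        = (if y \<in># \<mu> then lookup (hw.induced \<phi> (word (Dt 1 k # s))) (\<mu> - {#y#}) else 0)"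
      by (intro lookup_negative_mult)
    moreover have "lookup (hw.induced \<phi> (word (Dt 1 k # s))) (\<mu> - {#y#})
        = (\<Sum>z\<in>#mset s. F z (\<mu> - {#y#}))" if "y \<in># \<mu>"
      unfolding F_def using Cons.prems that by (intro Cons.IH) (auto simp: size_Diff_singleton)
    ultimately show ?thesis by simp
  qed
  \<comment> \<open>For \<open>i = - 1\<close> the commutator is a letter of degree 0. It no longer
    counts towards the size, so nothing remains at size of \<mu>; this is why only letters of degree
    at most -2 enter the derivation.\<close>
  have second: "lookup (hw.induced \<phi> (word (Dt (i + 1) (j + k) # s))) \<mu>
      = (if i \<le> - 2 \<and> \<mu> = add_mset (raise k y) (mset s) then 1 else 0)"
  proof (cases "i \<le> - 2")
    case True
    then have "hw.induced \<phi> (word (Dt (i + 1) (j + k) # s)) = hw.nf (Dt (i + 1) (j + k) # s)"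
      using Cons.prems by (intro induced_negative_word) (auto simp: nonneg_iff)
    then show ?thesis using True Cons.prems(2) by (simp add: hw.nf_top y)
  next
    case False
    then have "i = - 1" using y by simp
    have "length s < size \<mu>" using Cons.prems(2) by simp
    with length_filter_le have "length (filter (\<lambda>x. x \<notin> lvb_nonneg) s) < size \<mu>"
      by (rule le_less_trans)
    then have "length (filter (\<lambda>x. x \<notin> lvb_nonneg) (Dt (i + 1) (j + k) # s)) < size \<mu>"
      using \<open>i = - 1\<close> by (simp add: nonneg_iff)
    then show ?thesis using False by (simp add: induced_word_size)
  qed
  have rest: "(if y \<in># \<mu> then F z (\<mu> - {#y#}) else 0) =
      (if lvb_degree z \<le> - 2 \<and> \<mu> = add_mset (raise k z) (mset (y # s) - {#z#})
       then of_int (lvb_degree z - 1) else 0)" if "z \<in># mset s" for z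
  proof -
    have "mset (y # s) - {#z#} = add_mset y (mset s - {#z#})" using that by simp
    moreover have "\<mu> = add_mset (raise k z) (add_mset y (mset s - {#z#})) \<longleftrightarrow>
        y \<in># \<mu> \<and> \<mu> - {#y#} = add_mset (raise k z) (mset s - {#z#})"
      by (auto simp: add_mset_commute[of y] dest: insert_DiffM)
    ultimately show ?thesis by (auto simp: F_def)
  qed
  have "(\<Sum>z\<in>#mset s. if lvb_degree z \<le> - 2 \<and> \<mu> = add_mset (raise k z) (mset (y # s) - {#z#})
       then of_int (lvb_degree z - 1) else 0) = (\<Sum>z\<in>#mset s. if y \<in># \<mu> then F z (\<mu> - {#y#}) else 0)"
    by (intro arg_cong[where f = sum_mset] image_mset_cong) (simp only: rest)
  also have "\<dots> = (if y \<in># \<mu> then (\<Sum>z\<in>#mset s. F z (\<mu> - {#y#})) else 0)"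
    by simp
  finally have sum: "(\<Sum>z\<in>#mset s. if lvb_degree z \<le> - 2 \<and> \<mu> = add_mset (raise k z) (mset (y # s) - {#z#})
       then of_int (lvb_degree z - 1) else 0) = (if y \<in># \<mu> then (\<Sum>z\<in>#mset s. F z (\<mu> - {#y#})) else 0)" .
  have "lookup (hw.induced \<phi> (word (Dt 1 k # y # s))) \<mu>
    = (if y \<in># \<mu> then (\<Sum>z\<in>#mset s. F z (\<mu> - {#y#})) else 0)
      + of_int (i - 1) * (if i \<le> - 2 \<and> \<mu> = add_mset (raise k y) (mset s) then 1 else 0)"
    using first second unfolding y(1) d1_Cons by (simp only: lookup_add lookup_scal)
  also have "\<dots> = (\<Sum>z\<in>#mset (y # s). if lvb_degree z \<le> - 2 \<and> \<mu> = add_mset (raise k z) (mset (y # s) - {#z#})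
       then of_int (lvb_degree z - 1) else 0)"
    using sum by (simp add: y(1))
  finally show ?case .
qed

lemma sum_mset_linear:
  assumes "F 0 = 0" "\<And>p q. F (p + q) = F p + F q"
  shows "F (\<Sum>y\<in>#M. h y) = (\<Sum>y\<in>#M. F (h y))"
  by (induction M) (simp_all add: assms)

abbreviation depth_one :: "lvb multiset \<Rightarrow> bool" where
  "depth_one \<mu> \<equiv> \<forall>x\<in>#\<mu>. lvb_degree x = - 1"

lemma depth_one_letter:
  assumes "lvb_degree x = - 1"
  shows "x = Dt (- 1) (lvb_exponent x)"
  using assms by (cases x) auto

text \<open>Any two letters d_{-1} t^i and d_{-1} t^j commute, the factor k - i of the bracket being
  0. Straightening then produces no lower terms.\<close>

lemma induced_depth_one:
  assumes "depth_one (mset w)"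
  shows "hw.induced \<phi> (word w) = single (mset w) 1"
proof -
  have "lvb_bracket x y = 0" if "x \<in> set w" "y \<in> set w" for x y
  proof -
    have "x = Dt (- 1) (lvb_exponent x)" "y = Dt (- 1) (lvb_exponent y)"
      using assms that by (simp_all add: depth_one_letter)
    then show ?thesis using lvb_bracket.simps(1)[of "- 1" "lvb_exponent x" "- 1" "lvb_exponent y"] by simp
  qed
  then have "hw.nf w = single (mset w) 1" by (rule hw.nf_commuting)
  moreover have "set w \<inter> lvb_nonneg = {}" using assms by (force simp: nonneg_iff)
  ultimately show ?thesis by (simp add: induced_negative_word)
qed

lemma depth_one_mult:
  assumes "lvb_degree y = - 1" "depth_one \<kappa>"
  shows "hw.induced \<phi> (word [y] * mset_word (single \<kappa> c)) = single (add_mset y \<kappa>) c"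
  using induced_depth_one[of "y # sorted_list_of_multiset \<kappa>" \<phi>] assms
  by (simp add: induced_word_mset_word)

lemma negative_mult_linear:
  "hw.induced \<phi> (word [y] * mset_word (p + q))
    = hw.induced \<phi> (word [y] * mset_word p) + hw.induced \<phi> (word [y] * mset_word q)"
  "hw.induced \<phi> (word [y] * mset_word (scal c p)) = scal c (hw.induced \<phi> (word [y] * mset_word p))"
  "hw.induced \<phi> (word [y] * mset_word 0) = 0"
  by (simp_all add: mset_word_linear distrib_left scal_mult_right hw.induced_linear)

text \<open>Moving d_0 t^k to the right replaces one letter d_{-1} t^j by - d_{-1} t^(j+k) at a
  time; when it reaches v_0 it acts as a scalar.\<close>

lemma d0_depth_one:
  assumes "depth_one (mset s)"
  shows "hw.induced \<phi> (word (Dt 0 k # s)) = single (mset s) (\<phi> (d_t 0 k))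
    - (\<Sum>y\<in>#mset s. single (add_mset (translate k y) (mset s - {#y#})) 1)"
  using assms
proof (induction s)
  case Nil
  then show ?case by (simp add: induced_nonneg_letter nonneg_iff)
next
  case (Cons y s)
  let ?L = "\<lambda>m. hw.induced \<phi> (word [y] * mset_word m)"
  have y: "y = Dt (- 1) (lvb_exponent y)" "lvb_degree y = - 1"
    using Cons.prems depth_one_letter[of y] by auto
  have s: "depth_one (mset s)" using Cons.prems by simp
  have diff: "?L (p - q) = ?L p - ?L q" for p q
    by (simp add: mset_word_linear right_diff_distrib hw.induced_linear)
  have "?L (\<Sum>z\<in>#mset s. single (add_mset (translate k z) (mset s - {#z#})) 1)
      = (\<Sum>z\<in>#mset s. ?L (single (add_mset (translate k z) (mset s - {#z#})) 1))"
    by (rule sum_mset_linear) (simp_all add: negative_mult_linear)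
  also have "\<dots> = (\<Sum>z\<in>#mset s. single (add_mset (translate k z) (mset (y # s) - {#z#})) 1)"
  proof (intro arg_cong[where f = sum_mset] image_mset_cong)
    fix z assume z: "z \<in># mset s"
    then have "depth_one (add_mset (translate k z) (mset s - {#z#}))"
      using s by (auto dest: in_diffD)
    moreover have "mset (y # s) - {#z#} = add_mset y (mset s - {#z#})" using z by simp
    ultimately show "?L (single (add_mset (translate k z) (mset s - {#z#})) 1)
        = single (add_mset (translate k z) (mset (y # s) - {#z#})) 1"
      using y(2) by (simp add: depth_one_mult add_mset_commute)
  qed
  finally have sum: "?L (\<Sum>z\<in>#mset s. single (add_mset (translate k z) (mset s - {#z#})) 1)
      = (\<Sum>z\<in>#mset s. single (add_mset (translate k z) (mset (y # s) - {#z#})) 1)" .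
  have "hw.induced \<phi> (word (translate k y # s)) = single (add_mset (translate k y) (mset s)) 1"
    using induced_depth_one[of "translate k y # s" \<phi>] Cons.prems by simp
  moreover have "translate k y = Dt (- 1) (lvb_exponent y + k)" by (subst y(1)) simp
  ultimately have "hw.induced \<phi> (word (Dt 0 k # y # s)) = ?L (hw.induced \<phi> (word (Dt 0 k # s)))
      + scal (- 1) (single (add_mset (translate k y) (mset s)) 1)"
    using letter_Cons[of 0 \<phi> k "- 1" "lvb_exponent y" s] y(1) by simp
  also have "\<dots> = single (add_mset y (mset s)) (\<phi> (d_t 0 k))
      - (\<Sum>z\<in>#mset s. single (add_mset (translate k z) (mset (y # s) - {#z#})) 1)
      - single (add_mset (translate k y) (mset s)) 1"
    unfolding Cons.IH[OF s] diff sum using depth_one_mult[OF y(2) s]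
    by (simp add: single_uminus)
  finally show ?case by (simp add: diff_diff_eq add.commute)
qed

text \<open>A pair (\<kappa>, x) encodes the whole family, over k, of monomials consisting of
  \<kappa> and x with its exponent raised by k. So one element that does not depend on k records all
  terms in which the action has created a letter.\<close>

definition new_letter :: "int \<Rightarrow> (lvb multiset \<times> lvb \<Rightarrow>\<^sub>0 complex) \<Rightarrow> (lvb multiset \<Rightarrow>\<^sub>0 complex)" where
  "new_letter k = lin_ext (\<lambda>(\<kappa>, x). single (add_mset (translate k x) \<kappa>) 1)"

lemma new_letter_linear:
  "new_letter k (p + q) = new_letter k p + new_letter k q"
  "new_letter k (scal c p) = scal c (new_letter k p)" "new_letter k 0 = 0"
  "new_letter k (sum h A) = (\<Sum>a\<in>A. new_letter k (h a))"
  by (simp_all add: new_letter_def lin_ext_linear lin_ext_sum)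

lemma new_letter_single [simp]:
  "new_letter k (single (\<kappa>, x) c) = single (add_mset (translate k x) \<kappa>) c"
  by (simp add: new_letter_def)

lemma keys_sum_mset:
  fixes h :: "'a \<Rightarrow> 'b \<Rightarrow>\<^sub>0 complex"
  assumes "\<And>y. y \<in># M \<Longrightarrow> keys (h y) \<subseteq> S"
  shows "keys (\<Sum>y\<in>#M. h y) \<subseteq> S"
  using assms by (induction M) (simp_all add: keys_add_subset)

text \<open>Commuting d_1 t^k with d_{-1} t^j gives -2 d_0 t^(k+j). This either reaches v_0, which
  produces the values of \<phi>, or translates one of the remaining letters, which produces
  \<open>Q\<close>. That \<open>Q\<close> is the same for all k is the point.\<close>

lemma d1_depth_one:
  assumes "depth_one (mset s)"
  shows "\<exists>Q. keys Q \<subseteq> {(\<kappa>, x). depth_one \<kappa> \<and> lvb_degree x = - 1 \<and> size \<kappa> + 2 = length s} \<and>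
    (\<forall>k. hw.induced \<phi> (word (Dt 1 k # s)) =
      (\<Sum>y\<in>#mset s. single (mset s - {#y#}) (- 2 * \<phi> (d_t 0 (k + lvb_exponent y)))) + new_letter k Q)"
  using assms
proof (induction s)
  case Nil
  show ?case
    by (intro exI[of _ 0]) (simp add: induced_nonneg_letter nonneg_iff new_letter_linear)
next
  case (Cons y s)
  let ?L = "\<lambda>m. hw.induced \<phi> (word [y] * mset_word m)"
  let ?f = "\<lambda>k y. - 2 * \<phi> (d_t 0 (k + lvb_exponent y))"
  have y: "y = Dt (- 1) (lvb_exponent y)" "lvb_degree y = - 1"
    using Cons.prems depth_one_letter[of y] by auto
  have s: "depth_one (mset s)" using Cons.prems by simp
  obtain Q where Q: "keys Q \<subseteq> {(\<kappa>, x). depth_one \<kappa> \<and> lvb_degree x = - 1 \<and> size \<kappa> + 2 = length s}"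
    "\<And>k. hw.induced \<phi> (word (Dt 1 k # s)) =
      (\<Sum>y\<in>#mset s. single (mset s - {#y#}) (?f k y)) + new_letter k Q"
    using Cons.IH[OF s] by blast
  define Q1 where "Q1 = lin_ext (\<lambda>(\<kappa>, x). single (add_mset y \<kappa>, x) 1) Q"
  \<comment> \<open>The coefficient 2 is (-2) (-1): the factor of d_0 t^k in the commutator times
    the one by which d_0 t^k moves a letter d_{-1} t^j.\<close>
  define Q2 where "Q2 = (\<Sum>z\<in>#mset s. single (mset s - {#z#}, translate (lvb_exponent y) z) (2 :: complex))"
  let ?S = "{(\<kappa>, x). depth_one \<kappa> \<and> lvb_degree x = - 1 \<and> size \<kappa> + 2 = length (y # s)}"
  have "keys Q1 \<subseteq> ?S"
    unfolding Q1_def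
  proof (rule keys_lin_ext)
    fix a assume "a \<in> keys Q"
    then have "a \<in> {(\<kappa>, x). depth_one \<kappa> \<and> lvb_degree x = - 1 \<and> size \<kappa> + 2 = length s}"
      using Q(1) by (rule rev_subsetD)
    then show "keys (case a of (\<kappa>, x) \<Rightarrow> single (add_mset y \<kappa>, x) 1) \<subseteq> ?S"
      using y(2) by (cases a) simp
  qed
  moreover have "keys Q2 \<subseteq> ?S"
  proof -
    have "depth_one (mset s - {#z#})" "size (mset s - {#z#}) + 2 = length (y # s)" if "z \<in># mset s" for z
    proof -
      show "depth_one (mset s - {#z#})" using s by (auto dest: in_diffD)
      have "size (mset s) = Suc (size (mset s - {#z#}))" using that by (metis insert_DiffM size_add_mset)
      then show "size (mset s - {#z#}) + 2 = length (y # s)" by simp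
    qed
    then show ?thesis unfolding Q2_def using s by (intro keys_sum_mset) auto
  qed
  ultimately have "keys (Q1 + Q2) \<subseteq> ?S" by (rule keys_add_subset)
  moreover have "hw.induced \<phi> (word (Dt 1 k # y # s)) =
      (\<Sum>z\<in>#mset (y # s). single (mset (y # s) - {#z#}) (?f k z)) + new_letter k (Q1 + Q2)" for k
  proof -
    have L1: "?L (\<Sum>z\<in>#mset s. single (mset s - {#z#}) (?f k z))
        = (\<Sum>z\<in>#mset s. single (mset (y # s) - {#z#}) (?f k z))"
    proof -
      have "?L (\<Sum>z\<in>#mset s. single (mset s - {#z#}) (?f k z))
          = (\<Sum>z\<in>#mset s. ?L (single (mset s - {#z#}) (?f k z)))"
        by (rule sum_mset_linear) (simp_all add: negative_mult_linear)
      also have "\<dots> = (\<Sum>z\<in>#mset s. single (mset (y # s) - {#z#}) (?f k z))"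
      proof (intro arg_cong[where f = sum_mset] image_mset_cong)
        fix z assume z: "z \<in># mset s"
        have "depth_one (mset s - {#z#})" using s by (auto dest: in_diffD)
        moreover have "mset (y # s) - {#z#} = add_mset y (mset s - {#z#})" using z by simp
        ultimately show "?L (single (mset s - {#z#}) (?f k z))
            = single (mset (y # s) - {#z#}) (?f k z)"
          using y(2) by (simp only: depth_one_mult)
      qed
      finally show ?thesis .
    qed
    have L2: "?L (new_letter k Q) = new_letter k Q1"
      unfolding Q1_def
    proof (induction Q rule: pm_keys_induct)
      case (single a)
      then obtain \<kappa> x where a: "a = (\<kappa>, x)" "depth_one \<kappa>" "lvb_degree x = - 1" using Q(1) by auto
      then have "depth_one (add_mset (translate k x) \<kappa>)" by simp
      from depth_one_mult[OF y(2) this] show ?case by (simp add: a add_mset_commute)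
    qed (simp_all add: new_letter_linear negative_mult_linear lin_ext_linear)
    have Q2: "new_letter k Q2
        = scal 2 (\<Sum>z\<in>#mset s. single (add_mset (translate (lvb_exponent y + k) z) (mset s - {#z#})) 1)"
      unfolding Q2_def
      by (subst sum_mset_linear[of "new_letter k"], simp_all add: new_letter_linear translate_translate)
        (subst sum_mset_linear[of "scal 2"], simp_all add: scal_add add.commute)
    have "hw.induced \<phi> (word (Dt 1 k # y # s)) = ?L (hw.induced \<phi> (word (Dt 1 k # s)))
        + scal (- 2) (hw.induced \<phi> (word (Dt 0 (lvb_exponent y + k) # s)))"
      using d1_Cons[of \<phi> k "- 1" "lvb_exponent y" s] y(1) by simp
    also have "\<dots> = (\<Sum>z\<in>#mset s. single (mset (y # s) - {#z#}) (?f k z)) + new_letter k Q1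
        + (single (mset s) (?f k y) + new_letter k Q2)"
      unfolding Q(2) negative_mult_linear(1) L1 L2 d0_depth_one[OF s] Q2 scal_diff
      by (simp add: scal_minus_left add.commute[of k])
    finally show ?thesis by (simp add: new_letter_linear add_ac)
  qed
  ultimately show ?case by blast
qed

lemma sum_mset_count:
  fixes f :: "'a \<Rightarrow> complex"
  assumes "finite Y" "set_mset M \<subseteq> Y"
  shows "(\<Sum>y\<in>#M. f y) = (\<Sum>y\<in>Y. of_nat (count M y) * f y)"
  using assms(2)
proof (induction M)
  case (add x M)
  have "(\<Sum>y\<in>Y. of_nat (count (add_mset x M) y) * f y)
      = (\<Sum>y\<in>Y. of_nat (count M y) * f y + (if x = y then f y else 0))"
    by (intro sum.cong) (auto simp: distrib_right)
  also have "\<dots> = (\<Sum>y\<in>Y. of_nat (count M y) * f y) + f x"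
    using add.prems assms(1) by (simp add: sum.distrib)
  finally show ?case using add by simp
qed simp

lemma lookup_sum_mset: "lookup (\<Sum>y\<in>#M. h y) b = (\<Sum>y\<in>#M. lookup (h y) b)"
  by (rule sum_mset_linear[of "\<lambda>p. lookup p b"]) (simp_all add: lookup_add)

text \<open>The only vectors killed by all $d_1 \otimes t^k$ are the multiples of the highest weight
  vector, unless $k \mapsto \varphi(d_0 \otimes t^k)$ satisfies a recurrence. If a letter occurs with a
  large exponent in a monomial of the image, it has been created by the commutation with
  $d_1 \otimes t^k$; this determines the monomial it comes from.\<close>

theorem singular_recurrent:
  assumes v: "keys v \<subseteq> {\<mu>. set_mset \<mu> \<inter> lvb_nonneg = {}}"
    and \<mu>1: "\<mu>1 \<in> keys v" "\<mu>1 \<noteq> {#}"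
    and killed: "\<And>k. hw.induced \<phi> (word [Dt 1 k] * mset_word v) = 0"
  shows "recurrent (\<lambda>k. \<phi> (d_t 0 k))"
proof -
  let ?K = "keys v"
  let ?v = "lookup v"
  define A where "A \<mu> k = hw.induced \<phi> (word (Dt 1 k # sorted_list_of_multiset \<mu>))" for \<mu> k
  have A: "(\<Sum>\<mu>\<in>?K. ?v \<mu> * lookup (A \<mu> k) \<nu>) = 0" for k \<nu>
    using arg_cong[OF killed[of k], of "\<lambda>p. lookup p \<nu>"]
    by (simp add: induced_word_mset_word lookup_lin_ext A_def)
  have A_top: "lookup (A \<mu> k) \<nu> =
      (\<Sum>y\<in>#\<mu>. if lvb_degree y \<le> - 2 \<and> \<nu> = add_mset (raise k y) (\<mu> - {#y#})
        then of_int (lvb_degree y - 1) else 0)" if "\<mu> \<in> ?K" "size \<mu> \<le> size \<nu>" for \<mu> \<nu> k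
    using d1_top[of "sorted_list_of_multiset \<mu>" \<nu> \<phi> k] that v by (auto simp: A_def)
  \<comment> \<open>\<open>r\<close> is the length of the longest monomials of \<open>v\<close>.
    Coefficients are compared at length r to show that those monomials have depth one, then at
    length r - 1 to obtain the recurrence.\<close>
  define r where "r = Max (size ` ?K)"
  have size_le: "size \<mu> \<le> r" if "\<mu> \<in> ?K" for \<mu> using that by (simp add: r_def)
  have "r \<in> size ` ?K" unfolding r_def by (rule Max_in) (use \<mu>1 in auto)
  then obtain \<mu>0 where \<mu>0: "\<mu>0 \<in> ?K" "size \<mu>0 = r" by auto
  have "0 < r" using size_le[OF \<mu>1(1)] \<mu>1(2) by (simp add: nonempty_has_size)
  define S where "S = {\<mu> \<in> ?K. size \<mu> = r}"
  define Y where "Y = (\<Union>\<mu>\<in>?K. set_mset \<mu>)"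
  have "finite Y" by (simp add: Y_def)
  have negative: "lvb_degree y < 0" "y \<notin> lvb_nonneg" if "\<mu> \<in> ?K" "y \<in># \<mu>" for \<mu> y
    using v that by (auto simp: nonneg_iff disjoint_iff subset_iff not_le)

  \<comment> \<open>If a longest monomial has a letter x of degree at most -2, raise x with a
    separating k. The new letter occurs in no monomial of \<open>v\<close>, so the resulting \<nu>
    comes from this monomial and this letter alone, and its coefficient cannot cancel.\<close>
  have depth_one: "depth_one \<mu>" if "\<mu> \<in> S" for \<mu>
  proof (rule ccontr)
    assume "\<not> depth_one \<mu>"
    moreover have \<mu>: "\<mu> \<in> ?K" "size \<mu> = r" using that by (auto simp: S_def)
    ultimately obtain x where x: "x \<in># \<mu>" "lvb_degree x \<noteq> - 1" by blast
    then have deg: "lvb_degree x \<le> - 2" using negative[OF \<mu>(1) x(1)] by simp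
    obtain k where k: "\<And>x z. x \<in> Y \<Longrightarrow> z \<in> Y \<Longrightarrow> lvb_exponent x + k \<noteq> lvb_exponent z"
      using separating_shift[OF \<open>finite Y\<close>] by blast
    define \<nu> where "\<nu> = add_mset (raise k x) (\<mu> - {#x#})"
    have "size \<nu> = r" using x \<mu> unfolding \<nu>_def by (metis insert_DiffM size_add_mset)
    have new: "raise k x \<notin># \<mu>'" if "\<mu>' \<in> ?K" for \<mu>'
    proof
      assume "raise k x \<in># \<mu>'"
      then have "raise k x \<in> Y" "x \<in> Y" using that x \<mu> by (auto simp: Y_def)
      from k[OF this(2,1)] show False by simp
    qed
    have "lookup (A \<mu>' k) \<nu> = (if \<mu>' = \<mu> then of_nat (count \<mu> x) * of_int (lvb_degree x - 1) else 0)"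
      if \<mu>': "\<mu>' \<in> ?K" for \<mu>'
    proof -
      have "\<nu> = add_mset (raise k y) (\<mu>' - {#y#}) \<longleftrightarrow> y = x \<and> \<mu>' = \<mu>" if "y \<in># \<mu>'" for y
      proof
        assume eq: "\<nu> = add_mset (raise k y) (\<mu>' - {#y#})"
        then have "raise k x \<in># add_mset (raise k y) (\<mu>' - {#y#})"
          unfolding \<nu>_def by (metis union_single_eq_member)
        then have "y = x" using new[OF \<mu>'] by (auto dest: in_diffD)
        then have "\<mu> - {#x#} = \<mu>' - {#x#}" "x \<in># \<mu>'" using eq that by (auto simp: \<nu>_def)
        then show "y = x \<and> \<mu>' = \<mu>" using x(1) \<open>y = x\<close> by (metis insert_DiffM)
      qed (simp add: \<nu>_def)
      then have "lookup (A \<mu>' k) \<nu>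
          = (\<Sum>y\<in>#\<mu>'. if y = x \<and> \<mu>' = \<mu> then of_int (lvb_degree x - 1) else 0)"
        using A_top[OF \<mu>', of \<nu> k] size_le[OF \<mu>'] \<open>size \<nu> = r\<close> deg
        by (auto intro!: arg_cong[where f = sum_mset] image_mset_cong)
      also have "\<dots> = (if \<mu>' = \<mu> then of_nat (count \<mu> x) * of_int (lvb_degree x - 1) else 0)"
        using x(1) by (subst sum_mset_count[of "set_mset \<mu>'"])
          (auto simp: if_distrib[of "\<lambda>z. of_nat _ * z"] cong: if_cong)
      finally show ?thesis .
    qed
    then have "(\<Sum>\<mu>'\<in>?K. ?v \<mu>' * lookup (A \<mu>' k) \<nu>)
        = ?v \<mu> * (of_nat (count \<mu> x) * of_int (lvb_degree x - 1))"
      using \<mu>(1) by (simp add: if_distrib[of "\<lambda>z. _ * z"] cong: if_cong)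
    moreover have "?v \<mu> \<noteq> 0" using \<mu>(1) by (simp add: in_keys_iff)
    moreover have "of_int (lvb_degree x - 1) \<noteq> (0 :: complex)"
      unfolding of_int_eq_0_iff using deg by simp
    ultimately show False using A[of k \<nu>] x(1) by (simp add: count_eq_zero_iff)
  qed

  let ?f = "\<lambda>k y. - 2 * \<phi> (d_t 0 (k + lvb_exponent y))"
  \<comment> \<open>The part in which a letter of a longest monomial is contracted to a value of
    \<phi>.\<close>
  define F where "F \<mu> k \<nu> = (if size \<mu> = r then \<Sum>y\<in>#\<mu>. if \<mu> - {#y#} = \<nu> then ?f k y else 0 else 0)"
    for \<mu> k \<nu>
  let ?R = "{(\<kappa>, x :: lvb). size \<kappa> + 2 = r}"
  \<comment> \<open>At length r - 1, longest monomials contribute contractions and translated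
    letters, those of length r - 1 contribute raised letters, and shorter ones nothing. Apart from
    \<open>F\<close>, all dependence on k sits in the exponent of one letter.\<close>
  have "\<exists>Q. keys Q \<subseteq> ?R \<and> (\<forall>k \<nu>. size \<nu> + 1 = r \<longrightarrow>
      lookup (A \<mu> k) \<nu> = F \<mu> k \<nu> + lookup (new_letter k Q) \<nu>)"
    if \<mu>: "\<mu> \<in> ?K" for \<mu>
  proof -
    consider "size \<mu> = r" | "size \<mu> + 1 = r" | "size \<mu> + 2 \<le> r" using size_le[OF \<mu>] by linarith
    then show ?thesis
    proof cases
      case 1
      then have "depth_one (mset (sorted_list_of_multiset \<mu>))" using depth_one[of \<mu>] \<mu> by (simp add: S_def)
      from d1_depth_one[OF this, of \<phi>] obtain Q where Q:
        "keys Q \<subseteq> {(\<kappa>, x). depth_one \<kappa> \<and> lvb_degree x = - 1 \<and> size \<kappa> + 2 = r}"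
        "\<And>k. A \<mu> k = (\<Sum>y\<in>#\<mu>. single (\<mu> - {#y#}) (?f k y)) + new_letter k Q"
        using 1 by (auto simp: A_def)
      have "keys Q \<subseteq> ?R" using Q(1) by auto
      moreover have "lookup (A \<mu> k) \<nu> = F \<mu> k \<nu> + lookup (new_letter k Q) \<nu>" for k \<nu>
        unfolding Q(2) by (simp add: lookup_add lookup_sum_mset F_def 1 lookup_single when_def cong: if_cong)
      ultimately show ?thesis by blast
    next
      case 2
      \<comment> \<open>\<open>raise 0\<close> changes the degree only; the shift by k is left to
        \<open>new_letter\<close>, so \<open>Q\<close> is independent of k.\<close>
      define Q where "Q = (\<Sum>y\<in>#\<mu>. if lvb_degree y \<le> - 2
        then single (\<mu> - {#y#}, raise 0 y) (of_int (lvb_degree y - 1)) else (0 :: _ \<Rightarrow>\<^sub>0 complex))"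
      have "size (\<mu> - {#y#}) + 2 = r" if "y \<in># \<mu>" for y
        using that 2 by (metis Suc_1 add_Suc_right add_Suc_shift insert_DiffM plus_1_eq_Suc add.commute size_add_mset)
      then have "keys Q \<subseteq> ?R"
        unfolding Q_def by (intro keys_sum_mset) auto
      moreover have "translate k (raise 0 y) = raise k y" for k y by (cases y) simp_all
      then have "lookup (A \<mu> k) \<nu> = F \<mu> k \<nu> + lookup (new_letter k Q) \<nu>"
        if "size \<nu> + 1 = r" for k \<nu>
        using A_top[OF \<mu>, of \<nu> k] that 2 unfolding Q_def
        by (subst sum_mset_linear[of "new_letter k"])
          (auto simp: new_letter_linear lookup_sum_mset F_def lookup_single when_def
            intro!: arg_cong[where f = sum_mset] image_mset_cong)
      ultimately show ?thesis by blast
    next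
      case 3
      have "lookup (A \<mu> k) \<nu> = F \<mu> k \<nu> + lookup (new_letter k 0) \<nu>"
        if "size \<nu> + 1 = r" for k \<nu>
      proof -
        have "\<nu> \<noteq> add_mset (raise k y) (\<mu> - {#y#})" if "y \<in># \<mu>" for y
          using \<open>size \<nu> + 1 = r\<close> 3 that
          by (metis One_nat_def Suc_1 add_Suc_right add_le_cancel_right insert_DiffM nat_add_left_cancel_le
              not_less_eq_eq order_refl plus_1_eq_Suc size_add_mset add.right_neutral)
        then have "(\<Sum>y\<in>#\<mu>. if lvb_degree y \<le> - 2 \<and> \<nu> = add_mset (raise k y) (\<mu> - {#y#})
            then of_int (lvb_degree y - 1) else 0) = (\<Sum>y\<in>#\<mu>. 0 :: complex)"
          by (intro arg_cong[where f = sum_mset] image_mset_cong) simp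
        then have "lookup (A \<mu> k) \<nu> = 0"
          using A_top[OF \<mu>, of \<nu> k] that 3 by simp
        then show ?thesis using 3 by (simp add: F_def new_letter_linear)
      qed
      then show ?thesis by (intro exI[of _ 0]) simp
    qed
  qed
  then obtain Qf where Qf: "\<And>\<mu>. \<mu> \<in> ?K \<Longrightarrow> keys (Qf \<mu>) \<subseteq> ?R"
    "\<And>\<mu> k \<nu>. \<mu> \<in> ?K \<Longrightarrow> size \<nu> + 1 = r \<Longrightarrow>
      lookup (A \<mu> k) \<nu> = F \<mu> k \<nu> + lookup (new_letter k (Qf \<mu>)) \<nu>"
    by metis
  define Q where "Q = (\<Sum>\<mu>\<in>?K. scal (?v \<mu>) (Qf \<mu>))"
  have keys_Q: "keys Q \<subseteq> ?R"
  proof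
    fix a assume "a \<in> keys Q"
    then obtain \<mu> where "\<mu> \<in> ?K" "a \<in> keys (scal (?v \<mu>) (Qf \<mu>))"
      unfolding Q_def using keys_sum by fast
    then show "a \<in> ?R" using Qf(1) keys_scal by fast
  qed
  have FQ: "(\<Sum>\<mu>\<in>?K. ?v \<mu> * F \<mu> k \<nu>) + lookup (new_letter k Q) \<nu> = 0"
    if "size \<nu> + 1 = r" for k \<nu>
    using A[of k \<nu>] Qf(2) that
    by (simp add: Q_def new_letter_linear lookup_sum distrib_left sum.distrib cong: sum.cong)

  \<comment> \<open>With a separating k the created letter is met in no monomial of \<open>v\<close>
    and in no other place of \<open>Q\<close>. The coefficient at \<nu> is then a single coefficient
    of \<open>Q\<close>, and \<open>F\<close> vanishes there.\<close>
  have "Q = 0"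
  proof (rule ccontr)
    assume "Q \<noteq> 0"
    then have "keys Q \<noteq> {}" by simp
    then obtain \<kappa> x where \<kappa>x: "(\<kappa>, x) \<in> keys Q" by (metis ex_in_conv surj_pair)
    define Z where "Z = Y \<union> (\<Union>(\<kappa>, x)\<in>keys Q. insert x (set_mset \<kappa>))"
    have "finite Z" using \<open>finite Y\<close> by (auto simp: Z_def)
    then obtain k where k: "\<And>x z. x \<in> Z \<Longrightarrow> z \<in> Z \<Longrightarrow> lvb_exponent x + k \<noteq> lvb_exponent z"
      using separating_shift by blast
    have "x \<in> Z" using \<kappa>x by (auto simp: Z_def)
    then have new: "translate k x \<notin> Z" using k[of x "translate k x"] by auto
    define \<nu> where "\<nu> = add_mset (translate k x) \<kappa>"
    have "size \<nu> + 1 = r" using \<kappa>x keys_Q by (auto simp: \<nu>_def)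
    have "F \<mu> k \<nu> = 0" if "\<mu> \<in> ?K" for \<mu>
    proof -
      have "translate k x \<notin># \<mu>" using new that by (auto simp: Z_def Y_def)
      then have "\<mu> - {#y#} \<noteq> \<nu>" for y unfolding \<nu>_def by (metis in_diffD union_single_eq_member)
      then show ?thesis by (simp add: F_def)
    qed
    moreover have "lookup (new_letter k Q) \<nu> = lookup Q (\<kappa>, x)"
    proof -
      have "lookup (new_letter k Q) \<nu>
          = (\<Sum>a\<in>keys Q. if a = (\<kappa>, x) then lookup Q a else 0)"
        unfolding new_letter_def lookup_lin_ext
      proof (rule sum.cong[OF refl])
        fix a assume a: "a \<in> keys Q"
        obtain \<kappa>' x' where a': "a = (\<kappa>', x')" by fastforce
        have "translate k x \<notin># \<kappa>'" using new a a' by (auto simp: Z_def)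
        then have "add_mset (translate k x') \<kappa>' = \<nu> \<longleftrightarrow> a = (\<kappa>, x)"
          unfolding \<nu>_def a' by (metis add_mset_remove_trivial insert_noteq_member prod.inject translate_inject)
        then show "lookup Q a * lookup
            (case a of (\<kappa>, x) \<Rightarrow> single (add_mset (translate k x) \<kappa>) 1) \<nu>
          = (if a = (\<kappa>, x) then lookup Q a else 0)"
          by (simp add: a' lookup_single when_def)
      qed
      then show ?thesis using \<kappa>x by simp
    qed
    ultimately have "lookup Q (\<kappa>, x) = 0" using FQ[OF \<open>size \<nu> + 1 = r\<close>, of k] by simp
    then show False using \<kappa>x by (simp add: in_keys_iff)
  qed

  obtain y0 where y0: "y0 \<in># \<mu>0" using \<mu>0 \<open>0 < r\<close> by (metis multiset_nonemptyE nonempty_has_size)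
  \<comment> \<open>Removing one letter from a longest monomial singles out an equation in which
    that monomial certainly takes part.\<close>
  define \<nu> where "\<nu> = \<mu>0 - {#y0#}"
  have \<nu>: "add_mset y0 \<nu> = \<mu>0" using y0 by (simp add: \<nu>_def)
  then have "size \<nu> + 1 = r" using \<mu>0(2) by auto
  define Y' where "Y' = (\<Union>\<mu>\<in>S. set_mset \<mu>)"
  have Y': "finite Y'" "\<And>y. y \<in> Y' \<Longrightarrow> y = Dt (- 1) (lvb_exponent y)"
    using depth_one depth_one_letter by (auto simp: Y'_def S_def)
  have y0': "y0 \<in> Y'" using y0 \<mu>0 by (auto simp: Y'_def S_def)
  have inj: "inj_on lvb_exponent Y'" using Y'(2) by (intro inj_onI) metis
  \<comment> \<open>\<open>c y\<close> is the coefficient of the value at k + exponent of y in the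
    equation at \<nu>. For \<open>y0\<close> it is the coefficient of \<mu>0 times a positive
    multiplicity, so the recurrence is not trivial.\<close>
  define c where "c y = (\<Sum>\<mu>\<in>S. ?v \<mu> * (if add_mset y \<nu> = \<mu> then of_nat (count \<mu> y) else 0))" for y
  have "(\<Sum>y\<in>Y'. c y * \<phi> (d_t 0 (k + lvb_exponent y))) = 0" for k
  proof -
    have "F \<mu> k \<nu> = (\<Sum>y\<in>Y'. (if add_mset y \<nu> = \<mu> then of_nat (count \<mu> y) else 0) * ?f k y)"
      if "\<mu> \<in> S" for \<mu>
    proof -
      have "set_mset \<mu> \<subseteq> Y'" "size \<mu> = r" using that by (auto simp: Y'_def S_def)
      then have "F \<mu> k \<nu> = (\<Sum>y\<in>Y'. of_nat (count \<mu> y) * (if \<mu> - {#y#} = \<nu> then ?f k y else 0))"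
        unfolding F_def by (simp only: sum_mset_count[OF Y'(1)] if_True simp_thms)
      also have "\<dots> = (\<Sum>y\<in>Y'. (if add_mset y \<nu> = \<mu> then of_nat (count \<mu> y) else 0) * ?f k y)"
      proof (rule sum.cong[OF refl])
        fix y
        have "\<mu> - {#y#} = \<nu> \<longleftrightarrow> add_mset y \<nu> = \<mu>" if "y \<in># \<mu>" using that by auto
        then show "of_nat (count \<mu> y) * (if \<mu> - {#y#} = \<nu> then ?f k y else 0)
            = (if add_mset y \<nu> = \<mu> then of_nat (count \<mu> y) else 0) * ?f k y"
          by (cases "y \<in># \<mu>") (auto simp: not_in_iff)
      qed
      finally show ?thesis .
    qed
    moreover have "(\<Sum>\<mu>\<in>?K. ?v \<mu> * F \<mu> k \<nu>) = (\<Sum>\<mu>\<in>S. ?v \<mu> * F \<mu> k \<nu>)"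
      by (rule sum.mono_neutral_right) (auto simp: S_def F_def)
    ultimately have "(\<Sum>\<mu>\<in>S. \<Sum>y\<in>Y'. ?v \<mu> * (if add_mset y \<nu> = \<mu> then of_nat (count \<mu> y) else 0) * ?f k y) = 0"
      using FQ[OF \<open>size \<nu> + 1 = r\<close>, of k] \<open>Q = 0\<close>
      by (simp only: sum_distrib_left mult.assoc new_letter_linear lookup_zero add.right_neutral cong: sum.cong)
    then have "(\<Sum>y\<in>Y'. c y * ?f k y) = 0"
      unfolding c_def sum_distrib_right by (subst sum.swap)
    then have "- 2 * (\<Sum>y\<in>Y'. c y * \<phi> (d_t 0 (k + lvb_exponent y))) = 0"
      unfolding sum_distrib_left by (simp add: mult_ac)
    then show ?thesis by simp
  qed
  then have "(\<Sum>j\<in>lvb_exponent ` Y'. c (Dt (- 1) j) * \<phi> (d_t 0 (k + j))) = 0" for k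
    by (subst sum.reindex[OF inj]) (use Y'(2) in \<open>simp cong: sum.cong\<close>)
  moreover have "c y0 = ?v \<mu>0 * of_nat (count \<mu>0 y0)"
    using \<mu>0 by (simp add: c_def \<nu> S_def if_distrib[of "\<lambda>z. _ * z"] cong: if_cong)
  then have "c (Dt (- 1) (lvb_exponent y0)) \<noteq> 0"
    using y0 \<mu>0 Y'(2)[OF y0'] by (simp add: in_keys_iff)
  ultimately show ?thesis
    using Y'(1) y0' by (intro recurrentI_laurent[of "lvb_exponent ` Y'" "lvb_exponent y0" "\<lambda>j. c (Dt (- 1) j)"]) auto
qed

section \<open>Submodules and the irreducible quotient\<close>

lemma verma_submoduleD:
  assumes "lv_submodule N (verma_model \<phi>)"
  shows "N \<subseteq> carrier (verma_model \<phi>)" "0 \<in> N" "\<And>p q. p \<in> N \<Longrightarrow> q \<in> N \<Longrightarrow> p + q \<in> N"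
    "\<And>c p. p \<in> N \<Longrightarrow> scal c p \<in> N"
    "\<And>x p. p \<in> N \<Longrightarrow> hw.induced \<phi> (deg1 x * mset_word p) \<in> N"
proof -
  interpret N: submodule N complex_field "verma_model \<phi>" using assms by (simp add: lv_submodule_def)
  show "N \<subseteq> carrier (verma_model \<phi>)" by (rule lv_submodule_subset[OF assms])
  show "0 \<in> N" "\<And>p q. p \<in> N \<Longrightarrow> q \<in> N \<Longrightarrow> p + q \<in> N" "\<And>c p. p \<in> N \<Longrightarrow> scal c p \<in> N"
    using N.one_closed N.m_closed N.smult_closed by (simp_all add: complex_field_def)
  show "\<And>x p. p \<in> N \<Longrightarrow> hw.induced \<phi> (deg1 x * mset_word p) \<in> N"
    using assms by (simp add: lv_submodule_def)
qed

lemma submodule_word_closed: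
  assumes N: "lv_submodule N (verma_model \<phi>)" and "m \<in> N"
  shows "hw.induced \<phi> (word w * mset_word m) \<in> N"
proof (induction w)
  case Nil
  have "hw.induced \<phi> (mset_word m) = m"
    using verma_submoduleD(1)[OF N] assms(2) by (intro hw.induced_mset_word) auto
  then show ?case using assms(2) by (simp add: word_Nil)
next
  case (Cons x w)
  have "hw.induced \<phi> (deg1 (single x 1) * mset_word (hw.induced \<phi> (word w * mset_word m))) \<in> N"
    by (rule verma_submoduleD(5)[OF N Cons])
  then show ?case
    using hw.induced_mult_left[of \<phi> "word [x]" "word w * mset_word m"]
    by (simp add: word_Cons[of x w] mult.assoc)
qed

lemma submodule_vacuum:
  assumes N: "lv_submodule N (verma_model \<phi>)" and "single {#} c \<in> N" "c \<noteq> 0"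
  shows "N = carrier (verma_model \<phi>)"
proof
  show "N \<subseteq> carrier (verma_model \<phi>)" by (rule verma_submoduleD(1)[OF N])
  have v0: "hw.induced \<phi> 1 \<in> N"
    using verma_submoduleD(4)[OF N assms(2), of "inverse c"] assms(3) by (simp add: induced_one del: single_one)
  have word: "hw.induced \<phi> (word w) \<in> N" for w
    using submodule_word_closed[OF N v0, of w] hw.induced_mult_left[of \<phi> "word w" 1] by simp
  have "hw.induced \<phi> q \<in> N" for q
    by (induction q rule: tensor_induct)
      (simp_all add: hw.induced_linear word verma_submoduleD[OF N])
  then show "carrier (verma_model \<phi>) \<subseteq> N"
    using hw.induced_mset_word by (metis (no_types, lifting) mem_Collect_eq subsetI verma_model_simps(1))
qed

lemma lower_degree:
  assumes "set_mset \<mu> \<inter> lvb_nonneg = {}" "\<mu> \<noteq> {#}"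
  shows "mset_degree \<mu> < 0"
proof -
  have "\<mu> = {#} \<or> mset_degree \<mu> < 0" using assms(1)
    by (induction \<mu>) (auto simp: nonneg_iff)
  with assms(2) show ?thesis by blast
qed

lemma only_vacuum:
  assumes "\<And>\<mu>. \<mu> \<in> keys m \<Longrightarrow> \<mu> = {#}"
  shows "m = single {#} (lookup m {#})"
proof (rule poly_mapping_eqI)
  show "lookup m \<mu> = lookup (single {#} (lookup m {#})) \<mu>" for \<mu>
    using assms[of \<mu>] by (cases "\<mu> = {#}") (auto simp: lookup_single_not_eq in_keys_iff)
qed

lemma d0_diagonal:
  assumes "m \<in> carrier (verma_model \<phi>)"
  shows "lookup (hw.induced \<phi> (word [Dt 0 0] * mset_word m)) \<mu>
    = (\<phi> (d_t 0 0) + of_int (mset_degree \<mu>)) * lookup m \<mu>"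
proof (induction m rule: pm_keys_induct)
  case (single \<kappa>)
  let ?w = "sorted_list_of_multiset \<kappa>"
  have "set ?w \<inter> lvb_nonneg = {}" using single assms by auto
  then have "hw.induced \<phi> (word ?w) = single \<kappa> 1"
    by (simp add: induced_negative_word hw.nf_sorted)
  moreover have "word_degree ?w = mset_degree \<kappa>"
    by (metis mset_map mset_sorted_list_of_multiset sum_mset_sum_list)
  ultimately show ?case
    using induced_d0[of \<phi> 1 ?w] by (auto simp: mset_word_def lookup_single when_def)
qed (simp_all add: mset_word_linear hw.induced_linear distrib_left scal_mult_right lookup_add)

text \<open>Applying the operators $d_0 - \lambda$ for the other weights $\lambda$ projects to the
  component of highest weight.\<close>

lemma submodule_projection:
  assumes N: "lv_submodule N (verma_model \<phi>)" and "finite A"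
  shows "m \<in> N \<Longrightarrow> 0 \<notin> A \<Longrightarrow> (\<And>\<mu>. \<mu> \<in> keys m \<Longrightarrow> \<mu> = {#} \<or> mset_degree \<mu> \<in> A) \<Longrightarrow>
    lookup m {#} \<noteq> 0 \<Longrightarrow> N = carrier (verma_model \<phi>)"
  using assms(2)
proof (induction A arbitrary: m)
  case empty
  then have "m = single {#} (lookup m {#})" by (intro only_vacuum) auto
  then show ?case using empty submodule_vacuum[OF N] by metis
next
  case (insert a A)
  let ?m = "hw.induced \<phi> (deg1 (d_t 0 0) * mset_word m) + scal (- (\<phi> (d_t 0 0) + of_int a)) m"
  have lookup: "lookup ?m \<mu> = of_int (mset_degree \<mu> - a) * lookup m \<mu>" for \<mu>
  proof -
    have "m \<in> carrier (verma_model \<phi>)" using insert.prems(1) verma_submoduleD(1)[OF N] by blast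
    from d0_diagonal[OF this, of \<mu>] show ?thesis
      unfolding deg1_single scal_eqs lookup_add lookup_scal by (simp add: algebra_simps)
  qed
  show ?case
  proof (rule insert.IH)
    show "?m \<in> N" using insert.prems(1) N by (intro verma_submoduleD)
    show "0 \<notin> A" using insert.prems(2) by simp
    show "lookup ?m {#} \<noteq> 0" unfolding lookup using insert.prems(2,4) by simp
    fix \<mu> assume "\<mu> \<in> keys ?m"
    then have "mset_degree \<mu> \<noteq> a" "\<mu> \<in> keys m" unfolding in_keys_iff lookup by auto
    then show "\<mu> = {#} \<or> mset_degree \<mu> \<in> A" using insert.prems(3)[of \<mu>] by auto
  qed
qed

subsection \<open>The irreducible quotient\<close>

text \<open>A pairing of the enveloping algebra with the Verma module. The contravariant form would
  pair the module with itself through an anti-involution; pairing with words needs none and realises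
  the irreducible quotient inside functions on words.\<close>

definition vac_form :: "(lvir \<Rightarrow> complex) \<Rightarrow> (lvb multiset \<Rightarrow>\<^sub>0 complex) \<Rightarrow> lvb list \<Rightarrow> complex" where
  "vac_form \<phi> m = (\<lambda>u. vac \<phi> (word u * mset_word m))"

lemma vac_form_linear:
  "vac_form \<phi> (p + q) = vac_form \<phi> p + vac_form \<phi> q"
  "vac_form \<phi> (- p) = - vac_form \<phi> p"
  "vac_form \<phi> (scal c p) = (\<lambda>u. c * vac_form \<phi> p u)" "vac_form \<phi> 0 = 0"
  by (simp_all add: vac_form_def mset_word_linear distrib_left scal_mult_right vac_linear fun_eq_iff)

lemma vac_form_induced: "vac_form \<phi> (hw.induced \<phi> q) u = vac \<phi> (word u * q)"
  by (simp add: vac_form_def vac_def flip: hw.induced_mult_left)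

text \<open>An element acts by appending it to the argument, the formula forced by (u x) m = u (x
  m).\<close>

definition irr_model :: "(lvir \<Rightarrow> complex) \<Rightarrow> (lvb list \<Rightarrow> complex) lv_module" where
  "irr_model \<phi> = \<lparr>carrier = vac_form \<phi> ` carrier (verma_model \<phi>),
     monoid.mult = undefined, one = undefined, zero = 0, add = (+), module.smult = (\<lambda>c F u. c * F u),
     act = (\<lambda>x F u. fun_ext (\<lambda>b. F (u @ [b])) x)\<rparr>"

lemma irr_model_simps [simp]:
  "carrier (irr_model \<phi>) = vac_form \<phi> ` carrier (verma_model \<phi>)"
  "\<zero>\<^bsub>irr_model \<phi>\<^esub> = 0" "add (irr_model \<phi>) = (+)" "module.smult (irr_model \<phi>) = (\<lambda>c F u. c * F u)"
  "act (irr_model \<phi>) x F = (\<lambda>u. fun_ext (\<lambda>b. F (u @ [b])) x)"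
  by (simp_all add: irr_model_def)

lemma vac_form_act:
  "vac_form \<phi> (hw.induced \<phi> (deg1 x * mset_word m)) = (\<lambda>u. fun_ext (\<lambda>b. vac_form \<phi> m (u @ [b])) x)"
proof
  fix u
  have "vac \<phi> (word u * (deg1 x * mset_word m)) = fun_ext (\<lambda>b. vac_form \<phi> m (u @ [b])) x"
  proof (induction x rule: pm_keys_induct)
    case (single a)
    have "word u * (word [a] * mset_word m) = word (u @ [a]) * mset_word m"
      by (simp add: word_append mult.assoc)
    then show ?case by (simp add: vac_form_def)
  qed (simp_all add: deg1_linear vac_linear distrib_left distrib_right scal_mult_left scal_mult_right
      fun_ext_linear)
  then show "vac_form \<phi> (hw.induced \<phi> (deg1 x * mset_word m)) u = fun_ext (\<lambda>b. vac_form \<phi> m (u @ [b])) x"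
    by (simp add: vac_form_induced)
qed

lemma irr_model_group: "abelian_group (irr_model \<phi>)"
proof (rule abelian_group_plusI)
  have V: "p + q \<in> carrier (verma_model \<phi>)" "- p \<in> carrier (verma_model \<phi>)" "0 \<in> carrier (verma_model \<phi>)"
    if "p \<in> carrier (verma_model \<phi>)" "q \<in> carrier (verma_model \<phi>)" for p q
    using that by (simp_all add: keys_add_subset)
  show "0 \<in> carrier (irr_model \<phi>)"
    using image_eqI[of 0 "vac_form \<phi>" 0 "carrier (verma_model \<phi>)"] by (simp add: vac_form_linear)
  fix F assume "F \<in> carrier (irr_model \<phi>)"
  then obtain p where p: "F = vac_form \<phi> p" "p \<in> carrier (verma_model \<phi>)"
    unfolding irr_model_simps by blast
  show "- F \<in> carrier (irr_model \<phi>)"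
    unfolding p(1) irr_model_simps vac_form_linear(2)[symmetric] using V(2)[OF p(2) p(2)] by (rule imageI)
  fix G assume "G \<in> carrier (irr_model \<phi>)"
  then obtain q where q: "G = vac_form \<phi> q" "q \<in> carrier (verma_model \<phi>)"
    unfolding irr_model_simps by blast
  show "F + G \<in> carrier (irr_model \<phi>)"
    unfolding p(1) q(1) irr_model_simps vac_form_linear(1)[symmetric] using V(1)[OF p(2) q(2)] by (rule imageI)
qed simp_all

lemma vac_form_epi: "lv_epi (vac_form \<phi>) (verma_model \<phi>) (irr_model \<phi>)"
proof -
  note V = verma_model_space[of \<phi>]
  have "lv_space (irr_model \<phi>)"
    unfolding lv_space_def
  proof (intro conjI allI ballI)
    fix F assume "F \<in> carrier (irr_model \<phi>)"
    then obtain p where p: "F = vac_form \<phi> p" "p \<in> carrier (verma_model \<phi>)"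
      unfolding irr_model_simps by blast
    show "c \<odot>\<^bsub>irr_model \<phi>\<^esub> F \<in> carrier (irr_model \<phi>)" for c
      using imageI[OF lv_spaceD(2)[OF V p(2), of c], of "vac_form \<phi>"]
      by (simp add: p(1) vac_form_linear)
    show "act (irr_model \<phi>) x F \<in> carrier (irr_model \<phi>)" for x
      using imageI[OF lv_spaceD(3)[OF V p(2), of x], of "vac_form \<phi>"]
      by (simp add: p(1) vac_form_act)
  qed (rule irr_model_group)
  with V show ?thesis
    by (simp add: lv_epi_def vac_form_linear vac_form_act)
qed

lemma vac_form_vacuum: "vac_form \<phi> (single {#} 1) [] = 1"
  by (simp add: vac_form_def mset_word_def word_Nil del: single_one)

text \<open>If some word u takes m to a vector with a v_0 component, this component is separated
  from the others, which all have negative degree; the submodule then contains v_0 and is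
  everything.\<close>

lemma proper_submodule_kernel:
  assumes N: "lv_submodule N (verma_model \<phi>)" "N \<noteq> carrier (verma_model \<phi>)" and m: "m \<in> N"
  shows "vac_form \<phi> m = 0"
proof (rule ccontr)
  assume "vac_form \<phi> m \<noteq> 0"
  then obtain u where u: "vac_form \<phi> m u \<noteq> 0" by (auto simp: fun_eq_iff)
  let ?m = "hw.induced \<phi> (word u * mset_word m)"
  have "?m \<in> N" by (rule submodule_word_closed[OF N(1) m])
  moreover have "lookup ?m {#} \<noteq> 0" using u by (simp add: vac_form_def vac_def)
  moreover have "mset_degree \<mu> \<noteq> 0" if "\<mu> \<in> keys ?m" "\<mu> \<noteq> {#}" for \<mu>
    using lower_degree[of \<mu>] that keys_induced_lower[of \<phi> "word u * mset_word m"] by auto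
  ultimately have "N = carrier (verma_model \<phi>)"
    by (intro submodule_projection[OF N(1), of "mset_degree ` (keys ?m - {{#}})" ?m])
      (fastforce+)
  with N(2) show False by simp
qed

lemma lv_epi_kernel_submodule:
  assumes h: "lv_epi h V W" and "\<And>c. c \<odot>\<^bsub>W\<^esub> \<zero>\<^bsub>W\<^esub> = \<zero>\<^bsub>W\<^esub>" "\<And>x. act W x \<zero>\<^bsub>W\<^esub> = \<zero>\<^bsub>W\<^esub>"
  shows "lv_submodule {v \<in> carrier V. h v = \<zero>\<^bsub>W\<^esub>} V"
proof -
  have "subgroup {v \<in> carrier V. h v = \<zero>\<^bsub>W\<^esub>} (add_monoid V)"
    using group_hom.subgroup_kernel[OF lv_epi_group_hom[OF h]] by (simp add: kernel_def)
  then show ?thesis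
    using assms lv_epiD[OF h] lv_spaceD[OF lv_epiD(1)[OF h]]
    by (simp add: lv_submodule_def submodule_def submodule_axioms_def)
qed

text \<open>The kernel of the pairing is proper, because v_0 pairs to 1 with the empty word, and
  contains every proper submodule. Hence it is the one maximal proper submodule that the definite
  description denotes.\<close>

theorem lv_irreducible_hw_iso:
  "\<exists>h. lv_iso h (lv_irreducible_hw \<phi>) (irr_model \<phi>)"
proof -
  let ?V = "lv_verma \<phi>" and ?h = "vac_form \<phi> \<circ> verma_iso \<phi>"
  have iso: "lv_epi (verma_iso \<phi>) ?V (verma_model \<phi>)" "inj_on (verma_iso \<phi>) (carrier ?V)"
    using verma_iso[of \<phi>] by (simp_all add: lv_iso_def)
  have h: "lv_epi ?h ?V (irr_model \<phi>)" by (rule lv_epi_comp[OF iso(1) vac_form_epi])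
  define N0 where "N0 = {X \<in> carrier ?V. ?h X = \<zero>\<^bsub>irr_model \<phi>\<^esub>}"
  have sub: "lv_submodule N0 ?V"
    unfolding N0_def by (rule lv_epi_kernel_submodule[OF h]) (simp_all add: fun_eq_iff fun_ext_def)
  have proper: "N0 \<noteq> carrier ?V"
  proof
    assume "N0 = carrier ?V"
    have "single {#} 1 \<in> carrier (verma_model \<phi>)" by (simp del: single_one)
    then obtain X where "X \<in> carrier ?V" "verma_iso \<phi> X = single {#} 1"
      using lv_epiD(3)[OF iso(1)] by (metis imageE)
    moreover from this(1) have "X \<in> N0" using \<open>N0 = carrier ?V\<close> by simp
    then have "vac_form \<phi> (verma_iso \<phi> X) = 0" by (simp add: N0_def)
    ultimately show False using vac_form_vacuum[of \<phi>] by (simp del: single_one)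
  qed
  have largest: "N \<subseteq> N0" if N: "lv_submodule N ?V" "N \<noteq> carrier ?V" for N
  proof
    fix X assume X: "X \<in> N"
    have NV: "N \<subseteq> carrier ?V" by (rule lv_submodule_subset[OF N(1)])
    have "verma_iso \<phi> ` N \<noteq> carrier (verma_model \<phi>)"
      using inj_on_image_eq_iff[OF iso(2) NV, of "carrier ?V"] N(2) lv_epiD(3)[OF iso(1)] by simp
    with lv_epi_submodule_image[OF iso(1) N(1)] have "vac_form \<phi> (verma_iso \<phi> X) = 0"
      by (rule proper_submodule_kernel) (use X in blast)
    then show "X \<in> N0" using X NV by (auto simp: N0_def)
  qed
  have "(THE N. maximal_proper_submodule N ?V) = N0"
  proof (rule the_equality)
    show "maximal_proper_submodule N0 ?V"
      unfolding maximal_proper_submodule_def using sub proper largest by blast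
    show "N = N0" if "maximal_proper_submodule N ?V" for N
      using that sub proper largest unfolding maximal_proper_submodule_def by blast
  qed
  then show ?thesis
    unfolding lv_irreducible_hw_def using lv_quotient_iso(1)[OF h N0_def] by auto
qed

section \<open>The criteria\<close>

subsection \<open>Reducibility of the Verma module\<close>

lemma vac_swap:
  "vac \<phi> (word u * word (x # y # v)) =
    vac \<phi> (word u * word (y # x # v)) + vac \<phi> (word u * (deg1 (lvb_bracket x y) * word v))"
  using arg_cong[OF induced_comm[of \<phi> "word u" x y "word v"], of "\<lambda>p. lookup p {#}"]
  by (simp add: vac_def lookup_add mult_single plus_free_mon_def)

text \<open>Without a recurrence, every vector that is not a multiple of v_0 is moved to a nonzero
  vector by some d_1 t^k. Each such step raises the lower bound on the degrees by one, so a nonzero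
  multiple of v_0 is reached inside the submodule.\<close>

lemma submodule_contains_vacuum:
  assumes N: "lv_submodule N (verma_model \<phi>)" and f: "\<not> recurrent (\<lambda>k. \<phi> (d_t 0 k))"
  shows "v \<in> N \<Longrightarrow> v \<noteq> 0 \<Longrightarrow> (\<And>\<mu>. \<mu> \<in> keys v \<Longrightarrow> - int n \<le> mset_degree \<mu>) \<Longrightarrow>
    N = carrier (verma_model \<phi>)"
proof (induction n arbitrary: v)
  case (0 v)
  have "\<mu> = {#}" if "\<mu> \<in> keys v" for \<mu>
    using lower_degree[of \<mu>] 0(3)[OF that] subsetD[OF verma_submoduleD(1)[OF N] 0(1)] that by fastforce
  then have v: "v = single {#} (lookup v {#})" by (rule only_vacuum)
  with 0(2) have "lookup v {#} \<noteq> 0" by (metis single_zero)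
  then show ?case using submodule_vacuum[OF N] 0(1) v by metis
next
  case (Suc n v)
  have lower: "keys v \<subseteq> {\<mu>. set_mset \<mu> \<inter> lvb_nonneg = {}}"
    using subsetD[OF verma_submoduleD(1)[OF N] Suc(2)] by simp
  show ?case
  proof (cases "\<exists>\<mu>\<in>keys v. \<mu> \<noteq> {#}")
    case True
    then obtain k where k: "hw.induced \<phi> (word [Dt 1 k] * mset_word v) \<noteq> 0"
      using singular_recurrent[OF lower] f by blast
    have "- int n \<le> mset_degree \<nu>"
      if \<nu>: "\<nu> \<in> keys (hw.induced \<phi> (word [Dt 1 k] * mset_word v))" for \<nu>
    proof -
      let ?w = "\<lambda>\<mu>. Dt 1 k # sorted_list_of_multiset \<mu>"
      have "keys (hw.induced \<phi> (word [Dt 1 k] * mset_word v))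
          \<subseteq> (\<Union>\<mu>\<in>keys v. keys (hw.induced \<phi> (word (?w \<mu>))))"
        unfolding induced_word_mset_word by (rule keys_lin_ext) auto
      then obtain \<mu> where \<mu>: "\<mu> \<in> keys v" "\<nu> \<in> keys (hw.induced \<phi> (word (?w \<mu>)))"
        using \<nu> by blast
      have "word_degree (sorted_list_of_multiset \<mu>) = mset_degree \<mu>"
        by (metis mset_map mset_sorted_list_of_multiset sum_mset_sum_list)
      then show ?thesis using induced_word_degree[OF \<mu>(2)] Suc(4)[OF \<mu>(1)] by simp
    qed
    then show ?thesis
      using Suc.IH[OF submodule_word_closed[OF N Suc(2)] k] by blast
  next
    case False
    then have v: "v = single {#} (lookup v {#})" by (intro only_vacuum) blast
    with Suc(3) have "lookup v {#} \<noteq> 0" by (metis single_zero)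
    then show ?thesis using submodule_vacuum[OF N] Suc(2) v by metis
  qed
qed

lemma reducible_recurrent:
  assumes "lv_reducible (verma_model \<phi>)"
  shows "recurrent (\<lambda>k. \<phi> (d_t 0 k))"
proof (rule ccontr)
  assume f: "\<not> recurrent (\<lambda>k. \<phi> (d_t 0 k))"
  obtain N where N: "lv_submodule N (verma_model \<phi>)" "N \<noteq> {0}" "N \<noteq> carrier (verma_model \<phi>)"
    using assms by (auto simp: lv_reducible_def)
  then obtain v where v: "v \<in> N" "v \<noteq> 0" using verma_submoduleD(2)[OF N(1)] by blast
  have "- int (nat (Max ((\<lambda>\<mu>. - mset_degree \<mu>) ` keys v))) \<le> mset_degree \<mu>"
    if "\<mu> \<in> keys v" for \<mu>
  proof -
    have "- mset_degree \<mu> \<le> Max ((\<lambda>\<mu>. - mset_degree \<mu>) ` keys v)" using that by simp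
    then show ?thesis by linarith
  qed
  from submodule_contains_vacuum[OF N(1) f v this] N(3) show False by blast
qed

lemma shift_act_translate: "shift_act p (\<lambda>j. h (j + l)) k = shift_act p h (k + l)"
  by (simp add: shift_act_def add_ac)

text \<open>The last letter b of degree m either passes d_{-1} t^j and acts on v_0 by a scalar, or
  is replaced with it by their bracket: again a letter d_{-1} for m = 0, a multiple of d_0 for m =
  1, and a letter killing v_0 for larger m. The index j is only shifted, which recurrences
  tolerate.\<close>

lemma annihilated_nonneg_word:
  assumes p: "\<And>k. shift_act p (\<lambda>k. \<phi> (d_t 0 k)) k = 0" and y: "set y \<subseteq> lvb_nonneg"
  shows "shift_act p (\<lambda>j. vac \<phi> (word y * word [Dt (- 1) j])) k = 0"
  using y
proof (induction y arbitrary: k rule: rev_induct)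
  case Nil
  have "vac \<phi> (word [] * word [Dt (- 1) j]) = 0" for j
    using vac_negative[of "Dt (- 1) j" \<phi> 1] by (simp add: nonneg_iff word_Nil)
  then show ?case by (simp add: shift_act_lincomb)
next
  case (snoc b y)
  let ?h = "\<lambda>j. vac \<phi> (word y * word [Dt (- 1) j])"
  let ?g = "\<lambda>j. vac \<phi> (word y * deg1 (lvb_bracket b (Dt (- 1) j)))"
  have b: "keys (word [b]) \<subseteq> words_over lvb_nonneg" using snoc.prems by simp
  have eq: "vac \<phi> (word (y @ [b]) * word [Dt (- 1) j]) = hw_scalar \<phi> b * ?h j + ?g j" for j
    using vac_swap[of \<phi> y b "Dt (- 1) j" "[]"] vac_char[OF b, of \<phi> "word y * word [Dt (- 1) j]"]
    by (simp add: mult_single plus_free_mon_def word_Nil)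
  have IH: "shift_act p ?h k = 0" for k using snoc by simp
  have g: "shift_act p ?g k = 0" for k
  proof (cases b)
    case (Ct l)
    then show ?thesis by (simp add: deg1_linear vac_linear shift_act_lincomb)
  next
    case (Dt m l)
    then have "0 \<le> m" using snoc.prems by (simp add: nonneg_iff)
    have br: "lvb_bracket b (Dt (- 1) j) = scal (of_int (- 1 - m)) (d_t (m - 1) (l + j))" for j
      by (simp add: Dt)
    have g: "?g j = of_int (- 1 - m) * vac \<phi> (word y * word [Dt (m - 1) (j + l)])" for j
      unfolding br deg1_linear deg1_single scal_eqs scal_mult_right vac_linear by (simp add: add.commute)
    show ?thesis
    proof (cases "m = 0")
      case True
      then have "?g = (\<lambda>j. - 1 * ?h (j + l))" unfolding g by simp
      then show ?thesis using shift_act_translate[of p ?h l] IH by (simp only: shift_act_lincomb mult_zero_right)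
    next
      case False
      then have "Dt (m - 1) j \<in> lvb_nonneg" for j using \<open>0 \<le> m\<close> by (simp add: nonneg_iff)
      then have "vac \<phi> (word y * word [Dt (m - 1) j]) = hw_scalar \<phi> (Dt (m - 1) j) * vac \<phi> (word y)" for j
        using vac_char[of "word [Dt (m - 1) j]" \<phi> "word y"] by simp
      then have "?g = (\<lambda>j. (of_int (- 1 - m) * (if m = 1 then 1 else 0) * vac \<phi> (word y)) * \<phi> (d_t 0 (j + l)))"
        unfolding g by auto
      then show ?thesis
        using shift_act_translate[of p "\<lambda>j. \<phi> (d_t 0 j)" l] p by (simp only: shift_act_lincomb mult_zero_right)
    qed
  qed
  show ?case unfolding eq shift_act_lincomb IH g by simp
qed

text \<open>It suffices to test sorted words. One that begins with a negative letter cannot reach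
  v_0, and the others are words of nonnegative letters.\<close>

lemma annihilated_singular:
  assumes p: "\<And>k. shift_act p (\<lambda>k. \<phi> (d_t 0 k)) k = 0"
  shows "shift_act p (\<lambda>j. vac \<phi> (q * word [Dt (- 1) j])) k = 0"
  using bracket_UNIV(1) bracket_UNIV(2)[of q]
proof (induction q rule: hw.pbw_induct)
  case (sorted w)
  then obtain s y where w: "w = s @ y" "set s \<inter> lvb_nonneg = {}" "set y \<subseteq> lvb_nonneg"
    using hw.sorted_split by blast
  show ?case
  proof (cases s)
    case Nil
    then show ?thesis using annihilated_nonneg_word[OF p w(3)] w(1) by simp
  next
    case (Cons x s')
    then have "x \<notin> lvb_nonneg" "word w = word [x] * word (s' @ y)"
      using w by (auto simp: mult_single plus_free_mon_def)
    then have "vac \<phi> (word w * word [Dt (- 1) j]) = 0" for j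
      using vac_negative[of x \<phi> "word (s' @ y) * word [Dt (- 1) j]"] by (simp add: mult.assoc)
    then show ?thesis by (simp only: shift_act_lincomb)
  qed
next
  case (rel u x y v)
  have "vac \<phi> (word u * hw.comm_rel x y * word v * word [Dt (- 1) j]) = 0" for j
    using vac_comm_rel[of \<phi> "word u" x y "word v * word [Dt (- 1) j]"] by (simp add: mult.assoc)
  then show ?case by (simp only: shift_act_lincomb)
qed (simp_all only: vac_linear mult_zero_left distrib_right scal_mult_left shift_act_lincomb; simp)+

text \<open>The submodule exhibited is the whole kernel of the pairing, which is proper by
  construction. The combination of the d_{-1} t^i with the coefficients of p lies in it and is
  nonzero, having the leading coefficient of p among its coefficients.\<close>

lemma recurrent_reducible:
  assumes "recurrent (\<lambda>k. \<phi> (d_t 0 k))"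
  shows "lv_reducible (verma_model \<phi>)"
proof -
  obtain p where p: "p \<noteq> 0" "\<And>k. shift_act p (\<lambda>k. \<phi> (d_t 0 k)) k = 0"
    using assms by (auto simp: recurrent_def)
  define m where "m = (\<Sum>i\<le>degree p. single {#Dt (- 1) (int i)#} (coeff p i))"
  define N where "N = {v \<in> carrier (verma_model \<phi>). vac_form \<phi> v = \<zero>\<^bsub>irr_model \<phi>\<^esub>}"
  have "lv_submodule N (verma_model \<phi>)"
    unfolding N_def by (rule lv_epi_kernel_submodule[OF vac_form_epi]) (simp_all add: fun_eq_iff fun_ext_def)
  moreover have "N \<noteq> carrier (verma_model \<phi>)"
  proof
    assume "N = carrier (verma_model \<phi>)"
    moreover have "single {#} 1 \<in> carrier (verma_model \<phi>)" by (simp del: single_one)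
    ultimately have "vac_form \<phi> (single {#} 1) = 0" by (auto simp: N_def)
    then show False using vac_form_vacuum[of \<phi>] by (simp del: single_one)
  qed
  moreover have "m \<in> N"
  proof -
    have "keys m \<subseteq> {\<mu>. set_mset \<mu> \<inter> lvb_nonneg = {}}"
    proof
      fix \<mu> assume "\<mu> \<in> keys m"
      then obtain i where "\<mu> \<in> keys (single {#Dt (- 1) (int i)#} (coeff p i))"
        unfolding m_def using keys_sum by fast
      then show "\<mu> \<in> {\<mu>. set_mset \<mu> \<inter> lvb_nonneg = {}}" by (auto simp: nonneg_iff split: if_splits)
    qed
    moreover have "vac_form \<phi> m u = 0" for u
    proof -
      have "mset_word m = (\<Sum>i\<le>degree p. scal (coeff p i) (word [Dt (- 1) (int i)]))"
        by (simp add: m_def mset_word_def lin_ext_sum)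
      then have "word u * mset_word m = (\<Sum>i\<le>degree p. scal (coeff p i) (word u * word [Dt (- 1) (int i)]))"
        by (simp add: sum_distrib_left scal_mult_right del: scal_single)
      moreover have "vac \<phi> (sum h A) = (\<Sum>a\<in>A. vac \<phi> (h a))" for h and A :: "nat set"
        by (induction A rule: infinite_finite_induct) (simp_all add: vac_linear)
      ultimately have "vac_form \<phi> m u = shift_act p (\<lambda>j. vac \<phi> (word u * word [Dt (- 1) j])) 0"
        unfolding vac_form_def shift_act_def by (simp add: vac_linear del: scal_single)
      then show ?thesis by (simp only: annihilated_singular[OF p(2)])
    qed
    ultimately show ?thesis by (simp add: N_def fun_eq_iff)
  qed
  moreover have "m \<noteq> 0"
  proof -
    have "lookup m {#Dt (- 1) (int (degree p))#} = coeff p (degree p)"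
      by (simp add: m_def lookup_sum lookup_single when_def)
    then show ?thesis using p(1) by (metis leading_coeff_0_iff lookup_zero)
  qed
  ultimately show ?thesis unfolding lv_reducible_def by (intro exI[of _ N]) auto
qed

subsection \<open>Weight spaces of the irreducible module\<close>

interpretation fv: vector_space "\<lambda>(c::complex) (F :: lvb list \<Rightarrow> complex) u. c * F u"
  by unfold_locales (simp_all add: fun_eq_iff algebra_simps)

lemma sum_fun_apply: "(\<Sum>a\<in>A. h a) u = (\<Sum>a\<in>A. h a u)"
  for h :: "'a \<Rightarrow> 'b \<Rightarrow> complex"
  by (induction A rule: infinite_finite_induct) auto

lemma vac_d0:
  "vac \<phi> (word u * (word [Dt 0 0] * q)) = (\<phi> (d_t 0 0) - of_int (word_degree u)) * vac \<phi> (word u * q)"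
proof (induction q rule: tensor_induct)
  case (word w)
  have "vac \<phi> (word u * (word [Dt 0 0] * word w)) = (\<phi> (d_t 0 0) + of_int (word_degree w)) * vac \<phi> (word u * word w)"
    using induced_d0[of \<phi> "word u" w] by (simp add: vac_def)
  moreover have "vac \<phi> (word u * word w) = 0" if "word_degree w \<noteq> - word_degree u"
    using vac_word_degree[of "u @ w" \<phi>] that by (simp add: word_append)
  ultimately show ?case by (cases "word_degree w = - word_degree u") auto
qed (simp_all add: vac_linear distrib_left scal_mult_right)

text \<open>On functionals d_0 is diagonal: it multiplies the value at u by \<phi>(d_0) minus the
  degree of u. A weight vector is thus a functional supported on words of one degree.\<close>

lemma weight_space_irr:
  "weight_space (irr_model \<phi>) \<mu>
    = {F \<in> carrier (irr_model \<phi>). \<forall>u. F u \<noteq> 0 \<longrightarrow> \<phi> (d_t 0 0) - of_int (word_degree u) = \<mu>}"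
proof -
  have "act (irr_model \<phi>) (d_t 0 0) F = \<mu> \<odot>\<^bsub>irr_model \<phi>\<^esub> F \<longleftrightarrow>
      (\<forall>u. F u \<noteq> 0 \<longrightarrow> \<phi> (d_t 0 0) - of_int (word_degree u) = \<mu>)" if "F \<in> carrier (irr_model \<phi>)" for F
  proof -
    obtain m where m: "F = vac_form \<phi> m" using \<open>F \<in> carrier (irr_model \<phi>)\<close> by auto
    have "F (u @ [Dt 0 0]) = (\<phi> (d_t 0 0) - of_int (word_degree u)) * F u" for u
      using vac_d0[of \<phi> u "mset_word m"] by (simp add: m vac_form_def word_append mult.assoc)
    then show ?thesis by (auto simp: fun_eq_iff)
  qed
  then show ?thesis unfolding weight_space_def by (intro Collect_cong) blast
qed

definition word_vector :: "(lvir \<Rightarrow> complex) \<Rightarrow> lvb list \<Rightarrow> lvb list \<Rightarrow> complex" where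
  "word_vector \<phi> s = (\<lambda>u. vac \<phi> (word (u @ s)))"

lemma word_vector_form: "word_vector \<phi> s = vac_form \<phi> (hw.induced \<phi> (word s))"
  by (simp add: word_vector_def vac_form_induced word_append fun_eq_iff)

lemma word_vector_carrier: "word_vector \<phi> s \<in> carrier (irr_model \<phi>)"
  using keys_induced_lower[of \<phi> "word s"] by (simp add: word_vector_form)

lemma word_vector_degree: "word_vector \<phi> s u \<noteq> 0 \<Longrightarrow> word_degree u = - word_degree s"
  using vac_word_degree[of "u @ s" \<phi>] by (fastforce simp: word_vector_def eq_neg_iff_add_eq_0)

lemma word_vector_weight:
  "word_vector \<phi> s \<in> weight_space (irr_model \<phi>) (\<phi> (d_t 0 0) + of_int (word_degree s))"
  using word_vector_degree[of \<phi> s] word_vector_carrier by (auto simp: weight_space_irr)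

lemma vac_form_expand:
  "vac_form \<phi> m = (\<Sum>\<kappa>\<in>keys m.
    (\<lambda>u. lookup m \<kappa> * word_vector \<phi> (sorted_list_of_multiset \<kappa>) u))"
  by (simp add: fun_eq_iff sum_fun_apply vac_form_def vac_def induced_word_mset_word lookup_lin_ext
      word_vector_def)

lemma finite_dimensional_irr:
  assumes "W \<subseteq> carrier (irr_model \<phi>)"
  shows "finite_dimensional (irr_model \<phi>) W \<longleftrightarrow> (\<exists>B. finite B \<and> B \<subseteq> W \<and> W \<subseteq> fv.span B)"
proof -
  have "(\<Oplus>\<^bsub>irr_model \<phi>\<^esub>b\<in>B. c b \<odot>\<^bsub>irr_model \<phi>\<^esub> b) = (\<Sum>b\<in>B. (\<lambda>u. c b * b u))"
    if "B \<subseteq> W" for B c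
    using lv_spaceD(2)[OF lv_epiD(2)[OF vac_form_epi[of \<phi>]]] that assms
    by (subst finsum_eq_sum[OF irr_model_group]) (auto simp del: irr_model_simps(1) simp: subset_iff)
  then have "(\<forall>w\<in>W. \<exists>c. w = (\<Oplus>\<^bsub>irr_model \<phi>\<^esub>b\<in>B. c b \<odot>\<^bsub>irr_model \<phi>\<^esub> b)) \<longleftrightarrow> W \<subseteq> fv.span B"
    if "finite B" "B \<subseteq> W" for B
    using that by (auto simp: fv.span_finite)
  then show ?thesis
    unfolding finite_dimensional_def by (intro iff_exI) (simp cong: conj_cong)
qed

text \<open>Linear dependence is a notion for sets and forgets repetitions, so a sequence with two
  equal members is treated apart. Otherwise the first card B + 1 members are too many to be
  independent.\<close>

lemma sequence_dependent:
  fixes e :: "nat \<Rightarrow> lvb list \<Rightarrow> complex"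
  assumes "finite B" "\<And>i. e i \<in> fv.span B"
  obtains i N c where "i \<le> N" "c i \<noteq> 0" "\<And>u. (\<Sum>i\<le>N. c i * e i u) = 0"
proof (cases "inj_on e {..card B}")
  case False
  then obtain i j where ij: "i \<le> card B" "j \<le> card B" "i \<noteq> j" "e i = e j" by (auto simp: inj_on_def)
  define c where "c l = (if l = i then 1 else if l = j then - 1 else 0 :: complex)" for l
  have "(\<Sum>l\<le>card B. c l * e l u) = 0" for u
  proof -
    have "(\<Sum>l\<le>card B. c l * e l u) = (\<Sum>l\<in>{i, j}. c l * e l u)"
      by (rule sum.mono_neutral_right) (use ij in \<open>auto simp: c_def\<close>)
    then show ?thesis using ij by (simp add: c_def)
  qed
  moreover have "c i \<noteq> 0" by (simp add: c_def)
  ultimately show ?thesis using ij(1) by (intro that)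
next
  case True
  let ?S = "e ` {..card B}"
  have "card ?S = Suc (card B)" using True by (simp add: card_image)
  then have "fv.dependent ?S"
    using fv.independent_span_bound[OF assms(1), of ?S] assms(2) by auto
  then obtain c where c: "\<exists>v\<in>?S. c v \<noteq> 0" "(\<Sum>v\<in>?S. (\<lambda>u. c v * v u)) = 0"
    by (subst (asm) fv.dependent_finite) auto
  then obtain i where "i \<le> card B" "c (e i) \<noteq> 0" by auto
  moreover have "(\<Sum>i\<le>card B. c (e i) * e i u) = 0" for u
    using fun_cong[OF c(2), of u] by (simp add: sum.reindex[OF True] sum_fun_apply)
  ultimately show ?thesis by (intro that[of i "card B" "\<lambda>i. c (e i)"])
qed

lemma vac_nonneg_letter: "x \<in> lvb_nonneg \<Longrightarrow> vac \<phi> (word [x]) = hw_scalar \<phi> x"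
  by (simp add: vac_def induced_nonneg_letter)

lemma vac_pair:
  assumes "0 < n"
  shows "vac \<phi> (word [Dt n k, Dt (- n) j])
    = of_int (- 2 * n) * \<phi> (d_t 0 (k + j)) + of_int (n ^ 3 - n) / 12 * \<phi> (c_t (k + j))"
proof -
  have "vac \<phi> (word [Dt (- n) j, Dt n k]) = 0"
    using vac_negative[of "Dt (- n) j" \<phi> "word [Dt n k]"] assms
    by (simp add: nonneg_iff mult_single plus_free_mon_def)
  moreover have "vac \<phi> (word [Dt 0 (k + j)]) = \<phi> (d_t 0 (k + j))"
    "vac \<phi> (word [Ct (k + j)]) = \<phi> (c_t (k + j))"
    by (simp_all add: vac_nonneg_letter nonneg_iff) (simp add: hw_scalar_def)
  ultimately show ?thesis
    using vac_swap[of \<phi> "[]" "Dt n k" "Dt (- n) j" "[]"]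
    by (simp add: word_Nil deg1_linear vac_linear del: scal_single)
qed

text \<open>The vectors d_{-n} t^i v_0 all have the same weight, so finitely many of them are
  dependent. Evaluating the dependence at the one-letter words d_n t^k, for all k, turns it into a
  recurrence.\<close>

lemma harish_chandra_recurrent_pair:
  assumes "harish_chandra (irr_model \<phi>)" "0 < n"
  shows "recurrent (\<lambda>k. of_int (- 2 * n) * \<phi> (d_t 0 k) + of_int (n ^ 3 - n) / 12 * \<phi> (c_t k))"
proof -
  let ?W = "weight_space (irr_model \<phi>) (\<phi> (d_t 0 0) + of_int (- n))"
  let ?e = "\<lambda>i. word_vector \<phi> [Dt (- n) (int i)]"
  have "?W \<subseteq> carrier (irr_model \<phi>)" by (simp add: weight_space_def)
  moreover have "finite_dimensional (irr_model \<phi>) ?W" using assms(1) by (simp add: harish_chandra_def)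
  ultimately obtain B where B: "finite B" "?W \<subseteq> fv.span B" by (auto simp: finite_dimensional_irr)
  have "?e i \<in> ?W" for i using word_vector_weight[of \<phi> "[Dt (- n) (int i)]"] by simp
  then have "?e i \<in> fv.span B" for i using B(2) by blast
  then obtain i N c where c: "i \<le> N" "c i \<noteq> 0" "\<And>u. (\<Sum>i\<le>N. c i * ?e i u) = 0"
    by (rule sequence_dependent[of B ?e, OF B(1)]) (rule that)
  define F where "F k = of_int (- 2 * n) * \<phi> (d_t 0 k) + of_int (n ^ 3 - n) / 12 * \<phi> (c_t k)" for k
  have "(\<Sum>j\<in>int ` {..N}. c (nat j) * F (k + j)) = 0" for k
    using c(3)[of "[Dt n k]"]
    by (simp add: sum.reindex word_vector_def vac_pair[OF assms(2)] F_def del: of_int_minus of_int_mult)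
  then have "recurrent F"
    using c(1,2) by (intro recurrentI_laurent[of "int ` {..N}" "int i" "\<lambda>j. c (nat j)"]) auto
  then show ?thesis by (simp only: F_def[abs_def])
qed

lemma harish_chandra_recurrent:
  assumes "harish_chandra (irr_model \<phi>)"
  shows "recurrent (\<lambda>k. \<phi> (d_t 0 k))" "recurrent (\<lambda>k. \<phi> (c_t k))"
proof -
  \<comment> \<open>n = 1 removes the central term.\<close>
  have 1: "recurrent (\<lambda>k. - 2 * \<phi> (d_t 0 k))"
    using harish_chandra_recurrent_pair[OF assms, of 1] by simp
  show "recurrent (\<lambda>k. \<phi> (d_t 0 k))" using recurrent_scale[OF 1, of "- 1 / 2"] by simp
  have "recurrent (\<lambda>k. - 4 * \<phi> (d_t 0 k) + 1 / 2 * \<phi> (c_t k))"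
    using harish_chandra_recurrent_pair[OF assms, of 2] by simp
  \<comment> \<open>Twice the relation for n = 2, minus four times the one for n = 1, leaves the
    values on c alone.\<close>
  from recurrent_add[OF recurrent_scale[OF this, of 2] recurrent_scale[OF 1, of "- 4"]]
  show "recurrent (\<lambda>k. \<phi> (c_t k))" by (simp add: algebra_simps)
qed

section \<open>From recurrences to finite-dimensional weight spaces\<close>

abbreviation annihilates :: "complex poly \<Rightarrow> (int \<Rightarrow> complex) \<Rightarrow> bool" where
  "annihilates p h \<equiv> \<forall>k. shift_act p h k = 0"

lemma annihilates_lincomb:
  "annihilates p h \<Longrightarrow> annihilates p h' \<Longrightarrow> annihilates p (\<lambda>j. h j + h' j)"
  "annihilates p h \<Longrightarrow> annihilates p (\<lambda>j. c * h j)"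
  "annihilates p h \<Longrightarrow> annihilates p (\<lambda>j. h (j + l))"
  "annihilates p (\<lambda>j. 0)"
  by (simp_all add: shift_act_lincomb shift_act_translate)

lemma lvb_bracket_Ct [simp]: "lvb_bracket (Ct j) x = 0" "lvb_bracket x (Ct j) = 0"
  by (cases x; simp)+

text \<open>Families of basis elements indexed by the power of t. That p annihilates such a family
  in j, inside a word, says that the elements with t^j replaced by t^k p give 0.\<close>

definition ideal_letter :: "(int \<Rightarrow> lvb) \<Rightarrow> bool" where
  "ideal_letter x \<longleftrightarrow> (\<exists>i. x = Dt i) \<or> x = Ct"

lemma ideal_letterI [simp]: "ideal_letter (Dt i)" "ideal_letter Ct"
  by (auto simp: ideal_letter_def)

text \<open>The ideal $\mathrm{Vir} \otimes (p)$ annihilates the irreducible module: an element of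
  nonnegative degree can be moved to the highest weight vector, one of negative degree to the left.\<close>

context
  fixes p :: "complex poly" and \<phi> :: "lvir \<Rightarrow> complex"
  assumes f: "annihilates p (\<lambda>k. \<phi> (d_t 0 k))" and g: "annihilates p (\<lambda>k. \<phi> (c_t k))"
begin

lemma ideal_annihilates:
  "ideal_letter x \<Longrightarrow> annihilates p (\<lambda>j. vac \<phi> (word (u @ x j # v)))"
proof (induction "length u + length v" arbitrary: u v x rule: less_induct)
  case less
  let ?A = "\<lambda>u v. annihilates p (\<lambda>j. vac \<phi> (word (u @ x j # v)))"
  \<comment> \<open>The bracket with a fixed letter consists of families of the same kind with
    shifted index, and it stands in a shorter word, so the induction hypothesis covers it.\<close>
  have bracket: "annihilates p (\<lambda>j. vac \<phi> (word u' * (deg1 (lvb_bracket (x j) b) * word v')))"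
    if "length u' + length v' < length u + length v" for u' v' b
  proof -
    have IH: "annihilates p (\<lambda>j. vac \<phi> (word u' * (word [y j] * word v')))" if "ideal_letter y" for y
      using less.hyps[OF \<open>length u' + length v' < length u + length v\<close> that]
      by (simp add: mult_single plus_free_mon_def)
    show ?thesis
    proof (cases "x = Ct \<or> (\<exists>l. b = Ct l)")
      case True
      then show ?thesis by (auto simp: deg1_linear vac_linear shift_act_lincomb)
    next
      case False
      then obtain i m l where x: "x = Dt i" "b = Dt m l"
        using less.prems by (cases b) (auto simp: ideal_letter_def)
      have D: "annihilates p (\<lambda>j. of_int (m - i) * vac \<phi> (word u' * (word [Dt (i + m) (j + l)] * word v')))"
        using IH[of "Dt (i + m)"]
          annihilates_lincomb(3)[of p "\<lambda>j. vac \<phi> (word u' * (word [Dt (i + m) j] * word v'))" l]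
        by (intro annihilates_lincomb(2)) simp
      have C: "annihilates p (\<lambda>j. of_int (i ^ 3 - i) / 12 * vac \<phi> (word u' * (word [Ct (j + l)] * word v')))"
        using IH[of Ct]
          annihilates_lincomb(3)[of p "\<lambda>j. vac \<phi> (word u' * (word [Ct j] * word v'))" l]
        by (intro annihilates_lincomb(2)) simp
      have "vac \<phi> (word u' * (deg1 (lvb_bracket (x j) b) * word v'))
        = of_int (m - i) * vac \<phi> (word u' * (word [Dt (i + m) (j + l)] * word v'))
          + (if i + m = 0 then of_int (i ^ 3 - i) / 12 * vac \<phi> (word u' * (word [Ct (j + l)] * word v')) else 0)"
        for j
        unfolding x lvb_bracket.simps
        by (simp add: deg1_linear vac_linear distrib_left distrib_right scal_mult_left scal_mult_right
            del: scal_single)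
      then show ?thesis using D annihilates_lincomb(1)[OF D C] by (cases "i + m = 0") simp_all
    qed
  qed
  have swap: "?A u' (b # v') \<longleftrightarrow> ?A (u' @ [b]) v'"
    if "length u' + length (b # v') = length u + length v" for u' b v'
  proof -
    have eq: "vac \<phi> (word (u' @ x j # b # v')) = vac \<phi> (word ((u' @ [b]) @ x j # v'))
        + vac \<phi> (word u' * (deg1 (lvb_bracket (x j) b) * word v'))" for j
      using vac_swap[of \<phi> u' "x j" b v'] by (simp add: mult_single plus_free_mon_def)
    have "annihilates p (\<lambda>j. vac \<phi> (word u' * (deg1 (lvb_bracket (x j) b) * word v')))"
      by (rule bracket) (use that in simp)
    then show ?thesis unfolding eq shift_act_lincomb by simp
  qed
  \<comment> \<open>By the bracket step the place of the family within the word does not matter;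
    only the right end and the left end have to be examined.\<close>
  have slide: "?A u' v' \<longleftrightarrow> ?A (u' @ v') []" if "length u' + length v' = length u + length v" for u' v'
    using that
  proof (induction v' arbitrary: u')
    case (Cons b v')
    then have "?A u' (b # v') \<longleftrightarrow> ?A (u' @ [b]) v'" by (intro swap)
    also have "\<dots> \<longleftrightarrow> ?A ((u' @ [b]) @ v') []" using Cons by (intro Cons.IH) simp
    finally show ?case by simp
  qed simp
  show ?case
  proof (cases "\<exists>i<0. x = Dt i")
    case True
    then obtain i where i: "i < 0" "x = Dt i" by blast
    then have "vac \<phi> (word ([] @ x j # u @ v)) = 0" for j
      using vac_negative[of "x j" \<phi> "word (u @ v)"] by (simp add: nonneg_iff mult_single plus_free_mon_def)
    then have "?A [] (u @ v)" by (simp add: shift_act_lincomb)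
    then show ?thesis using slide[of "[]" "u @ v"] slide[of u v] by simp
  next
    case False
    then have nonneg: "x j \<in> lvb_nonneg" for j using less.prems
      by (metis ideal_letter_def lvb_degree.simps nonneg_iff not_le order_refl)
    have "vac \<phi> (word ((u @ v) @ [x j])) = vac \<phi> (word (u @ v)) * hw_scalar \<phi> (x j)" for j
      using vac_char[of "word [x j]" \<phi> "word (u @ v)"] nonneg
      by (simp add: word_append mult.assoc mult.commute[of "hw_scalar _ _"])
    moreover have "annihilates p (\<lambda>j. hw_scalar \<phi> (x j))"
    proof (cases "x = Ct")
      case True
      then show ?thesis using g by (simp add: hw_scalar_def)
    next
      case False
      then obtain i where "x = Dt i" using less.prems by (auto simp: ideal_letter_def)
      then show ?thesis using f by (cases "i = 0") (simp_all add: shift_act_lincomb)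
    qed
    ultimately have "?A (u @ v) []" by (simp add: shift_act_lincomb)
    then show ?thesis using slide[of u v] by simp
  qed
qed

end

text \<open>Both the leading and the constant coefficient of p are nonzero, so the recurrence can be
  solved upwards and downwards from the values at 0, ..., deg p - 1. The coefficients depend on j
  and p but not on the sequence.\<close>

lemma recurrence_basis:
  assumes p: "coeff p 0 \<noteq> 0"
  shows "\<exists>c. \<forall>t. annihilates p t \<longrightarrow> t j = (\<Sum>i<degree p. c i * t (int i))"
proof -
  define G where "G j \<longleftrightarrow> (\<exists>c. \<forall>t. annihilates p t \<longrightarrow> t j = (\<Sum>i<degree p. c i * t (int i)))" for j
  \<comment> \<open>If t j is a fixed combination of values already expressed through the initial
    ones, so is t j itself; the order of the quantifiers keeps the coefficients independent of
    t.\<close>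
  have comb: "G j" if "finite A" and h: "\<And>a. a \<in> A \<Longrightarrow> G (h a)"
    and d: "\<And>t. annihilates p t \<Longrightarrow> t j = (\<Sum>a\<in>A. d a * t (h a))" for j and A :: "nat set" and h d
  proof -
    obtain C where C: "\<And>a t. a \<in> A \<Longrightarrow> annihilates p t \<Longrightarrow> t (h a) = (\<Sum>i<degree p. C a i * t (int i))"
      using h unfolding G_def by metis
    have "t j = (\<Sum>i<degree p. (\<Sum>a\<in>A. d a * C a i) * t (int i))" if t: "annihilates p t" for t
    proof -
      have "t j = (\<Sum>a\<in>A. d a * (\<Sum>i<degree p. C a i * t (int i)))"
        using d[OF t] C[OF _ t] by simp
      also have "\<dots> = (\<Sum>a\<in>A. \<Sum>i<degree p. d a * C a i * t (int i))"
        by (simp add: sum_distrib_left mult.assoc)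
      finally show ?thesis by (subst (asm) sum.swap) (simp add: sum_distrib_right)
    qed
    then show ?thesis
      unfolding G_def by (intro exI[of _ "\<lambda>i. \<Sum>a\<in>A. d a * C a i"] allI impI)
  qed
  have lc: "coeff p (degree p) \<noteq> 0" using p by auto
  have base: "G (int i)" if "i < degree p" for i
    unfolding G_def using that
    by (intro exI[of _ "\<lambda>l. if l = i then 1 else 0"]) (simp add: if_distrib[of "\<lambda>z. z * _"] cong: if_cong)
  have up: "G (int n)" for n
  proof (induction n rule: less_induct)
    case (less n)
    show ?case
    proof (cases "n < degree p")
      case False
      show ?thesis
      proof (rule comb[of "{..<degree p}" "\<lambda>a. int (n - degree p + a)" _ "\<lambda>a. - coeff p a / coeff p (degree p)"])
        show "t (int n) = (\<Sum>a<degree p. - coeff p a / coeff p (degree p) * t (int (n - degree p + a)))"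
          if "annihilates p t" for t
        proof -
          have "0 = (\<Sum>a\<le>degree p. coeff p a * t (int (n - degree p + a)))"
            using that[THEN spec, of "int (n - degree p)"] by (simp add: shift_act_def)
          also have "\<dots> = (\<Sum>a<degree p. coeff p a * t (int (n - degree p + a))) + coeff p (degree p) * t (int n)"
            using False by (simp add: lessThan_Suc_atMost[symmetric])
          finally have "t (int n) * coeff p (degree p) = - (\<Sum>a<degree p. coeff p a * t (int (n - degree p + a)))"
            by (simp add: eq_neg_iff_add_eq_0 mult.commute add.commute)
          then have "t (int n) = - (\<Sum>a<degree p. coeff p a * t (int (n - degree p + a))) / coeff p (degree p)"
            by (rule nonzero_eq_divide_eq[OF lc, THEN iffD2])
          then show ?thesis by (simp add: sum_divide_distrib sum_negf[symmetric])
        qed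
        show "G (int (n - degree p + a))" if "a \<in> {..<degree p}" for a
          by (rule less.IH) (use False that in simp)
      qed simp
    qed (rule base)
  qed
  have down: "G (- int n)" for n
  proof (induction n rule: less_induct)
    case (less n)
    show ?case
    proof (cases "n = 0")
      case False
      show ?thesis
      proof (rule comb[of "{1..degree p}" "\<lambda>a. - int n + int a" _ "\<lambda>a. - coeff p a / coeff p 0"])
        fix a assume "a \<in> {1..degree p}"
        show "G (- int n + int a)"
        proof (cases "a < n")
          case True
          then have "- int n + int a = - int (n - a)" by simp
          moreover have "G (- int (n - a))" by (rule less.IH) (use \<open>a \<in> _\<close> True in simp)
          ultimately show ?thesis by (simp only:)
        next
          case False
          then have "- int n + int a = int (a - n)" by simp
          then show ?thesis using up by metis
        qed
      next
        fix t assume t: "annihilates p t"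
        have "0 = (\<Sum>a\<le>degree p. coeff p a * t (- int n + int a))"
          using t[THEN spec, of "- int n"] by (simp add: shift_act_def)
        also have "\<dots> = coeff p 0 * t (- int n) + (\<Sum>a=1..degree p. coeff p a * t (- int n + int a))"
          by (simp add: atMost_atLeast0 sum.atLeast_Suc_atMost)
        finally have "t (- int n) * coeff p 0 = - (\<Sum>a=1..degree p. coeff p a * t (- int n + int a))"
          by (simp add: eq_neg_iff_add_eq_0 mult.commute)
        then have "t (- int n) = - (\<Sum>a=1..degree p. coeff p a * t (- int n + int a)) / coeff p 0"
          by (rule nonzero_eq_divide_eq[OF p, THEN iffD2])
        then show "t (- int n) = (\<Sum>a=1..degree p. - coeff p a / coeff p 0 * t (- int n + int a))"
          by (simp add: sum_divide_distrib sum_negf[symmetric])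
      qed simp
    qed (use up[of 0] in simp)
  qed
  have "G j"
  proof (cases "0 \<le> j")
    case True
    then show ?thesis using up[of "nat j"] by simp
  next
    case False
    then show ?thesis using down[of "nat (- j)"] by simp
  qed
  then show ?thesis by (simp add: G_def)
qed

text \<open>The exponents of t are confined to 0, ..., D - 1, the powers that span the Laurent
  polynomials modulo a polynomial of degree D with nonzero constant term.\<close>

definition bounded_words :: "nat \<Rightarrow> lvb list \<Rightarrow> lvb list set" where
  "bounded_words D s = {s'. map lvb_degree s' = map lvb_degree s \<and>
     set s' \<subseteq> (\<lambda>(i, j). Dt i j) ` (UNIV \<times> {0..<int D})}"

text \<open>Letters are treated from the right. For each letter in turn, the family obtained by
  varying its exponent is annihilated by p, so the given exponent can be expressed through those
  below deg p.\<close>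

lemma word_vector_bounded:
  assumes p: "coeff p 0 \<noteq> 0" "annihilates p (\<lambda>k. \<phi> (d_t 0 k))" "annihilates p (\<lambda>k. \<phi> (c_t k))"
    and s: "set s \<inter> lvb_nonneg = {}"
  shows "word_vector \<phi> s \<in> fv.span (word_vector \<phi> ` bounded_words (degree p) s)"
  using s
proof (induction s)
  case Nil
  then show ?case by (intro fv.span_base) (simp add: bounded_words_def)
next
  case (Cons b s)
  let ?E = "\<lambda>s. word_vector \<phi> ` bounded_words (degree p) s"
  obtain i j where b: "b = Dt i j" using Cons.prems by (auto elim: negative_letter_cases)
  \<comment> \<open>\<open>T\<close> is the action of the letter \<open>b\<close> on functionals: it
    is linear and puts \<open>b\<close> in front of a word, so it carries the span obtained for
    \<open>s\<close> along.\<close>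
  define T where "T F = (\<lambda>u. F (u @ [b]))" for F :: "lvb list \<Rightarrow> complex"
  have T_word: "T (word_vector \<phi> w) = word_vector \<phi> (b # w)" for w
    by (simp add: T_def word_vector_def)
  have gen: "word_vector \<phi> (b # w) \<in> fv.span (?E (b # s))" if w: "w \<in> bounded_words (degree p) s" for w
  proof -
    obtain c where c: "\<And>t. annihilates p t \<Longrightarrow> t j = (\<Sum>l<degree p. c l * t (int l))"
      using recurrence_basis[OF p(1), of j] by blast
    have "word_vector \<phi> (b # w) = (\<Sum>l<degree p. (\<lambda>u. c l * word_vector \<phi> (Dt i (int l) # w) u))"
    proof
      fix u
      have "annihilates p (\<lambda>j. vac \<phi> (word (u @ Dt i j # w)))"
        by (rule ideal_annihilates[OF p(2,3)]) simp
      from c[OF this] show "word_vector \<phi> (b # w) u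
          = (\<Sum>l<degree p. (\<lambda>u. c l * word_vector \<phi> (Dt i (int l) # w) u)) u"
        by (simp add: word_vector_def b sum_fun_apply)
    qed
    also have "\<dots> \<in> fv.span (?E (b # s))"
    proof (intro fv.span_sum fv.span_scale fv.span_base imageI)
      fix l assume "l \<in> {..<degree p}"
      then show "Dt i (int l) # w \<in> bounded_words (degree p) (b # s)"
        using w by (auto simp: bounded_words_def b image_iff)
    qed
    finally show ?thesis .
  qed
  have "T F \<in> fv.span (?E (b # s))" if "F \<in> fv.span (?E s)" for F
    using that
  proof (induction F rule: fv.span_induct)
    case base
    have T: "T 0 = 0" "T (F + G) = T F + T G" "T (\<lambda>u. c * F u) = (\<lambda>u. c * T F u)" for F G c
      by (simp_all add: T_def fun_eq_iff)
    show ?case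
      by (rule fv.subspaceI) (simp_all add: T fv.span_zero fv.span_add fv.span_scale)
  qed (use gen T_word in auto)
  then have "T (word_vector \<phi> s) \<in> fv.span (?E (b # s))" using Cons by simp
  then show ?case by (simp add: T_word)
qed

lemma weight_space_subspace: "fv.subspace (weight_space (irr_model \<phi>) \<mu>)"
proof (rule fv.subspaceI)
  interpret A: abelian_group "irr_model \<phi>" by (rule irr_model_group)
  have scale: "(\<lambda>u. c * F u) \<in> carrier (irr_model \<phi>)" if "F \<in> carrier (irr_model \<phi>)" for c F
    using lv_spaceD(2)[OF lv_epiD(2)[OF vac_form_epi[of \<phi>]] that, of c] by simp
  fix F assume F: "F \<in> weight_space (irr_model \<phi>) \<mu>"
  show "(\<lambda>u. c * F u) \<in> weight_space (irr_model \<phi>) \<mu>" for c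
    using F scale[of F c] unfolding weight_space_irr by auto
  fix G assume G: "G \<in> weight_space (irr_model \<phi>) \<mu>"
  have "F + G \<in> carrier (irr_model \<phi>)"
    using A.a_closed[of F G] F G by (simp add: weight_space_def)
  moreover have "F u \<noteq> 0 \<or> G u \<noteq> 0" if "(F + G) u \<noteq> 0" for u using that by auto
  ultimately show "F + G \<in> weight_space (irr_model \<phi>) \<mu>"
    using F G unfolding weight_space_irr by blast
next
  interpret A: abelian_group "irr_model \<phi>" by (rule irr_model_group)
  show "0 \<in> weight_space (irr_model \<phi>) \<mu>"
    using A.zero_closed unfolding weight_space_irr by simp
qed

lemma recurrent_harish_chandra:
  assumes "recurrent (\<lambda>k. \<phi> (d_t 0 k))" "recurrent (\<lambda>k. \<phi> (c_t k))"
  shows "harish_chandra (irr_model \<phi>)"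
proof -
  let ?w0 = "\<phi> (d_t 0 0)"
  obtain p where p: "coeff p 0 \<noteq> 0" "annihilates p (\<lambda>k. \<phi> (d_t 0 k))" "annihilates p (\<lambda>k. \<phi> (c_t k))"
  proof -
    obtain q where q: "q \<noteq> 0" "\<And>k. shift_act q (\<lambda>k. \<phi> (d_t 0 k)) k = 0" "\<And>k. shift_act q (\<lambda>k. \<phi> (c_t k)) k = 0"
      using recurrent_common[OF assms] by blast
    from shift_act_unit_constant_term[OF q] that show ?thesis by blast
  qed
  let ?v = "\<lambda>\<kappa>. word_vector \<phi> (sorted_list_of_multiset \<kappa>)"
  have degree_sorted: "word_degree (sorted_list_of_multiset \<kappa>) = mset_degree \<kappa>" for \<kappa>
    by (metis mset_map mset_sorted_list_of_multiset sum_mset_sum_list)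
  have v_degree: "?v \<kappa> u = 0" if "word_degree u \<noteq> - mset_degree \<kappa>" for \<kappa> u
    using word_vector_degree[of \<phi> "sorted_list_of_multiset \<kappa>" u] that degree_sorted by auto
  have "\<exists>F w. finite F \<and> (\<forall>\<mu>\<in>F. w \<mu> \<in> weight_space (irr_model \<phi>) \<mu>)
      \<and> v = (\<Oplus>\<^bsub>irr_model \<phi>\<^esub>\<mu>\<in>F. w \<mu>)" if v: "v \<in> carrier (irr_model \<phi>)" for v
  proof -
    obtain m where m: "v = vac_form \<phi> m" using v by auto
    let ?K = "keys m" and ?g = "\<lambda>\<kappa>. ?w0 + of_int (mset_degree \<kappa>)"
    define h where "h \<kappa> = (\<lambda>u. lookup m \<kappa> * ?v \<kappa> u)" for \<kappa>
    define w where "w \<mu> = (\<Sum>\<kappa>\<in>{\<kappa> \<in> ?K. ?g \<kappa> = \<mu>}. h \<kappa>)" for \<mu>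
    have w: "w \<mu> \<in> weight_space (irr_model \<phi>) \<mu>" for \<mu>
      unfolding w_def h_def
    proof (intro fv.subspace_sum fv.subspace_scale weight_space_subspace)
      fix \<kappa> assume "\<kappa> \<in> {\<kappa> \<in> ?K. ?g \<kappa> = \<mu>}"
      then show "?v \<kappa> \<in> weight_space (irr_model \<phi>) \<mu>"
        using word_vector_weight[of \<phi> "sorted_list_of_multiset \<kappa>"] by (simp add: degree_sorted)
    qed
    have "v = (\<Sum>\<mu>\<in>?g ` ?K. w \<mu>)"
      unfolding m vac_form_expand w_def h_def by (rule sum.group[symmetric]) simp_all
    also have "\<dots> = (\<Oplus>\<^bsub>irr_model \<phi>\<^esub>\<mu>\<in>?g ` ?K. w \<mu>)"
      by (rule finsum_eq_sum[OF irr_model_group, symmetric]) (use w in \<open>simp_all add: weight_space_def\<close>)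
    finally show ?thesis using w by (intro exI[of _ "?g ` ?K"] exI[of _ w]) simp
  qed
  moreover have "finite_dimensional (irr_model \<phi>) (weight_space (irr_model \<phi>) \<mu>)" for \<mu>
  proof -
    let ?W = "weight_space (irr_model \<phi>) \<mu>"
    define S where "S = {s. set s \<inter> lvb_nonneg = {} \<and> ?w0 + of_int (word_degree s) = \<mu>}"
    \<comment> \<open>Different degrees give different weights, so all words of weight \<mu> have
      one degree; if there are none, any \<open>d\<close> will do.\<close>
    obtain d where d: "\<And>s. s \<in> S \<Longrightarrow> word_degree s = d"
    proof (cases "S = {}")
      case False
      then obtain s0 where "s0 \<in> S" by blast
      then have "word_degree s = word_degree s0" if "s \<in> S" for s
        using that unfolding S_def mem_Collect_eq by (metis add_left_cancel of_int_eq_iff)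
      then show ?thesis by (rule that)
    qed (use that in blast)
    \<comment> \<open>In a word of negative letters each letter has degree at most -1. Total degree
      d therefore bounds the length by -d and every single degree from below by d; with bounded
      exponents only finitely many words remain.\<close>
    define L where "L = (\<lambda>(i, j). Dt i j) ` ({d..0} \<times> {0..<int (degree p)})"
    define B where "B = {s. set s \<subseteq> L \<and> length s \<le> nat (- d)} \<inter> {s. ?w0 + of_int (word_degree s) = \<mu>}"
    have "finite B"
      unfolding B_def L_def by (intro finite_Int disjI1 finite_lists_length_le finite_imageI) simp
    have bounded: "bounded_words (degree p) s \<subseteq> B" if s: "s \<in> S" for s
    proof
      fix s' assume s': "s' \<in> bounded_words (degree p) s"
      have neg: "set s \<inter> lvb_nonneg = {}" and deg: "word_degree s = d" using s d[OF s] by (simp_all add: S_def)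
      have len: "int (length s) \<le> - word_degree s" using neg by (induction s) (auto simp: nonneg_iff)
      have letter: "word_degree s \<le> lvb_degree x \<and> lvb_degree x \<le> 0" if "x \<in> set s" for x
      proof -
        have "word_degree s \<le> 0 \<and> (x \<in> set s \<longrightarrow> word_degree s \<le> lvb_degree x \<and> lvb_degree x \<le> 0)"
          using neg by (induction s) (auto simp: nonneg_iff)
        with that show ?thesis by blast
      qed
      have map: "map lvb_degree s' = map lvb_degree s" using s' by (simp add: bounded_words_def)
      have "x \<in> L" if x: "x \<in> set s'" for x
      proof -
        obtain i j where ij: "x = Dt i j" "j \<in> {0..<int (degree p)}"
          using s' x by (auto simp: bounded_words_def)
        have "lvb_degree x \<in> lvb_degree ` set s" using x map by (metis image_eqI set_map)
        then have "i \<in> {d..0}" using letter deg ij(1) by auto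
        then show ?thesis using ij by (auto simp: L_def image_iff)
      qed
      moreover have "length s' = length s" using map by (metis length_map)
      ultimately show "s' \<in> B" using map len deg s by (auto simp: B_def S_def)
    qed
    let ?B = "word_vector \<phi> ` B"
    have "?B \<subseteq> ?W"
    proof (intro image_subsetI)
      fix s assume "s \<in> B"
      then show "word_vector \<phi> s \<in> ?W" using word_vector_weight[of \<phi> s] by (simp add: B_def)
    qed
    moreover have "?W \<subseteq> fv.span ?B"
    proof
      fix F assume F: "F \<in> ?W"
      then obtain m where m: "F = vac_form \<phi> m" "m \<in> carrier (verma_model \<phi>)"
        unfolding weight_space_irr irr_model_simps by blast
      let ?K = "{\<kappa> \<in> keys m. ?w0 + of_int (mset_degree \<kappa>) = \<mu>}"
      \<comment> \<open>A representative m of F may have components of other weights. They drop out: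
        at words u of the degree belonging to \<mu> only monomials of weight \<mu> give a nonzero
        value, and at other words F vanishes anyway.\<close>
      have "F = (\<Sum>\<kappa>\<in>?K. (\<lambda>u. lookup m \<kappa> * ?v \<kappa> u))"
      proof
        fix u
        have F_u: "F u = (\<Sum>\<kappa>\<in>keys m. lookup m \<kappa> * ?v \<kappa> u)"
          unfolding m(1) by (subst vac_form_expand) (simp add: sum_fun_apply)
        have "F u = (\<Sum>\<kappa>\<in>?K. lookup m \<kappa> * ?v \<kappa> u)"
        proof (cases "?w0 - of_int (word_degree u) = \<mu>")
          case True
          have "?v \<kappa> u = 0" if "?w0 + of_int (mset_degree \<kappa>) \<noteq> \<mu>" for \<kappa>
            by (rule v_degree) (use True that in auto)
          then show ?thesis unfolding F_u by (intro sum.mono_neutral_right) auto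
        next
          case False
          then have "F u = 0" using F unfolding weight_space_irr by blast
          moreover have "?v \<kappa> u = 0" if "\<kappa> \<in> ?K" for \<kappa>
            by (rule v_degree) (use False that in auto)
          ultimately show ?thesis by simp
        qed
        then show "F u = (\<Sum>\<kappa>\<in>?K. (\<lambda>u. lookup m \<kappa> * ?v \<kappa> u)) u"
          by (simp add: sum_fun_apply)
      qed
      also have "\<dots> \<in> fv.span ?B"
      proof (intro fv.span_sum fv.span_scale)
        fix \<kappa> assume \<kappa>: "\<kappa> \<in> ?K"
        let ?s = "sorted_list_of_multiset \<kappa>"
        have "set ?s \<inter> lvb_nonneg = {}" using m(2) \<kappa> by auto
        then have "?s \<in> S" using \<kappa> by (simp add: S_def degree_sorted)
        have "?v \<kappa> \<in> fv.span (word_vector \<phi> ` bounded_words (degree p) ?s)"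
          using p \<open>set ?s \<inter> lvb_nonneg = {}\<close> by (intro word_vector_bounded)
        also have "\<dots> \<subseteq> fv.span ?B"
          by (intro fv.span_mono image_mono bounded \<open>?s \<in> S\<close>)
        finally show "?v \<kappa> \<in> fv.span ?B" .
      qed
      finally show "F \<in> fv.span ?B" .
    qed
    moreover have "?W \<subseteq> carrier (irr_model \<phi>)" by (simp add: weight_space_def)
    ultimately show ?thesis using \<open>finite B\<close> by (subst finite_dimensional_irr) (auto intro!: exI[of _ ?B])
  qed
  ultimately show ?thesis unfolding harish_chandra_def by blast
qed

theorem theorem6p6:
  fixes \<phi> :: "lvir \<Rightarrow> complex"
  assumes "lv_zero_form \<phi>"
  shows "(harish_chandra (lv_irreducible_hw \<phi>) \<longleftrightarrow>
           (\<exists>f\<in>exp_polynomial. \<exists>g\<in>exp_polynomial.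
              \<forall>k::int. \<phi> (d_t 0 k) = f k \<and> \<phi> (c_t k) = g k))
       \<and> (lv_reducible (lv_verma \<phi>) \<longleftrightarrow>
           (\<exists>f\<in>exp_polynomial. \<forall>k::int. \<phi> (d_t 0 k) = f k))"
proof -
  have "(\<exists>f\<in>exp_polynomial. \<forall>k. h k = f k) \<longleftrightarrow> recurrent h" for h
    unfolding recurrent_iff_exp_polynomial fun_eq_iff[symmetric] by simp
  moreover have "(\<exists>f\<in>exp_polynomial. \<exists>g\<in>exp_polynomial. \<forall>k. \<phi> (d_t 0 k) = f k \<and> \<phi> (c_t k) = g k)
      \<longleftrightarrow> (\<exists>f\<in>exp_polynomial. \<forall>k. \<phi> (d_t 0 k) = f k) \<and> (\<exists>g\<in>exp_polynomial. \<forall>k. \<phi> (c_t k) = g k)"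
    by blast
  moreover have "harish_chandra (lv_irreducible_hw \<phi>) \<longleftrightarrow> harish_chandra (irr_model \<phi>)"
  proof -
    obtain h where h: "lv_iso h (lv_irreducible_hw \<phi>) (irr_model \<phi>)"
      using lv_irreducible_hw_iso by blast
    show ?thesis
      using lv_iso_harish_chandra[OF h] lv_iso_harish_chandra[OF lv_iso_sym[OF h]] by blast
  qed
  moreover have "lv_reducible (lv_verma \<phi>) \<longleftrightarrow> lv_reducible (verma_model \<phi>)"
    using lv_iso_reducible[OF verma_iso[of \<phi>]] lv_iso_reducible[OF lv_iso_sym[OF verma_iso[of \<phi>]]]
    by blast
  moreover have "harish_chandra (irr_model \<phi>) \<longleftrightarrow>
      recurrent (\<lambda>k. \<phi> (d_t 0 k)) \<and> recurrent (\<lambda>k. \<phi> (c_t k))"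
    using harish_chandra_recurrent recurrent_harish_chandra by blast
  moreover have "lv_reducible (verma_model \<phi>) \<longleftrightarrow> recurrent (\<lambda>k. \<phi> (d_t 0 k))"
    using reducible_recurrent recurrent_reducible by blast
  ultimately show ?thesis by simp
qed

end
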